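(* Let $H\in(1/4,1)$ and consider the degenerate stochastic system on $[0,1]$ $$dX_t=a_t(X_t,Y_t)\,dt,\qquad dY_t=b_t(X_t,Y_t)\,dt+\sigma_t\,dB^H_t,\qquad (X_0,Y_0)=(x_0,y_0)\in\mathbb{R}^m\times\mathbb{R}^n,$$ with $B^H$ an $n$-dimensional fractional Brownian motion of Hurst parameter $H$ and coefficients satisfying Assumption (A) (stated in the context). If there is a constant $C$ such that $$\nabla_y\cdot b_t(x,y)=C\qquad\text{for all }t\in[0,1],\ (x,y)\in\mathbb{R}^m\times\mathbb{R}^n,$$ then the system possesses the path-preservation property: if $(\psi^*,\phi^* )$ is the solution of the deterministic system $\psi'_t=a_t(\psi_t,\phi_t)$, $\phi'_t=b_t(\psi_t,\phi_t)$, $(\psi_0,\phi_0)=(x_0,y_0)$, then $\phi^*$ is a free-terminal most probable path, i.e. $\phi^*-y_0\in\mathcal{H}_H^\sigma([0,1];\mathbb{R}^n)$ and $$J(\phi^* )=\inf_{\phi-y_0\in\mathcal{H}_H^\sigma([0,1];\mathbb{R}^n)}J(\phi),$$ where $J$ is the Onsager--Machlup functional of the system (given in the context).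
   Context: Fractional Brownian motion: $B^H$ has $n$ independent centered Gaussian components with covariance $R_H(t,s)=\frac12(t^{2H}+s^{2H}-|t-s|^{2H})$, realized as $B^H_t=\int_0^tK_H(t,s)\,dW_s$ with $W$ a standard $n$-dimensional Brownian motion and $K_H$ the standard Volterra kernel $K_H(t,s)=c_H(t-s)^{H-1/2}F\big(H-\tfrac12,\tfrac12-H;H+\tfrac12;1-\tfrac ts\big)$, $0<s<t$, with $F$ the Gauss hypergeometric function and $c_H=\big(\frac{2H\Gamma(3/2-H)}{\Gamma(H+1/2)\Gamma(2-2H)}\big)^{1/2}$. Operators: $(K_Hu)(t)=\int_0^tK_H(t,s)u(s)\,ds$ for $u\in L^2([0,1];\mathbb{R}^n)$, and $(K_H^\sigma u)(t)=\int_0^t\sigma_s\,d(K_Hu)(s)$ (Young/Riemann--Stieltjes integral). $K_H^\sigma$ is injective, $\mathcal{H}_H^\sigma([0,1];\mathbb{R}^n):=K_H^\sigma(L^2([0,1];\mathbb{R}^n))$, and $(K_H^\sigma)^{-1}$ is the inverse on this space. Onsager--Machlup functional: for $\phi$ with $\phi-y_0\in\mathcal{H}_H^\sigma([0,1];\mathbb{R}^n)$, let $\psi$ solve $\psi'_t=a_t(\psi_t,\phi_t)$, $\psi_0=x_0$. Then $$J(\phi)=\frac12\int_0^1\Big|(K_H^\sigma)^{-1}\Big(\phi_\cdot-y_0-\int_0^\cdot b_v(\psi_v,\phi_v)\,dv\Big)(s)\Big|^2ds+\frac{d_H}{2}\int_0^1\nabla_y\cdot b_s(\psi_s,\phi_s)\,ds,$$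 with $d_H=\sqrt{2H\,\Gamma(H+1/2)\,\Gamma(3/2-H)/\Gamma(2-2H)}$. Assumption (A): (1) (a) $\sigma_t=\mathrm{diag}(\sigma^1_t,\dots,\sigma^n_t)$ is deterministic, each $\sigma^i\in C^1([0,1])$, and there are constants $m_i,M_i>0$ with $0<m_i\le\sigma^i_t\le M_i$ for all $t$. (b) $b:[0,1]\times\mathbb{R}^m\times\mathbb{R}^n\to\mathbb{R}^n$ is continuous, twice continuously differentiable in $(x,y)$, and globally bounded. (c) $a:[0,1]\times\mathbb{R}^m\times\mathbb{R}^n\to\mathbb{R}^m$ is $C^1$ in $(t,x,y)$ and globally Lipschitz in $(t,x,y)$. (2) If $H\in(1/2,1)$, in addition $b$ is globally Lipschitz in $(t,x,y)$. Definitions: a path $\phi^*$ with $\phi^*-y_0\in\mathcal{H}_H^\sigma$ is a free-terminal most probable path if it minimizes $J$ over all $\phi$ with $\phi-y_0\in\mathcal{H}^\sigma_H$. The system has the path-preservation property if every solution trajectory of the corresponding deterministic (noise-free) system is a free-terminal most probable path. *)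

theory Defs
  imports "HOL-Analysis.Analysis"
begin

section \<open>The Volterra kernel of fractional Brownian motion\<close>

text \<open>
  The kernel evaluates the Gauss hypergeometric function at \<open>1 - t/s < 0\<close>, possibly outside the
  disc of convergence of its series, so the function is the principal branch: the
  (unique) continuation of the series to the complex plane cut along \<open>[1, \<infinity>)\<close>.
\<close>

definition gauss_hypergeometric :: "complex \<Rightarrow> complex \<Rightarrow> complex \<Rightarrow> complex \<Rightarrow> complex" where
  "gauss_hypergeometric a b c =
     (SOME f. f holomorphic_on - (complex_of_real ` {1..}) \<and>
              f has_fps_expansion fps_hypergeo [a, b] [c] 1)"

definition fbm_c :: "real \<Rightarrow> real" where
  "fbm_c H = sqrt (2 * H * Gamma (3/2 - H) / (Gamma (H + 1/2) * Gamma (2 - 2 * H)))"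

definition fbm_d :: "real \<Rightarrow> real" where
  "fbm_d H = sqrt (2 * H * Gamma (H + 1/2) * Gamma (3/2 - H) / Gamma (2 - 2 * H))"

text \<open>Only the values for \<open>0 < s < t\<close> are meaningful and used; there the hypergeometric
  factor is real, so \<open>Re\<close> merely changes the type.\<close>

definition fbm_kernel :: "real \<Rightarrow> real \<Rightarrow> real \<Rightarrow> real" where
  "fbm_kernel H t s = fbm_c H * (t - s) powr (H - 1/2) *
     Re (gauss_hypergeometric (of_real (H - 1/2)) (of_real (1/2 - H)) (of_real (H + 1/2))
           (of_real (1 - t / s)))"

section \<open>The operators and their range\<close>

text \<open>Square-integrable functions on \<open>[0,1]\<close>, as representatives: no quotient by almost-everywhere
  equality is taken.\<close>

definition L2_unit :: "(real \<Rightarrow> 'a::euclidean_space) set" where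
  "L2_unit = {u. set_borel_measurable lborel {0..1} u \<and>
                 set_integrable lborel {0..1} (\<lambda>s. (norm (u s))\<^sup>2)}"

definition K_op :: "real \<Rightarrow> (real \<Rightarrow> real^'n) \<Rightarrow> real \<Rightarrow> real^'n" where
  "K_op H u t = (LBINT s:{0<..<t}. fbm_kernel H t s *\<^sub>R u s)"

text \<open>Riemann--Stieltjes integral of a matrix-valued integrand against a vector-valued
  integrator: limit of the tagged sums as the mesh tends to \<open>0\<close>.\<close>

definition has_RS_integral ::
    "(real \<Rightarrow> real^'n^'k) \<Rightarrow> (real \<Rightarrow> real^'n) \<Rightarrow> real \<Rightarrow> real \<Rightarrow> real^'k \<Rightarrow> bool" where
  "has_RS_integral f g a b I \<longleftrightarrow>
     (\<forall>e>0. \<exists>\<delta>>0. \<forall>p. p tagged_division_of {a..b} \<and> (\<forall>(x, K)\<in>p. Sup K - Inf K < \<delta>) \<longrightarrow>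
        norm ((\<Sum>(x, K)\<in>p. f x *v (g (Sup K) - g (Inf K))) - I) < e)"

definition RS_integral ::
    "(real \<Rightarrow> real^'n^'k) \<Rightarrow> (real \<Rightarrow> real^'n) \<Rightarrow> real \<Rightarrow> real \<Rightarrow> real^'k" where
  "RS_integral f g a b = (THE I. has_RS_integral f g a b I)"

definition K_sigma :: "real \<Rightarrow> (real \<Rightarrow> real^'n^'n) \<Rightarrow> (real \<Rightarrow> real^'n) \<Rightarrow> real \<Rightarrow> real^'n" where
  "K_sigma H \<sigma> u t = RS_integral \<sigma> (K_op H u) 0 t"

text \<open>Paths on \<open>[0,1]\<close> are functions on all reals of which only the values on \<open>[0,1]\<close> matter.\<close>

definition K_sigma_range :: "real \<Rightarrow> (real \<Rightarrow> real^'n^'n) \<Rightarrow> (real \<Rightarrow> real^'n) set" where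
  "K_sigma_range H \<sigma> = {h. \<exists>u\<in>L2_unit. \<forall>t\<in>{0..1}. K_sigma H \<sigma> u t = h t}"

text \<open>The inverse on the range; by injectivity the representative is determined
  up to a null set.\<close>

definition K_sigma_inv ::
    "real \<Rightarrow> (real \<Rightarrow> real^'n^'n) \<Rightarrow> (real \<Rightarrow> real^'n) \<Rightarrow> real \<Rightarrow> real^'n" where
  "K_sigma_inv H \<sigma> h = (SOME u. u \<in> L2_unit \<and> (\<forall>t\<in>{0..1}. K_sigma H \<sigma> u t = h t))"

section \<open>Regularity assumptions\<close>

definition C1_on :: "('a::real_normed_vector \<Rightarrow> 'b::real_normed_vector) \<Rightarrow> 'a set \<Rightarrow> bool" where
  "C1_on f S \<longleftrightarrow> (\<exists>f'. (\<forall>z\<in>S. (f has_derivative blinfun_apply (f' z)) (at z within S)) \<and>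
                       continuous_on S f')"

definition C2_on :: "('a::real_normed_vector \<Rightarrow> 'b::real_normed_vector) \<Rightarrow> 'a set \<Rightarrow> bool" where
  "C2_on f S \<longleftrightarrow> (\<exists>f'. (\<forall>z\<in>S. (f has_derivative blinfun_apply (f' z)) (at z within S)) \<and>
                       C1_on f' S)"

definition divergence :: "(real^'n \<Rightarrow> real^'n) \<Rightarrow> real^'n \<Rightarrow> real" where
  "divergence f y = trace (jacobian f (at y))"

definition assumption_A ::
    "real \<Rightarrow> (real \<Rightarrow> real^'m \<Rightarrow> real^'n \<Rightarrow> real^'m) \<Rightarrow> (real \<Rightarrow> real^'m \<Rightarrow> real^'n \<Rightarrow> real^'n)
      \<Rightarrow> (real \<Rightarrow> real^'n^'n) \<Rightarrow> bool" where
  "assumption_A H a b \<sigma> \<longleftrightarrow>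
     (\<forall>t\<in>{0..1}. \<forall>i j. i \<noteq> j \<longrightarrow> \<sigma> t $ i $ j = 0) \<and>
     (\<forall>i. C1_on (\<lambda>t. \<sigma> t $ i $ i) {0..1} \<and>
          (\<exists>m M. 0 < m \<and> 0 < M \<and> (\<forall>t\<in>{0..1}. m \<le> \<sigma> t $ i $ i \<and> \<sigma> t $ i $ i \<le> M))) \<and>
     continuous_on ({0..1} \<times> UNIV \<times> UNIV) (\<lambda>(t, x, y). b t x y) \<and>
     (\<forall>t\<in>{0..1}. C2_on (\<lambda>(x, y). b t x y) UNIV) \<and>
     (\<exists>B. \<forall>t\<in>{0..1}. \<forall>x y. norm (b t x y) \<le> B) \<and>
     C1_on (\<lambda>(t, x, y). a t x y) ({0..1} \<times> UNIV \<times> UNIV) \<and>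
     (\<exists>L. L-lipschitz_on ({0..1} \<times> UNIV \<times> UNIV) (\<lambda>(t, x, y). a t x y)) \<and>
     (H \<in> {1/2<..<1} \<longrightarrow> (\<exists>L. L-lipschitz_on ({0..1} \<times> UNIV \<times> UNIV) (\<lambda>(t, x, y). b t x y)))"

section \<open>The Onsager--Machlup functional and most probable paths\<close>

definition solves_ode_unit ::
    "(real \<Rightarrow> 'a::real_normed_vector \<Rightarrow> 'a) \<Rightarrow> 'a \<Rightarrow> (real \<Rightarrow> 'a) \<Rightarrow> bool" where
  "solves_ode_unit f z0 z \<longleftrightarrow>
     z 0 = z0 \<and> (\<forall>t\<in>{0..1}. (z has_vector_derivative f t (z t)) (at t within {0..1}))"

definition companion ::
    "(real \<Rightarrow> real^'m \<Rightarrow> real^'n \<Rightarrow> real^'m) \<Rightarrow> real^'m \<Rightarrow> (real \<Rightarrow> real^'n) \<Rightarrow> real \<Rightarrow> real^'m" where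
  "companion a x0 \<phi> = (SOME \<psi>. solves_ode_unit (\<lambda>t x. a t x (\<phi> t)) x0 \<psi>)"

definition admissible ::
    "real \<Rightarrow> (real \<Rightarrow> real^'n^'n) \<Rightarrow> real^'n \<Rightarrow> (real \<Rightarrow> real^'n) set" where
  "admissible H \<sigma> y0 = {\<phi>. (\<lambda>t. \<phi> t - y0) \<in> K_sigma_range H \<sigma>}"

definition OM_functional ::
    "real \<Rightarrow> (real \<Rightarrow> real^'m \<Rightarrow> real^'n \<Rightarrow> real^'m) \<Rightarrow> (real \<Rightarrow> real^'m \<Rightarrow> real^'n \<Rightarrow> real^'n)
      \<Rightarrow> (real \<Rightarrow> real^'n^'n) \<Rightarrow> real^'m \<Rightarrow> real^'n \<Rightarrow> (real \<Rightarrow> real^'n) \<Rightarrow> real" where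
  "OM_functional H a b \<sigma> x0 y0 \<phi> =
     (let \<psi> = companion a x0 \<phi> in
        1/2 * (LBINT s:{0..1}.
                 (norm (K_sigma_inv H \<sigma>
                    (\<lambda>t. \<phi> t - y0 - (LBINT v:{0..t}. b v (\<psi> v) (\<phi> v))) s))\<^sup>2)
        + fbm_d H / 2 * (LBINT s:{0..1}. divergence (\<lambda>y. b s (\<psi> s) y) (\<phi> s)))"

definition free_terminal_most_probable_path ::
    "real \<Rightarrow> (real \<Rightarrow> real^'m \<Rightarrow> real^'n \<Rightarrow> real^'m) \<Rightarrow> (real \<Rightarrow> real^'m \<Rightarrow> real^'n \<Rightarrow> real^'n)
      \<Rightarrow> (real \<Rightarrow> real^'n^'n) \<Rightarrow> real^'m \<Rightarrow> real^'n \<Rightarrow> (real \<Rightarrow> real^'n) \<Rightarrow> bool" where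
  "free_terminal_most_probable_path H a b \<sigma> x0 y0 \<phi> \<longleftrightarrow>
     is_arg_min (OM_functional H a b \<sigma> x0 y0) (\<lambda>\<phi>. \<phi> \<in> admissible H \<sigma> y0) \<phi>"

definition solves_deterministic_system ::
    "(real \<Rightarrow> real^'m \<Rightarrow> real^'n \<Rightarrow> real^'m) \<Rightarrow> (real \<Rightarrow> real^'m \<Rightarrow> real^'n \<Rightarrow> real^'n)
      \<Rightarrow> real^'m \<Rightarrow> real^'n \<Rightarrow> (real \<Rightarrow> real^'m) \<Rightarrow> (real \<Rightarrow> real^'n) \<Rightarrow> bool" where
  "solves_deterministic_system a b x0 y0 \<psi> \<phi> \<longleftrightarrow>
     solves_ode_unit (\<lambda>t (x, y). (a t x y, b t x y)) (x0, y0) (\<lambda>t. (\<psi> t, \<phi> t))"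

text \<open>
  The tuple \<open>(H, a, b, \<sigma>, x0, y0)\<close> represents the stochastic system
  \<open>dX = a(X,Y) dt, dY = b(X,Y) dt + \<sigma> dB\<^sup>H, (X, Y)(0) = (x0, y0)\<close>; the law of the noise
  enters the following notion only through the kernel and the constants attached to \<open>H\<close>.
\<close>

definition path_preserving ::
    "real \<Rightarrow> (real \<Rightarrow> real^'m \<Rightarrow> real^'n \<Rightarrow> real^'m) \<Rightarrow> (real \<Rightarrow> real^'m \<Rightarrow> real^'n \<Rightarrow> real^'n)
      \<Rightarrow> (real \<Rightarrow> real^'n^'n) \<Rightarrow> real^'m \<Rightarrow> real^'n \<Rightarrow> bool" where
  "path_preserving H a b \<sigma> x0 y0 \<longleftrightarrow>
     (\<forall>\<psi> \<phi>. solves_deterministic_system a b x0 y0 \<psi> \<phi> \<longrightarrow>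
        free_terminal_most_probable_path H a b \<sigma> x0 y0 \<phi>)"

end

theory Submission
  imports Defs "HOL-Complex_Analysis.Complex_Analysis"
begin

text \<open>
  For constant divergence the second term of the functional is the same for all paths, so \<open>J\<close> is
  bounded below by it, and a deterministic trajectory attains the bound because the argument of
  the inverse operator vanishes identically on it. Since the inverse is only a choice of
  preimage, this needs the injectivity of \<open>K_sigma\<close>; admissibility of the trajectory needs that
  sufficiently regular \<open>C\<^sup>1\<close> paths lie in its range. With \<open>\<alpha> = \<bar>H - 1/2\<bar>\<close> and
  \<open>\<gamma> = min 1 (2H)\<close>, Euler's integral for the hypergeometric function factorizes the Volterra
  operator, for \<open>H \<noteq> 1/2\<close>, as a constant times
  \<open>I\<^sup>\<gamma> \<circ> r\<^sup>\<alpha> \<circ> I\<^sup>\<alpha> \<circ> s\<^sup>-\<^sup>\<alpha>\<close> in terms of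
  Riemann--Liouville integrals, each factor of which is injective by the semigroup law. The
  outer Stieltjes integral is removed by integration by parts, for which \<open>K_op H u\<close> must be
  continuous; this follows from the scaling of the kernel and Scheffe's lemma.
\<close>

section \<open>Riemann--Liouville integrals\<close>

text \<open>The Volterra operator smooths by order H + 1/2. Below H = 1/2 this order is less than
  one, and primitives of continuous functions lie in its range. Above 1/2 it exceeds one, so the
  derivative of a path must itself have fractional smoothness, which is where the Lipschitz
  condition on b enters. Hence solvability is proved separately in each regime. The hypergeometric
  parameters H - 1/2 and 1/2 - H are \<alpha> and -\<alpha> in one order or the other. Taking
  \<alpha> as the parameter of the Beta weight and -\<alpha> as that of the power of 1 - zx makes
  one factorization serve both regimes; \<gamma> is the remainder H + 1/2 - \<alpha>. At H = 1/2 the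
  weight would not be integrable, but there the kernel is constant. Fractional integrals are left
  unnormalized, so all constants are Beta values; only their being nonzero matters. No regularity is
  asked of the competing paths: their first term is an integral of a nonnegative function, whatever
  the inverse returns on them. All the analysis is spent on the single deterministic
  trajectory.\<close>

lemma Beta_real_pos: "a > 0 \<Longrightarrow> b > 0 \<Longrightarrow> Beta a b > (0::real)"
  unfolding Beta_def by (intro divide_pos_pos mult_pos_pos Gamma_real_pos) auto

lemma nn_integral_Beta_unit:
  fixes a b :: real
  assumes "a > 0" "b > 0"
  shows "(\<integral>\<^sup>+x\<in>{0<..<1}. ennreal (x powr (a - 1) * (1 - x) powr (b - 1)) \<partial>lborel) = ennreal (Beta a b)"
proof -
  have "(\<integral>\<^sup>+x. ennreal (indicator {0..1} x * (x powr (a - 1) * (1 - x) powr (b - 1))) \<partial>lborel) = ennreal (Beta a b)"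
    by (rule nn_integral_has_integral_lebesgue[OF _ has_integral_Beta_real[OF assms]]) auto
  also have "(\<lambda>x. ennreal (indicator {0..1} x * (x powr (a - 1) * (1 - x) powr (b - 1)))) =
     (\<lambda>x. ennreal (x powr (a - 1) * (1 - x) powr (b - 1)) * indicator {0<..<1} x)"
    by (auto simp: fun_eq_iff indicator_def)
  finally show ?thesis .
qed

text \<open>The substitution r = s + (t - s) x reduces this to the unit interval; the two powers and
  the Jacobian contribute t - s to the exponent (a - 1) + (b - 1) + 1. The nonnegative integral is
  used so that finiteness comes together with the value.\<close>

lemma nn_integral_Beta_kernel:
  fixes a b s t :: real
  assumes "a > 0" "b > 0" "s < t"
  shows "(\<integral>\<^sup>+r\<in>{s<..<t}. ennreal ((t - r) powr (a - 1) * (r - s) powr (b - 1)) \<partial>lborel)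
           = ennreal (Beta a b * (t - s) powr (a + b - 1))"
proof -
  let ?g = "\<lambda>x. ennreal (x powr (b - 1) * (1 - x) powr (a - 1)) * indicator {0<..<1} x"
  let ?f = "\<lambda>x. (t - (s + (t - s) * x)) powr (a - 1) * ((s + (t - s) * x) - s) powr (b - 1)"
  have "(\<integral>\<^sup>+r\<in>{s<..<t}. ennreal ((t - r) powr (a - 1) * (r - s) powr (b - 1)) \<partial>lborel)
     = ennreal \<bar>t - s\<bar> * (\<integral>\<^sup>+x. ennreal (?f x) * indicator {s<..<t} (s + (t - s) * x) \<partial>lborel)"
    using assms by (subst nn_integral_real_affine[where c = "t - s" and t = s]) auto
  also have "(\<lambda>x. ennreal (?f x) * indicator {s<..<t} (s + (t - s) * x))
    = (\<lambda>x. ennreal ((t - s) powr (a + b - 2)) * (?g x))"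
  proof
    fix x
    have i: "indicator {s<..<t} (s + (t - s) * x) = (indicator {0<..<1} x :: ennreal)"
      using assms by (auto simp: indicator_def zero_less_mult_iff) (smt (verit) mult_less_cancel_left2)+
    have "?f x = (t - s) powr (a + b - 2) * (x powr (b - 1) * (1 - x) powr (a - 1))"
      if "0 < x" "x < 1"
    proof -
      have "t - (s + (t - s) * x) = (t - s) * (1 - x)" by (simp add: algebra_simps)
      moreover have "(t - s) powr (a + b - 2) = (t - s) powr (a - 1) * (t - s) powr (b - 1)"
        by (simp flip: powr_add)
      ultimately show ?thesis using that assms by (simp add: powr_mult)
    qed
    then show "ennreal (?f x) * indicator {s<..<t} (s + (t - s) * x) = ennreal ((t - s) powr (a + b - 2)) * (?g x)"
      unfolding i by (cases "x \<in> {0<..<1}") (simp_all add: ennreal_mult)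
  qed
  also have "(\<integral>\<^sup>+x. ennreal ((t - s) powr (a + b - 2)) * (?g x) \<partial>lborel) = ennreal ((t - s) powr (a + b - 2)) * ennreal (Beta b a)"
    using assms by (subst nn_integral_cmult) (auto simp: nn_integral_Beta_unit)
  also have "ennreal \<bar>t - s\<bar> * (ennreal ((t - s) powr (a + b - 2)) * ennreal (Beta b a)) = ennreal ((t - s) powr 1 * (t - s) powr (a + b - 2) * Beta b a)"
    using assms by (simp add: ennreal_mult[symmetric] Beta_real_pos less_imp_le mult.assoc)
  also have "(t - s) powr 1 * (t - s) powr (a + b - 2) = (t - s) powr (a + b - 1)"
    by (subst powr_add[symmetric]) simp
  finally show ?thesis by (simp add: Beta_commute mult.commute)
qed

lemma set_integral_eq_nn_integral:
  fixes f :: "'a \<Rightarrow> real"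
  assumes "(\<integral>\<^sup>+x\<in>A. ennreal (f x) \<partial>M) = ennreal c" "c \<ge> 0" "set_borel_measurable M A f" "\<And>x. x \<in> A \<Longrightarrow> f x \<ge> 0"
  shows "set_integrable M A f" "(LINT x:A|M. f x) = c"
proof -
  have *: "(\<integral>\<^sup>+x. ennreal (indicator A x *\<^sub>R f x) \<partial>M) = ennreal c"
    unfolding assms(1)[symmetric] by (intro nn_integral_cong) (auto simp: indicator_def)
  have m: "(\<lambda>x. indicator A x *\<^sub>R f x) \<in> borel_measurable M"
    using assms(3) by (simp add: set_borel_measurable_def)
  have "has_bochner_integral M (\<lambda>x. indicator A x *\<^sub>R f x) c"
    by (rule has_bochner_integral_nn_integral[OF m _ assms(2) *]) (auto simp: indicator_def assms(4))
  then show "set_integrable M A f" "(LINT x:A|M. f x) = c"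
    by (auto simp: has_bochner_integral_iff set_integrable_def set_lebesgue_integral_def)
qed

text \<open>Fubini on the triangle 0 < s < r < t for a nonnegative kernel L acting on a
  vector-valued f. The majorant M of the inner integral makes the double integral absolutely
  convergent. Every composition of integral operators below is computed by this exchange.\<close>

lemma triangle_Fubini:
  fixes L :: "real \<Rightarrow> real \<Rightarrow> real" and f :: "real \<Rightarrow> 'a::euclidean_space"
  assumes L[measurable]: "case_prod L \<in> borel_measurable (borel \<Otimes>\<^sub>M borel)"
    and nonneg: "\<And>r s. 0 < s \<Longrightarrow> s < r \<Longrightarrow> r < t \<Longrightarrow> 0 \<le> L r s"
    and f: "set_borel_measurable borel {0<..<t} f"
    and bound: "\<And>s. 0 < s \<Longrightarrow> s < t \<Longrightarrow> (\<integral>\<^sup>+r\<in>{s<..<t}. ennreal (L r s) \<partial>lborel) \<le> ennreal (M s)"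
    and M: "set_integrable lborel {0<..<t} (\<lambda>s. M s *\<^sub>R norm (f s))" "\<And>s. 0 < s \<Longrightarrow> s < t \<Longrightarrow> 0 \<le> M s"
  shows triangle_integrable: "set_integrable lborel {0<..<t} (\<lambda>r. LBINT s:{0<..<r}. L r s *\<^sub>R f s)"
    and triangle_integral: "(LBINT r:{0<..<t}. LBINT s:{0<..<r}. L r s *\<^sub>R f s) = (LBINT s:{0<..<t}. (LBINT r:{s<..<t}. L r s) *\<^sub>R f s)"
proof -
  let ?m = "\<lambda>s. indicator {0<..<t} s *\<^sub>R (M s * norm (f s))"
  \<comment> \<open>f is only known to be measurable on the interval; its extension by 0 is
    measurable on the line, which makes F measurable on the plane.\<close>
  define g where "g = (\<lambda>s. indicator {0<..<t} s *\<^sub>R f s)"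
  have g[measurable]: "g \<in> borel_measurable borel"
    using f by (simp add: g_def set_borel_measurable_def)
  define F where "F = (\<lambda>s r. (indicator {0<..<t} s * indicator {s<..<t} r * L r s) *\<^sub>R g s)"
  have Fm[measurable]: "case_prod F \<in> borel_measurable (lborel \<Otimes>\<^sub>M lborel)"
  proof -
    have e: "F = (\<lambda>s r. ((if 0 < s \<and> s < t then 1 else 0) * (if s < r \<and> r < t then 1 else 0) * L r s) *\<^sub>R g s)"
      unfolding F_def by (intro ext) (simp add: indicator_def)
    have "case_prod F \<in> borel_measurable (borel \<Otimes>\<^sub>M borel)"
      unfolding e by measurable
    then show ?thesis
      by (subst measurable_cong_sets[OF sets_pair_measure_cong[OF sets_lborel sets_lborel] refl])
  qed
  have nF: "norm (F s r) = indicator {0<..<t} s * indicator {s<..<t} r * L r s * norm (f s)" for s r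
    using nonneg[of s r] by (auto simp: F_def g_def indicator_def)
  have nnF: "(\<integral>\<^sup>+r. ennreal (norm (F s r)) \<partial>lborel) \<le> ennreal (?m s)" for s
  proof (cases "s \<in> {0<..<t}")
    case True
    have "(\<integral>\<^sup>+r. ennreal (norm (F s r)) \<partial>lborel) = (\<integral>\<^sup>+r. ennreal (norm (f s)) * (ennreal (L r s) * indicator {s<..<t} r) \<partial>lborel)"
      unfolding nF using True nonneg[of s]
      by (intro nn_integral_cong) (auto simp: indicator_def ennreal_mult[symmetric] mult.commute)
    also have "\<dots> = ennreal (norm (f s)) * (\<integral>\<^sup>+r. (ennreal (L r s) * indicator {s<..<t} r) \<partial>lborel)"
      by (rule nn_integral_cmult) simp
    also have "\<dots> \<le> ennreal (norm (f s)) * ennreal (M s)"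
      using bound[of s] True by (intro mult_left_mono) auto
    finally show ?thesis using True M(2)[of s] by (simp add: ennreal_mult mult.commute)
  qed (simp add: nF)
  have int: "integrable lborel (F s)" for s
  proof (rule integrableI_bounded)
    show "F s \<in> borel_measurable lborel"
      using measurable_Pair2[OF Fm, of s] by simp
    show "(\<integral>\<^sup>+r. ennreal (norm (F s r)) \<partial>lborel) < \<infinity>"
      using nnF[of s] by (rule order.strict_trans1) simp
  qed
  have intF: "integrable (lborel \<Otimes>\<^sub>M lborel) (case_prod F)"
  proof (rule lborel_pair.Fubini_integrable[OF Fm])
    show "integrable lborel (\<lambda>x. LBINT y. norm (case_prod F (x, y)))"
    proof (rule Bochner_Integration.integrable_bound)
      show "integrable lborel (\<lambda>s. ?m s)"
        using M(1) by (simp add: set_integrable_def)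
      show "(\<lambda>x. LBINT y. norm (case_prod F (x, y))) \<in> borel_measurable lborel" by measurable
      have "(LBINT y. norm (F s y)) \<le> (?m s)" for s
      proof -
        have "ennreal (LBINT y. norm (F s y)) = (\<integral>\<^sup>+r. ennreal (norm (F s r)) \<partial>lborel)"
          by (rule nn_integral_eq_integral[symmetric]) (auto intro: integrable_norm int)
        also note nnF[of s]
        finally show ?thesis using M(2)[of s] by (subst (asm) ennreal_le_iff) (auto simp: indicator_def)
      qed
      then show "AE s in lborel. norm (LBINT y. norm (case_prod F (s, y))) \<le> norm (?m s)"
        by (intro AE_I2) (auto intro!: order.trans[OF _ abs_ge_self])
    qed
  qed (use int in auto)
  have eq1: "(LBINT s. F s r) = indicator {0<..<t} r *\<^sub>R (LBINT s:{0<..<r}. L r s *\<^sub>R f s)" for r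
    unfolding set_lebesgue_integral_def integral_scaleR_right[symmetric]
    by (intro Bochner_Integration.integral_cong) (auto simp: F_def g_def indicator_def)
  have eq2: "(LBINT r. F s r) = indicator {0<..<t} s *\<^sub>R ((LBINT r:{s<..<t}. L r s) *\<^sub>R f s)" for s
  proof -
    have "(LBINT r. F s r) = (LBINT r. (indicator {s<..<t} r *\<^sub>R L r s) *\<^sub>R (indicator {0<..<t} s *\<^sub>R f s))"
      by (intro Bochner_Integration.integral_cong) (auto simp: F_def g_def indicator_def)
    moreover have "integrable lborel (\<lambda>r. indicator {s<..<t} r *\<^sub>R L r s)" if "0 < s" "s < t"
    proof (rule integrableI_bounded)
      have "(\<lambda>r. L r s) \<in> borel_measurable borel" using measurable_Pair1[OF L, of s] by simp
      then show "(\<lambda>r. indicator {s<..<t} r *\<^sub>R L r s) \<in> borel_measurable lborel" by measurable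
      have "(\<integral>\<^sup>+r. ennreal (norm (indicator {s<..<t} r *\<^sub>R L r s)) \<partial>lborel) = (\<integral>\<^sup>+r\<in>{s<..<t}. ennreal (L r s) \<partial>lborel)"
        using nonneg[of s] that by (intro nn_integral_cong) (auto simp: indicator_def)
      also note bound[OF that]
      finally show "(\<integral>\<^sup>+r. ennreal (norm (indicator {s<..<t} r *\<^sub>R L r s)) \<partial>lborel) < \<infinity>"
        by (rule order.strict_trans1) simp
    qed
    ultimately show ?thesis unfolding set_lebesgue_integral_def
      by (cases "s \<in> {0<..<t}") (auto simp: integral_scaleR_left)
  qed
  have "integrable lborel (\<lambda>r. LBINT s. F s r)"
    using lborel_pair.integrable_snd[OF intF] by simp
  then show "set_integrable lborel {0<..<t} (\<lambda>r. LBINT s:{0<..<r}. L r s *\<^sub>R f s)"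
    unfolding set_integrable_def eq1 .
  have "(LBINT r. LBINT s. F s r) = (LBINT s. LBINT r. F s r)"
    by (rule lborel_pair.Fubini_integral[OF intF])
  then show "(LBINT r:{0<..<t}. LBINT s:{0<..<r}. L r s *\<^sub>R f s) = (LBINT s:{0<..<t}. (LBINT r:{s<..<t}. L r s) *\<^sub>R f s)"
    unfolding eq1 eq2 by (simp add: set_lebesgue_integral_def)
qed

section \<open>Measurability and integrability under scalar weights\<close>

lemma set_borel_measurable_scaleR:
  fixes f :: "'a \<Rightarrow> 'b::euclidean_space"
  assumes h: "h \<in> borel_measurable M" and f: "set_borel_measurable M A f"
  shows "set_borel_measurable M A (\<lambda>s. h s *\<^sub>R f s)"
proof -
  have "(\<lambda>s. h s *\<^sub>R (indicator A s *\<^sub>R f s)) \<in> borel_measurable M"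
    using f unfolding set_borel_measurable_def by (intro borel_measurable_scaleR[OF h])
  then show ?thesis by (simp add: set_borel_measurable_def mult.commute)
qed

lemma set_integrable_bounded_scaleR:
  fixes f :: "'a \<Rightarrow> 'b::euclidean_space"
  assumes f: "set_integrable M A f" and h: "h \<in> borel_measurable M" "\<And>s. s \<in> A \<Longrightarrow> \<bar>h s\<bar> \<le> B"
  shows "set_integrable M A (\<lambda>s. h s *\<^sub>R f s)"
  unfolding set_integrable_def
proof (rule Bochner_Integration.integrable_bound)
  show "integrable M (\<lambda>s. B *\<^sub>R (indicator A s *\<^sub>R f s))"
    using f by (intro integrable_scaleR_right) (simp add: set_integrable_def)
  have "set_borel_measurable M A f"
    using f by (auto simp: set_integrable_def set_borel_measurable_def)
  from set_borel_measurable_scaleR[OF h(1) this]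
  show "(\<lambda>s. indicator A s *\<^sub>R (h s *\<^sub>R f s)) \<in> borel_measurable M"
    by (simp add: set_borel_measurable_def)
  have "\<bar>h s\<bar> \<le> \<bar>B\<bar>" if "s \<in> A" for s using h(2)[OF that] by linarith
  then show "AE s in M. norm (indicator A s *\<^sub>R (h s *\<^sub>R f s)) \<le> norm (B *\<^sub>R (indicator A s *\<^sub>R f s))"
    by (intro AE_I2) (auto simp: indicator_def intro!: mult_right_mono)
qed

lemma set_integrable_imp_borel_measurable:
  "set_integrable lborel A f \<Longrightarrow> set_borel_measurable borel A f"
  by (auto simp: set_integrable_def set_borel_measurable_def)

text \<open>The Riemann-Liouville integral of order a without the factor 1 / Gamma a; composition
  rules therefore carry Beta values.\<close>

definition rl_integral :: "real \<Rightarrow> (real \<Rightarrow> 'a::euclidean_space) \<Rightarrow> real \<Rightarrow> 'a" where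
  "rl_integral a f t = (LBINT s:{0<..<t}. (t - s) powr (a - 1) *\<^sub>R f s)"

lemma rl_integral_1: "rl_integral 1 f t = (LBINT s:{0<..<t}. f s)"
  unfolding rl_integral_def by (intro set_lebesgue_integral_cong) auto

lemma rl_integral_cong_AE:
  assumes "AE s in lborel. s \<in> {0<..<t} \<longrightarrow> f s = g s"
    and "set_borel_measurable borel {0<..<t} f" "set_borel_measurable borel {0<..<t} g"
  shows "rl_integral a f t = rl_integral a g t"
proof -
  have m: "(\<lambda>s. indicator {0<..<t} s *\<^sub>R ((t - s) powr (a - 1) *\<^sub>R h s)) \<in> borel_measurable lborel"
    if "set_borel_measurable borel {0<..<t} h" for h :: "real \<Rightarrow> 'a"
    using set_borel_measurable_scaleR[of "\<lambda>s. (t - s) powr (a - 1)" borel, OF _ that]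
    by (simp add: set_borel_measurable_def)
  show ?thesis
    unfolding rl_integral_def set_lebesgue_integral_def
    using assms(1) by (intro integral_cong_AE m assms) (auto simp: indicator_def)
qed

text \<open>After the integrals are exchanged the inner one is the Beta kernel. Integrability of the
  outer integrand is recorded as well: a Bochner integral of a non-integrable function is 0 by
  default, so linearity cannot be used without it.\<close>

lemma rl_integral_semigroup:
  fixes f :: "real \<Rightarrow> 'a::euclidean_space"
  assumes "a > 0" "b > 0" and f: "set_borel_measurable borel {0<..<t} f"
    and int: "set_integrable lborel {0<..<t} (\<lambda>s. (t - s) powr (a + b - 1) *\<^sub>R norm (f s))"
  shows "set_integrable lborel {0<..<t} (\<lambda>r. (t - r) powr (a - 1) *\<^sub>R rl_integral b f r)"
    and "rl_integral a (rl_integral b f) t = Beta a b *\<^sub>R rl_integral (a + b) f t"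
proof -
  let ?L = "\<lambda>r s. (t - r) powr (a - 1) * (r - s) powr (b - 1)"
  let ?M = "\<lambda>s. Beta a b * (t - s) powr (a + b - 1)"
  have pull: "(t - r) powr (a - 1) *\<^sub>R rl_integral b f r = (LBINT s:{0<..<r}. ?L r s *\<^sub>R f s)" for r
    unfolding rl_integral_def set_integral_scaleR_right[symmetric] by simp
  have *: "(\<integral>\<^sup>+r\<in>{s<..<t}. ennreal (?L r s) \<partial>lborel) = ennreal (?M s)" if "s < t" for s
    using nn_integral_Beta_kernel[OF assms(1,2) that] .
  have inner: "(LBINT r:{s<..<t}. ?L r s) = ?M s" if "s < t" for s
    using that assms(1,2) by (intro set_integral_eq_nn_integral[OF *]) (auto simp: Beta_real_pos less_imp_le set_borel_measurable_def)
  have M: "set_integrable lborel {0<..<t} (\<lambda>s. ?M s *\<^sub>R norm (f s))"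
    using set_integrable_mult_right[of "Beta a b", OF int] by (simp add: mult.assoc)
  have T: "case_prod ?L \<in> borel_measurable (borel \<Otimes>\<^sub>M borel)" by measurable
  note tri = triangle_integrable[OF T _ f _ M] triangle_integral[OF T _ f _ M]
  show "set_integrable lborel {0<..<t} (\<lambda>r. (t - r) powr (a - 1) *\<^sub>R rl_integral b f r)"
    unfolding pull using * Beta_real_pos[OF assms(1,2)] by (intro tri(1)) auto
  have "rl_integral a (rl_integral b f) t = (LBINT r:{0<..<t}. LBINT s:{0<..<r}. ?L r s *\<^sub>R f s)"
    by (simp add: rl_integral_def[of a] pull)
  also have "\<dots> = (LBINT s:{0<..<t}. (LBINT r:{s<..<t}. ?L r s) *\<^sub>R f s)"
    using * Beta_real_pos[OF assms(1,2)] by (intro tri(2)) auto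
  also have "\<dots> = (LBINT s:{0<..<t}. Beta a b *\<^sub>R ((t - s) powr (a + b - 1) *\<^sub>R f s))"
    by (intro set_lebesgue_integral_cong) (auto simp: inner)
  finally show "rl_integral a (rl_integral b f) t = Beta a b *\<^sub>R rl_integral (a + b) f t"
    by (simp only: set_integral_scaleR_right rl_integral_def)
qed

lemma set_integrable_powr_mult:
  fixes f :: "real \<Rightarrow> 'a::euclidean_space"
  assumes f: "set_integrable lborel {0<..<t} f" and "c \<ge> 0"
  shows "set_integrable lborel {0<..<t} (\<lambda>s. (t - s) powr c *\<^sub>R f s)"
  using \<open>c \<ge> 0\<close>
  by (intro set_integrable_bounded_scaleR[OF f, where B = "t powr c"]) (auto intro: powr_mono2)

text \<open>The integrability half of the semigroup law with outer order 1, where the outer weight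
  is a zeroth power.\<close>

lemma set_integrable_rl_integral:
  fixes f :: "real \<Rightarrow> 'a::euclidean_space"
  assumes "b > 0" and f: "set_integrable lborel {0<..<t} f"
  shows "set_integrable lborel {0<..<t} (rl_integral b f)"
proof -
  have "set_integrable lborel {0<..<t} (\<lambda>r. (t - r) powr (1 - 1) *\<^sub>R rl_integral b f r)"
    using assms(1) set_integrable_powr_mult[OF set_integrable_norm[OF f], of b]
    by (intro rl_integral_semigroup set_integrable_imp_borel_measurable[OF f]) auto
  then show ?thesis
    by (rule set_integrable_cong[THEN iffD1, rotated -1]) auto
qed

text \<open>Abel's inversion: the orders 1 - a and a add up to 1, leaving an ordinary indefinite
  integral.\<close>

lemma rl_integral_complement:
  fixes f :: "real \<Rightarrow> 'a::euclidean_space"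
  assumes "0 < a" "a < 1" and f: "set_integrable lborel {0<..<t} f"
  shows "rl_integral (1 - a) (rl_integral a f) t = Beta (1 - a) a *\<^sub>R (LBINT s:{0<..<t}. f s)"
  using assms set_integrable_powr_mult[OF set_integrable_norm[OF f], of 0]
  by (subst rl_integral_semigroup(2)) (auto simp: rl_integral_1 intro: set_integrable_imp_borel_measurable[OF f])

text \<open>The half-lines \<open>{..<t}\<close> form an intersection-stable generator of the Borel
  sets. The extension of f by 0 has integral 0 over each of them, Dynkin's argument carries this to
  every Borel set, and a function with vanishing integral over every Borel set is 0 almost
  everywhere.\<close>

lemma AE_zero_if_indefinite_integral_zero:
  fixes f :: "real \<Rightarrow> 'a::euclidean_space"
  assumes f: "set_integrable lborel {0<..<1} f"
    and zero: "\<And>t. t \<in> {0<..1} \<Longrightarrow> (LBINT s:{0<..<t}. f s) = 0"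
  shows "AE s in lborel. s \<in> {0<..<1} \<longrightarrow> f s = 0"
proof -
  define g where "g = (\<lambda>s. indicator {0<..<1} s *\<^sub>R f s)"
  have g: "integrable lborel g" using f by (simp add: g_def set_integrable_def)
  have gA: "set_integrable lborel A g" if "A \<in> sets borel" for A
    unfolding set_integrable_def using that g by (intro integrable_mult_indicator) auto
  have Iio: "(LBINT s:{..<t}. g s) = 0" for t
  proof (cases "t \<le> 0")
    case True
    then have "(LBINT s:{..<t}. g s) = (LBINT s:{..<t}. 0)"
      by (intro set_lebesgue_integral_cong) (auto simp: g_def)
    then show ?thesis by simp
  next
    case False
    have "(LBINT s:{..<t}. g s) = (LBINT s:{0<..<min t 1}. f s)"
      unfolding set_lebesgue_integral_def by (intro Bochner_Integration.integral_cong) (auto simp: g_def indicator_def)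
    then show ?thesis using False by (simp add: zero)
  qed
  \<comment> \<open>Needed for complements in the induction over Borel sets.\<close>
  have tot: "(LBINT s. g s) = 0"
  proof -
    have "(LBINT s. g s) = (LBINT s:{..<1}. g s)"
      unfolding set_lebesgue_integral_def by (intro Bochner_Integration.integral_cong) (auto simp: g_def indicator_def)
    then show ?thesis by (simp add: Iio)
  qed
  have "(LBINT s:A. g s) = 0" if "A \<in> sigma_sets UNIV (range lessThan)" for A
  proof (rule sigma_sets_induct_disjoint[OF _ _ that])
    show "Int_stable (range (lessThan :: real \<Rightarrow> _))"
    proof -
      have "{..<a} \<inter> {..<b} = {..<min a b}" for a b :: real by auto
      then show ?thesis by (auto simp: Int_stable_def)
    qed
    show "(LBINT s:A. g s) = 0" if "A \<in> range lessThan" for A using that Iio by auto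
    show "(LBINT s:{}. g s) = 0" by (simp add: set_lebesgue_integral_def)
    have s: "sigma_sets UNIV (range lessThan) = sets (borel :: real measure)"
      by (simp add: borel_Iio)
    show "(LBINT s:UNIV - A. g s) = 0" if "A \<in> sigma_sets UNIV (range lessThan)" "(LBINT s:A. g s) = 0" for A
    proof -
      have "(LBINT s:A \<union> (UNIV - A). g s) = (LBINT s:A. g s) + (LBINT s:UNIV - A. g s)"
        using that by (intro set_integral_Un gA) (auto simp: s)
      then show ?thesis using tot that by (simp add: set_lebesgue_integral_def)
    qed
    show "(LBINT s:\<Union> (range A). g s) = 0"
      if "disjoint_family A" "range A \<subseteq> sigma_sets UNIV (range lessThan)" "\<And>i. (LBINT s:A i. g s) = 0" for A :: "nat \<Rightarrow> _"
      using that by (subst lebesgue_integral_countable_add) (auto simp: s disjoint_family_on_def intro!: gA)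
  qed simp
  then have "AE s in lborel. g s = 0"
    by (intro sigma_finite_measure.density_zero[OF sigma_finite_lborel g]) (auto simp: borel_Iio)
  then show ?thesis
    by eventually_elim (auto simp: g_def)
qed

text \<open>Applying the complementary order 1 - a to the hypothesis gives a positive multiple of
  the indefinite integral of f. The hypothesis is seen only through that outer integral, so it may
  hold just almost everywhere; this lets several factors be peeled off in turn.\<close>

lemma rl_integral_zero_imp_AE_zero:
  fixes f :: "real \<Rightarrow> 'a::euclidean_space"
  assumes a: "0 < a" "a < 1" and f: "set_integrable lborel {0<..<1} f"
    and zero: "AE r in lborel. r \<in> {0<..<1} \<longrightarrow> rl_integral a f r = 0"
  shows "AE s in lborel. s \<in> {0<..<1} \<longrightarrow> f s = 0"
proof (rule AE_zero_if_indefinite_integral_zero[OF f])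
  fix t :: real assume t: "t \<in> {0<..1}"
  have ft: "set_integrable lborel {0<..<t} f"
    using t by (intro set_integrable_subset[OF f]) auto
  have "Beta (1 - a) a *\<^sub>R (LBINT s:{0<..<t}. f s) = rl_integral (1 - a) (rl_integral a f) t"
    by (rule rl_integral_complement[symmetric, OF a ft])
  also have "\<dots> = rl_integral (1 - a) (\<lambda>_. 0) t"
  proof (rule rl_integral_cong_AE)
    show "AE s in lborel. s \<in> {0<..<t} \<longrightarrow> rl_integral a f s = 0"
      using zero by eventually_elim (use t in auto)
    show "set_borel_measurable borel {0<..<t} (rl_integral a f)"
      by (intro set_integrable_imp_borel_measurable set_integrable_rl_integral a ft)
  qed (simp add: set_borel_measurable_def)
  also have "\<dots> = 0" by (simp add: rl_integral_def)
  finally show "(LBINT s:{0<..<t}. f s) = 0"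
    using Beta_real_pos[of "1 - a" a] a by auto
qed

text \<open>The exponents of r - s, s - q and s sum to -2, which is the condition under which a
  Moebius change of variable turns the integrand into that of a Beta integral: the powers of s
  produced by g, 1 - g and g' combine to s^(-a-b). With a = b this is the kernel computation behind
  the case H < 1/2.\<close>

lemma nn_integral_Beta_weighted:
  fixes a b q r :: real
  assumes "a > 0" "b > 0" "0 < q" "q < r"
  shows "(\<integral>\<^sup>+s\<in>{q<..<r}. ennreal ((r - s) powr (b - 1) * (s - q) powr (a - 1) * s powr - (a + b)) \<partial>lborel)
           = ennreal (Beta a b * (r - q) powr (a + b - 1) * q powr - b * r powr - a)"
proof -
  let ?k = "\<lambda>s. (r - s) powr (b - 1) * (s - q) powr (a - 1) * s powr - (a + b)"
  \<comment> \<open>the Moebius map \<open>g\<close> takes \<open>[q, r]\<close> to \<open>[0, 1]\<close>, with \<open>1 - g s = q (r - s) / (s (r - q))\<close>\<close>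
  define C where "C = (r - q) powr (a + b - 1) * q powr - b * r powr - a"
  define g where "g = (\<lambda>s. r / (r - q) * (1 - q / s))"
  define g' where "g' = (\<lambda>s. r * q / ((r - q) * s\<^sup>2))"
  let ?f = "\<lambda>x. C * (x powr (a - 1) * (1 - x) powr (b - 1))"
  have gq: "g q = 0" "g r = 1" using assms by (auto simp: g_def field_simps)
  have "(\<integral>\<^sup>+x. ennreal (?f x) * indicator {g q..g r} x \<partial>lborel)
     = (\<integral>\<^sup>+s. ennreal (?f (g s) * g' s) * indicator {q..r} s \<partial>lborel)"
    unfolding nn_integral_set_ennreal
  proof (rule nn_integral_substitution)
    show "set_borel_measurable borel {g q..g r} ?f" by (simp add: set_borel_measurable_def)
    show "(g has_real_derivative g' x) (at x)" if "x \<in> {q..r}" for x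
    proof -
      have "((\<lambda>s. 1 - q / s) has_real_derivative q / x\<^sup>2) (at x)"
        using that assms by (auto intro!: derivative_eq_intros simp: power2_eq_square)
      from DERIV_cmult[OF this, of "r / (r - q)"] show ?thesis
        by (simp add: g_def g'_def)
    qed
    show "continuous_on {q..r} g'"
      unfolding g'_def using assms by (intro continuous_intros) auto
  qed (use assms in \<open>auto simp: g'_def\<close>)
  also have "(\<lambda>s. ennreal (?f (g s) * g' s) * indicator {q..r} s)
     = (\<lambda>s. ennreal (?k s) * indicator {q<..<r} s)"
  proof
    fix s
    consider "s \<in> {q<..<r}" | "s = q \<or> s = r" | "s \<notin> {q..r}" by force
    then show "ennreal (?f (g s) * g' s) * indicator {q..r} s
       = ennreal (?k s) * indicator {q<..<r} s"
    proof cases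
      case 1
      have pos: "0 < s - q" "0 < r - s" "0 < s" "0 < r - q" "0 < r" "0 < q" using 1 assms by auto
      have g0: "g s = r * (s - q) / (s * (r - q))"
        using pos by (simp add: g_def field_simps)
      have g1: "1 - g s = q * (r - s) / (s * (r - q))"
        using pos by (simp add: g0 field_simps)
      have "?f (g s) * g' s = ?k s"
      proof -
        \<comment> \<open>Both sides are products of powers of positive quantities, so taking
          logarithms reduces the identity to arithmetic in the exponents.\<close>
        have "ln (?f (g s) * g' s) = ln (?k s)"
          unfolding g1 unfolding g0 g'_def C_def using pos
          by (simp add: ln_mult ln_div ln_powr ln_realpow, simp add: algebra_simps)
        moreover have "?f (g s) * g' s > 0"
          unfolding g1 unfolding g0 g'_def C_def using pos by simp
        ultimately show ?thesis using pos by (subst (asm) ln_inj_iff) auto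
      qed
      then show ?thesis using 1 by simp
    next
      case 2
      then show ?thesis using gq by auto
    next
      case 3
      then show ?thesis by auto
    qed
  qed
  finally have "(\<integral>\<^sup>+s\<in>{q<..<r}. ennreal (?k s) \<partial>lborel)
     = (\<integral>\<^sup>+x. ennreal (?f x) * indicator {0..1} x \<partial>lborel)" by (simp add: gq)
  also have "\<dots> = (\<integral>\<^sup>+x. ennreal C * (ennreal (x powr (a - 1) * (1 - x) powr (b - 1)) * indicator {0<..<1} x) \<partial>lborel)"
  proof (intro nn_integral_cong)
    fix x :: real
    have "C \<ge> 0" using assms by (simp add: C_def)
    then show "ennreal (?f x) * indicator {0..1} x = ennreal C * (ennreal (x powr (a - 1) * (1 - x) powr (b - 1)) * indicator {0<..<1} x)"
      by (auto simp: indicator_def ennreal_mult)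
  qed
  also have "\<dots> = ennreal C * ennreal (Beta a b)"
    using assms by (subst nn_integral_cmult) (auto simp: nn_integral_Beta_unit)
  also have "\<dots> = ennreal (Beta a b * (r - q) powr (a + b - 1) * q powr - b * r powr - a)"
    using Beta_real_pos[OF assms(1,2)] by (simp add: C_def ennreal_mult[symmetric] mult_ac)
  finally show ?thesis .
qed

section \<open>The Euler integral of the hypergeometric function\<close>

text \<open>Differentiation under the integral sign by dominated convergence along sequences: on a
  small ball the mean value inequality bounds every difference quotient by the local majorant B of
  the derivative.\<close>

lemma holomorphic_on_parametric_integral:
  fixes h h' :: "complex \<Rightarrow> 'b \<Rightarrow> complex"
  assumes U: "open U"
    and int: "\<And>z. z \<in> U \<Longrightarrow> integrable M (h z)"
    and m: "\<And>z. z \<in> U \<Longrightarrow> h' z \<in> borel_measurable M"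
    and deriv: "\<And>x z. x \<in> space M \<Longrightarrow> z \<in> U \<Longrightarrow> ((\<lambda>z. h z x) has_field_derivative h' z x) (at z)"
    and bound: "\<And>z. z \<in> U \<Longrightarrow> \<exists>e>0. \<exists>B. integrable M B \<and> (\<forall>w\<in>ball z e. \<forall>x\<in>space M. norm (h' w x) \<le> B x)"
  shows "(\<lambda>z. integral\<^sup>L M (h z)) holomorphic_on U"
proof -
  have "((\<lambda>z. integral\<^sup>L M (h z)) has_field_derivative integral\<^sup>L M (h' z)) (at z)" if z: "z \<in> U" for z
  proof -
    obtain e B where e: "e > 0" and B: "integrable M B"
      and hB: "\<And>w x. w \<in> ball z e \<Longrightarrow> x \<in> space M \<Longrightarrow> norm (h' w x) \<le> B x"
      using bound[OF z] by blast
    obtain e' where e': "e' > 0" "ball z e' \<subseteq> U" using U z by (auto simp: open_contains_ball)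
    define d where "d = min e e'"
    have d: "d > 0" "ball z d \<subseteq> U" "ball z d \<subseteq> ball z e" using e e' by (auto simp: d_def)
    show ?thesis
      unfolding has_field_derivative_iff tendsto_at_iff_sequentially
    proof (intro allI impI)
      fix X :: "nat \<Rightarrow> complex" assume X: "\<forall>i. X i \<in> UNIV - {z}" "X \<longlonglongrightarrow> z"
      \<comment> \<open>Only a tail of X lies in the ball on which B is a majorant, hence the shift
        by N.\<close>
      then obtain N where N: "\<And>n. n \<ge> N \<Longrightarrow> X n \<in> ball z d"
        using d(1) by (metis (no_types, lifting) dist_commute lim_sequentially mem_ball)
      have inU: "X (n + N) \<in> U" for n using N[of "n + N"] d by auto
      let ?q = "\<lambda>n x. (h (X (n + N)) x - h z x) / (X (n + N) - z)"
  let ?Q = "((\<lambda>y. (integral\<^sup>L M (h y) - integral\<^sup>L M (h z)) / (y - z)) \<circ> X)"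
      have "(\<lambda>n. integral\<^sup>L M (?q n)) \<longlonglongrightarrow> integral\<^sup>L M (h' z)"
      proof (rule integral_dominated_convergence[where w = B])
        show "?q n \<in> borel_measurable M" for n
          using int[OF inU[of n]] int[OF z] by measurable
        show "AE x in M. (\<lambda>n. ?q n x) \<longlonglongrightarrow> h' z x"
        proof (intro AE_I2)
          fix x assume x: "x \<in> space M"
          have "((\<lambda>y. (h y x - h z x) / (y - z)) \<circ> X) \<longlonglongrightarrow> h' z x"
            using deriv[OF x z] X unfolding has_field_derivative_iff tendsto_at_iff_sequentially by blast
          then have "(\<lambda>n. ((\<lambda>y. (h y x - h z x) / (y - z)) \<circ> X) (n + N)) \<longlonglongrightarrow> h' z x"
            by (rule LIMSEQ_ignore_initial_segment)
          then show "(\<lambda>n. ?q n x) \<longlonglongrightarrow> h' z x" by (simp add: o_def)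
        qed
        show "AE x in M. norm (?q n x) \<le> B x" for n
        proof (intro AE_I2)
          fix x assume x: "x \<in> space M"
          have "norm (h (X (n + N)) x - h z x) \<le> B x * norm (X (n + N) - z)"
          proof (rule field_differentiable_bound[where S = "ball z d"])
            show "((\<lambda>w. h w x) has_field_derivative h' w x) (at w within ball z d)" if "w \<in> ball z d" for w
            proof -
              have "w \<in> U" using that d(2) by auto
              from deriv[OF x this] show ?thesis by (rule has_field_derivative_at_within)
            qed
            show "norm (h' w x) \<le> B x" if "w \<in> ball z d" for w
              using hB[OF _ x] that d by auto
          qed (use N[of "n + N"] d in auto)
          moreover have "X (n + N) \<noteq> z" using X by auto
          ultimately show "norm (?q n x) \<le> B x" by (simp add: norm_divide divide_le_eq)
        qed
      qed (use m[OF z] B in auto)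
      moreover have "integral\<^sup>L M (?q n) = ?Q (n + N)" for n
        using int[OF inU[of n]] int[OF z] by (simp add: Bochner_Integration.integral_diff)
      ultimately have "(\<lambda>n. ?Q (n + N)) \<longlonglongrightarrow> integral\<^sup>L M (h' z)"
        by (simp only:)
      then show "?Q \<longlonglongrightarrow> integral\<^sup>L M (h' z)"
        by (rule LIMSEQ_offset)
    qed
  qed
  then show ?thesis using U by (auto simp: holomorphic_on_open)
qed

section \<open>Analytic continuation on the cut plane\<close>

abbreviation cut_plane :: "complex set" where
  "cut_plane \<equiv> - (complex_of_real ` {1..})"

lemma open_cut_plane: "open cut_plane"
proof -
  have "complex_of_real ` {1..} = {z. Im z = 0} \<inter> {z. Re z \<ge> 1}"
    by (auto simp: complex_eq_iff intro!: image_eqI[where x = "Re _"])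
  moreover have "closed ({z. Im z = 0} \<inter> {z. Re z \<ge> 1})"
    by (intro closed_Int closed_Collect_eq closed_Collect_le continuous_intros)
  ultimately show ?thesis by (simp only: open_Compl)
qed

text \<open>Keeps 1 - zx off the branch cut of the principal power, so that for each x the integrand
  of Euler's integral is holomorphic in z on the whole cut plane.\<close>

lemma cut_plane_one_minus: 
  assumes "z \<in> cut_plane" "x \<in> {0..1}"
  shows "1 - z * of_real x \<notin> \<real>\<^sub>\<le>\<^sub>0"
proof
  assume "1 - z * of_real x \<in> \<real>\<^sub>\<le>\<^sub>0"
  then obtain c where c: "c \<le> 0" "1 - z * of_real x = of_real c" by (auto simp: nonpos_Reals_def)
  then have zx: "z * of_real x = of_real (1 - c)" by (simp add: algebra_simps)
  have "x \<noteq> 0" using zx c by auto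
  then have "z = of_real ((1 - c) / x)" using zx by (simp add: field_simps)
  moreover have "(1 - c) / x \<ge> 1" using c assms \<open>x \<noteq> 0\<close> by (auto simp: field_simps)
  ultimately show False using assms(1) by blast
qed

text \<open>f itself shows that the choice in the definition succeeds. The chosen function and f
  agree near 0, and the cut plane is star-shaped about 0, hence connected, so the identity theorem
  applies.\<close>

lemma gauss_hypergeometric_eqI:
  assumes f: "f holomorphic_on cut_plane" "f has_fps_expansion fps_hypergeo [a, b] [c] 1"
    and z: "z \<in> cut_plane"
  shows "gauss_hypergeometric a b c z = f z"
proof -
  let ?g = "gauss_hypergeometric a b c"
  have "?g holomorphic_on cut_plane \<and> ?g has_fps_expansion fps_hypergeo [a, b] [c] 1"
    unfolding gauss_hypergeometric_def by (rule someI[where x = f]) (use f in auto)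
  then have g: "?g holomorphic_on cut_plane" "?g has_fps_expansion fps_hypergeo [a, b] [c] 1" by auto
  have "eventually (\<lambda>z. ?g z = f z) (nhds 0)"
    using f(2) g(2) unfolding has_fps_expansion_def by (auto elim: eventually_elim2)
  then obtain S where S: "open S" "0 \<in> S" "\<And>z. z \<in> S \<Longrightarrow> ?g z = f z"
    by (auto simp: eventually_nhds)
  have conn: "connected cut_plane"
  proof (rule starlike_imp_connected)
    show "starlike cut_plane"
      unfolding starlike_def
    proof (intro bexI[of _ 0] ballI subsetI)
      fix w y assume w: "w \<in> cut_plane" and y: "y \<in> closed_segment 0 w"
      then obtain u where u: "0 \<le> u" "u \<le> 1" "y = of_real u * w"
        by (auto simp: closed_segment_def scaleR_conv_of_real)
      show "y \<in> cut_plane"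
      proof
        assume "y \<in> complex_of_real ` {1..}"
        then obtain r where r: "r \<ge> 1" "y = of_real r" by auto
        then have "u \<noteq> 0" using u by auto
        then have "w = of_real (r / u)" using u r by (simp add: field_simps)
        moreover have "r / u \<ge> 1" using u r \<open>u \<noteq> 0\<close> by (auto simp: field_simps)
        ultimately show False using w by blast
      qed
    qed auto
  qed
  show ?thesis
    by (rule analytic_continuation_open[of "S \<inter> cut_plane" cut_plane ?g f])
       (use S g(1) f(1) conn open_cut_plane z in auto)
qed

text \<open>These are the moments of the weight in Euler's integral; the quotient of Pochhammer
  symbols is what enters the hypergeometric coefficients.\<close>

lemma Beta_pochhammer:
  fixes a b :: real
  assumes "a > 0" "b > 0"
  shows "Beta (a + of_nat n) b = Beta a b * pochhammer a n / pochhammer (a + b) n"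
proof -
  have nz: "a \<notin> \<int>\<^sub>\<le>\<^sub>0" "a + b \<notin> \<int>\<^sub>\<le>\<^sub>0" using assms by (auto elim!: nonpos_Ints_cases)
  have G: "Gamma a \<noteq> 0" "Gamma (a + b) \<noteq> 0"
    using nz by (simp_all add: Gamma_eq_zero_iff)
  have "Gamma (a + of_nat n) = pochhammer a n * Gamma a"
    using pochhammer_Gamma[OF nz(1), of n] G by simp
  moreover have "Gamma (a + b + of_nat n) = pochhammer (a + b) n * Gamma (a + b)"
    using pochhammer_Gamma[OF nz(2), of n] G by simp
  ultimately show ?thesis by (simp add: Beta_def add_ac mult_ac)
qed

text \<open>Expanding (1 - zx)^a binomially and integrating termwise against the Beta weight w gives
  the coefficients. The n-th binomial coefficient of a times (-z)^n is (-a)_n z^n / n!, whence the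
  first parameter -a. Holomorphy on the cut plane is read off the integral itself, beyond the disc
  where the series converges.\<close>

lemma euler_integral_hypergeometric:
  fixes a b c :: real
  assumes "0 < b" "b < c" "0 < a" "a < 1"
  defines "w \<equiv> \<lambda>x. indicator {0<..<1} x * (x powr (b - 1) * (1 - x) powr (c - b - 1))"
  defines "F \<equiv> \<lambda>z. of_real (1 / Beta b (c - b)) * (LBINT x. of_real (w x) * (1 - z * of_real x) powr of_real a)"
  shows "F holomorphic_on cut_plane"
    and "F has_fps_expansion fps_hypergeo [of_real (- a), of_real b] [of_real c] 1"
proof -
  have wm[measurable]: "w \<in> borel_measurable borel" unfolding w_def by measurable
  have w0: "w x \<ge> 0" for x by (auto simp: w_def indicator_def)
  have hbw: "has_bochner_integral lborel (\<lambda>x. w x * x ^ n) (Beta (b + of_nat n) (c - b))" for n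
  proof -
    have p: "x powr (b - 1) * x ^ n = x powr (b + of_nat n - 1)" if "x > 0" for x
      using that by (simp add: powr_realpow[symmetric] powr_add[symmetric] algebra_simps)
    have e: "ennreal (w x * x ^ n) = ennreal (x powr (b + of_nat n - 1) * (1 - x) powr (c - b - 1)) * indicator {0<..<1} x" for x
      using p[of x] by (auto simp: w_def indicator_def mult_ac)
    show ?thesis
    proof (rule has_bochner_integral_nn_integral)
      show "(\<integral>\<^sup>+x. ennreal (w x * x ^ n) \<partial>lborel) = ennreal (Beta (b + of_nat n) (c - b))"
        unfolding e using assms by (intro nn_integral_Beta_unit) auto
      show "AE x in lborel. 0 \<le> w x * x ^ n" by (auto simp: w_def indicator_def)
      show "0 \<le> Beta (b + of_nat n) (c - b)" using assms by (intro less_imp_le Beta_real_pos) auto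
    qed simp
  qed
  have wint: "integrable lborel w" using hbw[of 0] by (simp add: has_bochner_integral_iff)
  define h where "h = (\<lambda>z x. complex_of_real (w x) * (1 - z * of_real x) powr of_real a)"
  define h' where "h' = (\<lambda>z x. complex_of_real (w x) * (of_real a * (1 - z * of_real x) powr (of_real a - 1) * (- of_real x)))"
  \<comment> \<open>A factor continuous in (z, x) is bounded for z in a compact set and x in [0, 1],
    so a constant multiple of w is a majorant uniformly in z.\<close>
  have dom: "\<exists>B. \<forall>x\<in>{0..1}. \<forall>z\<in>K. norm (g z x) \<le> B"
    if "compact K" "continuous_on (K \<times> {0..1}) (\<lambda>(z, x). g z x)" for g :: "complex \<Rightarrow> real \<Rightarrow> complex" and K
  proof -
    have "compact ((\<lambda>(z, x). g z x) ` (K \<times> {0..1}))"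
      using that by (intro compact_continuous_image compact_Times) auto
    then have "bounded ((\<lambda>(z, x). g z x) ` (K \<times> {0..1}))" by (rule compact_imp_bounded)
    then show ?thesis unfolding bounded_iff by fastforce
  qed
  have cont: "continuous_on (K \<times> {0..1}) (\<lambda>(z, x). (1 - z * of_real x) powr e)" if "K \<subseteq> cut_plane" for K and e :: complex
  proof -
    have nz: "1 - z * of_real x \<notin> \<real>\<^sub>\<le>\<^sub>0" if "z \<in> K" "x \<in> {0..1}" for z x
      using cut_plane_one_minus that \<open>K \<subseteq> cut_plane\<close> by blast
    then have nz': "1 - z * of_real x \<noteq> 0" if "z \<in> K" "x \<in> {0..1}" for z x
      using that by (metis nonpos_Reals_zero_I)
    have "continuous_on (K \<times> {0..1}) (\<lambda>p. exp (e * Ln (1 - fst p * of_real (snd p))))"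
      by (intro continuous_intros) (use nz in auto)
    then show ?thesis
      by (rule continuous_on_eq) (use nz' in \<open>auto simp: powr_def\<close>)
  qed
  have wout: "w x = 0" if "x \<notin> {0..1}" for x using that by (auto simp: w_def)
  have hint: "integrable lborel (h z)" if "z \<in> cut_plane" for z
  proof -
    have "\<exists>B. \<forall>x\<in>{0..1}. \<forall>z'\<in>{z}. norm ((1 - z' * of_real x) powr of_real a) \<le> B"
      using that by (intro dom cont) auto
    then obtain B where B: "\<And>x. x \<in> {0..1} \<Longrightarrow> norm ((1 - z * of_real x) powr of_real a) \<le> B" by blast
    show ?thesis
    proof (rule Bochner_Integration.integrable_bound)
      show "integrable lborel (\<lambda>x. w x * B)" using wint by simp
      show "h z \<in> borel_measurable lborel" unfolding h_def by measurable
      have "norm (h z x) \<le> norm (w x * B)" for x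
      proof (cases "x \<in> {0..1}")
        case True
        have "norm (h z x) \<le> w x * B"
          unfolding h_def norm_mult using B[OF True] w0[of x] by (auto intro: mult_left_mono)
        then show ?thesis by simp
      qed (simp add: h_def wout)
      then show "AE x in lborel. norm (h z x) \<le> norm (w x * B)" by simp
    qed
  qed
  have "(\<lambda>z. integral\<^sup>L lborel (h z)) holomorphic_on cut_plane"
  proof (rule holomorphic_on_parametric_integral[where h' = h'])
    show "h' z \<in> borel_measurable lborel" for z unfolding h'_def by measurable
    show "((\<lambda>z. h z x) has_field_derivative h' z x) (at z)" if "z \<in> cut_plane" for x z
    proof (cases "x \<in> {0..1}")
      case True
      show ?thesis unfolding h_def h'_def using cut_plane_one_minus[OF that True]
        by (auto intro!: derivative_eq_intros)
    qed (simp add: h_def h'_def wout)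
    show "\<exists>e>0. \<exists>B. integrable lborel B \<and> (\<forall>w\<in>ball z e. \<forall>x\<in>space lborel. norm (h' w x) \<le> B x)" if z: "z \<in> cut_plane" for z
    proof -
      obtain e where e: "e > 0" "cball z e \<subseteq> cut_plane"
        using open_cut_plane z open_contains_cball by blast
      have "\<exists>B. \<forall>x\<in>{0..1}. \<forall>z\<in>cball z e. norm (of_real a * (1 - z * of_real x) powr (of_real a - 1) * (- of_real x)) \<le> B"
        using cont[OF e(2), of "of_real a - 1"] unfolding case_prod_unfold
        by (intro dom) (auto simp: case_prod_unfold intro!: continuous_intros)
      then obtain B where B: "\<And>x z'. x \<in> {0..1} \<Longrightarrow> z' \<in> cball z e \<Longrightarrow> norm (of_real a * (1 - z' * of_real x) powr (of_real a - 1) * (- complex_of_real x)) \<le> B" by blast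
      show ?thesis
      proof (intro exI conjI ballI)
        show "integrable lborel (\<lambda>x. w x * B)" using wint by simp
        show "norm (h' z' x) \<le> w x * B" if "z' \<in> ball z e" for z' x
        proof (cases "x \<in> {0..1}")
          case True
          then show ?thesis
            unfolding h'_def norm_mult[of "of_real (w x)"] using B[OF True, of z'] that w0[of x] by (auto intro!: mult_left_mono)
        qed (simp add: h'_def wout)
      qed (rule e(1))
    qed
  qed (use hint open_cut_plane in auto)
  then show "F holomorphic_on cut_plane"
    unfolding F_def h_def by (intro holomorphic_intros)
  show "F has_fps_expansion fps_hypergeo [of_real (- a), of_real b] [of_real c] 1"
  proof -
    let ?G = "fps_hypergeo [of_real (- a), of_real b] [of_real c] 1 :: complex fps"
    have B0: "Beta b (c - b) > 0" using assms by (intro Beta_real_pos) auto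
    have "(\<lambda>n. ?G $ n * z ^ n) sums F z" if z: "norm z < 1" for z :: complex
    proof -
      let ?f = "\<lambda>n x. ((of_real a gchoose n) * (- z) ^ n) * complex_of_real (w x * x ^ n)"
      have fi: "has_bochner_integral lborel (?f n) (((of_real a gchoose n) * (- z) ^ n) * of_real (Beta (b + of_nat n) (c - b)))" for n
        by (intro has_bochner_integral_mult_right has_bochner_integral_of_real hbw)
      have fsum: "?f n x = of_real (w x) * ((of_real a gchoose n) * (- (z * of_real x)) ^ n)" for n x
        by (simp add: power_mult_distrib power_minus[of "z * of_real x"] power_minus[of z])
      \<comment> \<open>The point (norm y + 1) / 2 lies strictly between norm y and 1; convergence
        of the power series there gives absolute convergence at y.\<close>
      have abs_sum: "summable (\<lambda>n. norm (((of_real a :: complex) gchoose n) * y ^ n))" if "norm y < 1" for y :: complex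
      proof (rule powser_insidea)
        show "summable (\<lambda>n. ((of_real a :: complex) gchoose n) * (of_real ((norm y + 1) / 2)) ^ n)"
          using gen_binomial_complex[of "of_real ((norm y + 1) / 2)" "of_real a"] that
          by (simp only: norm_of_real) (auto simp: sums_iff)
        show "norm y < norm (complex_of_real ((norm y + 1) / 2))"
          using that by (simp only: norm_of_real) auto
      qed
      have zx: "norm (- (z * of_real x)) < 1" if "x \<in> {0..1}" for x
      proof -
        have "norm z * \<bar>x\<bar> \<le> norm z * 1" using that by (intro mult_left_mono) auto
        then show ?thesis using z by (simp add: norm_mult)
      qed
      have "(\<lambda>n. integral\<^sup>L lborel (?f n)) sums (LBINT x. \<Sum>n. ?f n x)"
      proof (rule sums_integral)
        show "integrable lborel (?f n)" for n using fi[of n] by (simp add: has_bochner_integral_iff)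
        have "summable (\<lambda>n. norm (?f n x))" for x
        proof (cases "x \<in> {0..1}")
          case True
          show ?thesis unfolding fsum norm_mult[of "of_real (w x)"]
            by (intro summable_mult abs_sum zx True)
        qed (simp add: wout)
        then show "AE x in lborel. summable (\<lambda>n. norm (?f n x))" by simp
        show "summable (\<lambda>n. LBINT x. norm (?f n x))"
        proof (rule summable_comparison_test_ev)
          show "summable (\<lambda>n. Beta b (c - b) * norm ((of_real a gchoose n) * (- z) ^ n))"
            using z by (intro summable_mult abs_sum) auto
          have "norm (LBINT x. norm (?f n x)) \<le> Beta b (c - b) * norm ((of_real a gchoose n) * (- z) ^ n)" for n
          proof -
            have "norm (?f n x) = norm ((of_real a gchoose n) * (- z) ^ n) * (w x * x ^ n)" for x
              unfolding norm_mult[of "(of_real a gchoose n) * (- z) ^ n"] norm_of_real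
              using w0[of x] by (auto simp: w_def indicator_def)
            then have "(LBINT x. norm (?f n x)) = norm ((of_real a gchoose n) * (- z) ^ n) * Beta (b + of_nat n) (c - b)"
              using hbw[of n] by (simp add: has_bochner_integral_iff)
            \<comment> \<open>Since x^n is at most 1 on the support of w, the moments are bounded by
              the zeroth one, and the absolute binomial series at -z dominates.\<close>
            moreover have "Beta (b + of_nat n) (c - b) \<le> Beta b (c - b)"
            proof -
              have "(LBINT x. w x * x ^ n) \<le> (LBINT x. w x)"
                using hbw[of n] wint w0
                by (intro integral_mono) (auto simp: has_bochner_integral_iff w_def indicator_def intro!: mult_left_le power_le_one)
              then show ?thesis using hbw[of n] hbw[of 0] by (simp add: has_bochner_integral_iff)
            qed
            moreover have "Beta (b + of_nat n) (c - b) > 0" using assms by (intro Beta_real_pos) auto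
            ultimately show ?thesis by (simp add: abs_mult mult.commute mult_right_mono)
          qed
          then show "eventually (\<lambda>n. norm (LBINT x. norm (?f n x)) \<le> Beta b (c - b) * norm ((of_real a gchoose n) * (- z) ^ n)) sequentially"
            by simp
        qed
      qed
      moreover have "(\<Sum>n. ?f n x) = of_real (w x) * (1 - z * of_real x) powr of_real a" for x
      proof (cases "x \<in> {0..1}")
        case True
        show ?thesis unfolding fsum
          using sums_mult[OF gen_binomial_complex[OF zx[OF True], of "of_real a"], of "of_real (w x)"]
          by (simp add: sums_iff)
      qed (simp add: wout)
      ultimately have "(\<lambda>n. of_real (1 / Beta b (c - b)) * integral\<^sup>L lborel (?f n)) sums F z"
        unfolding F_def by (intro sums_mult) simp
      moreover have "of_real (1 / Beta b (c - b)) * integral\<^sup>L lborel (?f n) = ?G $ n * z ^ n" for n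
      proof -
        have "integral\<^sup>L lborel (?f n) = ((of_real a gchoose n) * (- z) ^ n) * of_real (Beta b (c - b) * pochhammer b n / pochhammer c n)"
          using fi[of n] Beta_pochhammer[of b "c - b" n] assms by (simp add: has_bochner_integral_iff)
        moreover have "(of_real a gchoose n) * (- z) ^ n = pochhammer (of_real (- a)) n / fact n * z ^ n"
          by (simp add: gbinomial_pochhammer power_minus[of z])
        ultimately show ?thesis using B0 
          by (simp add: pochhammer_of_real mult_ac)
      qed
      ultimately show ?thesis by simp
    qed
    moreover have "eventually (\<lambda>z. norm z < 1) (nhds (0::complex))"
      using eventually_nhds_in_open[of "ball 0 1" "0 :: complex"] by (simp add: dist_norm)
    ultimately show ?thesis
      by (intro has_fps_expansionI) (auto elim: eventually_mono)
  qed
qed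

section \<open>The kernel of fractional Brownian motion\<close>

lemma set_integrable_scaleR_L2:
  fixes f :: "'a \<Rightarrow> real" and g :: "'a \<Rightarrow> 'b::euclidean_space"
  assumes "set_borel_measurable M A f" "set_borel_measurable M A g"
    and "set_integrable M A (\<lambda>x. (f x)\<^sup>2)" "set_integrable M A (\<lambda>x. (norm (g x))\<^sup>2)"
  shows "set_integrable M A (\<lambda>x. f x *\<^sub>R g x)"
  unfolding set_integrable_def
proof (rule Bochner_Integration.integrable_bound)
  have [measurable]: "(\<lambda>x. indicator A x *\<^sub>R f x) \<in> borel_measurable M" "(\<lambda>x. indicator A x *\<^sub>R g x) \<in> borel_measurable M"
    using assms by (auto simp: set_borel_measurable_def)
  have "(\<lambda>x. (indicator A x *\<^sub>R f x) *\<^sub>R (indicator A x *\<^sub>R g x)) \<in> borel_measurable M" by measurable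
  also have "(\<lambda>x. (indicator A x *\<^sub>R f x) *\<^sub>R (indicator A x *\<^sub>R g x)) = (\<lambda>x. indicator A x *\<^sub>R f x *\<^sub>R g x)"
    by (auto simp: fun_eq_iff indicator_def)
  finally show "(\<lambda>x. indicator A x *\<^sub>R f x *\<^sub>R g x) \<in> borel_measurable M" .
  show "integrable M (\<lambda>x. indicator A x *\<^sub>R (f x)\<^sup>2 + indicator A x *\<^sub>R (norm (g x))\<^sup>2)"
    using assms by (intro Bochner_Integration.integrable_add) (auto simp: set_integrable_def)
  have "\<bar>f x\<bar> * norm (g x) \<le> (f x)\<^sup>2 + (norm (g x))\<^sup>2" for x
  proof -
    have "0 \<le> (\<bar>f x\<bar> - norm (g x))\<^sup>2" "0 \<le> \<bar>f x\<bar> * norm (g x)" by simp_all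
    then show ?thesis unfolding power2_diff power2_abs by linarith
  qed
  then show "AE x in M. norm (indicator A x *\<^sub>R f x *\<^sub>R g x) \<le> norm (indicator A x *\<^sub>R (f x)\<^sup>2 + indicator A x *\<^sub>R (norm (g x))\<^sup>2)"
    by (intro AE_I2) (auto simp: indicator_def)
qed

lemma set_integral_Beta:
  fixes a b t :: real
  assumes "a > 0" "b > 0" "t > 0"
  shows "set_integrable lborel {0<..<t} (\<lambda>r. (t - r) powr (a - 1) * r powr (b - 1))"
    and "(LBINT r:{0<..<t}. (t - r) powr (a - 1) * r powr (b - 1)) = Beta a b * t powr (a + b - 1)"
  using set_integral_eq_nn_integral[OF nn_integral_Beta_kernel[of a b 0 t]] assms
  by (auto simp: Beta_real_pos less_imp_le set_borel_measurable_def)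

definition fbm_alpha :: "real \<Rightarrow> real" where "fbm_alpha H = \<bar>H - 1/2\<bar>"
definition fbm_gamma :: "real \<Rightarrow> real" where "fbm_gamma H = min 1 (2 * H)"

text \<open>The kernel of the composition of fractional integrals and power weights once the inner
  and outer integrations have been exchanged.\<close>

definition volterra_kernel :: "real \<Rightarrow> real \<Rightarrow> real \<Rightarrow> real" where
  "volterra_kernel H t s = (LBINT r:{s<..<t}. (t - r) powr (fbm_gamma H - 1) * r powr fbm_alpha H *
     (r - s) powr (fbm_alpha H - 1) * s powr - fbm_alpha H)"

lemma fps_hypergeo_commute: "fps_hypergeo [a, b] cs z = fps_hypergeo [b, a] cs z"
  by (simp add: fps_eq_iff mult.commute)

text \<open>Euler's integral needs a positive second parameter. The coefficients are symmetric in
  the first two parameters, so \<alpha> can take that place on either side of H = 1/2, and the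
  remaining exponent parameter c - b is H + 1/2 - \<alpha> = \<gamma>.\<close>

lemma fbm_hypergeometric_euler:
  assumes "0 < H" "H < 1" "H \<noteq> 1/2" 
  defines "\<alpha> \<equiv> fbm_alpha H" and "\<gamma> \<equiv> fbm_gamma H"
  defines "F \<equiv> \<lambda>z. of_real (1 / Beta \<alpha> \<gamma>) *
     (LBINT x. of_real (indicator {0<..<1} x * (x powr (\<alpha> - 1) * (1 - x) powr (\<gamma> - 1))) * (1 - z * of_real x) powr of_real \<alpha>)"
  shows "F holomorphic_on cut_plane"
    and "F has_fps_expansion fps_hypergeo [of_real (H - 1/2), of_real (1/2 - H)] [of_real (H + 1/2)] 1"
proof -
  have c: "H + 1/2 - \<alpha> = \<gamma>" by (auto simp: \<alpha>_def \<gamma>_def fbm_alpha_def fbm_gamma_def)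
  have r: "0 < \<alpha>" "\<alpha> < H + 1/2" "\<alpha> < 1" using assms by (auto simp: \<alpha>_def fbm_alpha_def)
  note e = euler_integral_hypergeometric[of \<alpha> "H + 1/2" \<alpha>, unfolded c, OF r(1) r(2) r(1) r(3)]
  show "F holomorphic_on cut_plane" unfolding F_def by (rule e(1))
  have "fps_hypergeo [of_real (- \<alpha>), of_real \<alpha>] [of_real (H + 1/2)] 1
    = fps_hypergeo [of_real (H - 1/2), of_real (1/2 - H)] [complex_of_real (H + 1/2)] 1"
  proof (cases "H > 1/2")
    case True
    then show ?thesis
      by (subst fps_hypergeo_commute) (simp add: \<alpha>_def fbm_alpha_def)
  qed (simp add: \<alpha>_def fbm_alpha_def)
  then show "F has_fps_expansion fps_hypergeo [of_real (H - 1/2), of_real (1/2 - H)] [of_real (H + 1/2)] 1"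
    using e(2) unfolding F_def by simp
qed

text \<open>The case H = 1/2: both numerator parameters vanish and Euler's weight would be x^(-1)
  near 0, so the function is identified directly.\<close>

lemma one_has_fps_expansion_hypergeo_zero:
  "(\<lambda>_. 1) has_fps_expansion fps_hypergeo [0, 0] [1] (1 :: complex)"
proof -
  have "fps_hypergeo [0, 0] [1] (1 :: complex) = 1"
    by (auto simp: fps_eq_iff pochhammer_0_left)
  then show ?thesis using has_fps_expansion_1 by simp
qed

lemma fbm_hypergeometric_holomorphic:
  assumes "0 < H" "H < 1"
  shows "gauss_hypergeometric (of_real (H - 1/2)) (of_real (1/2 - H)) (of_real (H + 1/2)) holomorphic_on cut_plane"
proof -
  have "\<exists>f. f holomorphic_on cut_plane \<and>
     f has_fps_expansion fps_hypergeo [of_real (H - 1/2), of_real (1/2 - H)] [complex_of_real (H + 1/2)] 1"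
  proof (cases "H = 1/2")
    case True
    show ?thesis unfolding True
      using one_has_fps_expansion_hypergeo_zero by (intro exI[of _ "\<lambda>_. 1"]) simp
  qed (use fbm_hypergeometric_euler assms in blast)
  then show ?thesis unfolding gauss_hypergeometric_def by (rule someI2_ex) blast
qed

lemma one_minus_quotient_in_cut_plane:
  assumes "0 < s" "s < t"
  shows "complex_of_real (1 - t / s) \<in> cut_plane"
  unfolding Compl_iff inj_image_mem_iff[OF inj_of_real] using assms by (simp add: not_le)

lemma fbm_kernel_half: 
  assumes "0 < s" "s < t"
  shows "fbm_kernel (1/2) t s = fbm_c (1/2)"
proof -
  have "gauss_hypergeometric 0 0 1 (of_real (1 - t / s)) = 1"
    using one_has_fps_expansion_hypergeo_zero one_minus_quotient_in_cut_plane[OF assms]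
    by (intro gauss_hypergeometric_eqI) auto
  then show ?thesis using assms by (simp add: fbm_kernel_def)
qed

lemma fbm_c_pos: "0 < H \<Longrightarrow> H < 1 \<Longrightarrow> fbm_c H > 0"
  unfolding fbm_c_def by (intro real_sqrt_gt_zero divide_pos_pos mult_pos_pos Gamma_real_pos) auto

text \<open>The bound \<alpha> < 1/2 makes s^(-\<alpha>) square integrable at 0, and \<gamma> +
  \<alpha> = H + 1/2 fixes the power of t - s in the kernel.\<close>

lemma fbm_exponents:
  assumes "0 < H" "H < 1"
  shows "0 \<le> fbm_alpha H" "fbm_alpha H < 1/2" "0 < fbm_gamma H" "fbm_gamma H \<le> 1"
    "fbm_gamma H + fbm_alpha H = H + 1/2" "H \<noteq> 1/2 \<Longrightarrow> 0 < fbm_alpha H"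
  using assms by (auto simp: fbm_alpha_def fbm_gamma_def abs_if)

text \<open>Substituting r = s + (t - s) x = s (1 + (t/s - 1) x) turns the weight (r/s)^\<alpha>
  into Euler's factor (1 - zx)^\<alpha> at z = 1 - t/s. The powers of t - s, with exponents \<gamma>
  - 1, \<alpha> - 1 and 1 from the Jacobian, add up to H - 1/2, the prefactor in the definition of
  the kernel.\<close>

lemma fbm_kernel_eq_volterra:
  assumes H: "0 < H" "H < 1" "H \<noteq> 1/2" and st: "0 < s" "s < t"
  shows "fbm_kernel H t s = fbm_c H / Beta (fbm_alpha H) (fbm_gamma H) * volterra_kernel H t s"
proof -
  let ?p = "\<lambda>x. 1 + (t / s - 1) * x"
  define \<alpha> \<gamma> where "\<alpha> = fbm_alpha H" and "\<gamma> = fbm_gamma H"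
  have ag: "\<gamma> + \<alpha> = H + 1/2" "0 < \<alpha>" using fbm_exponents[OF H(1,2)] H(3) by (auto simp: \<alpha>_def \<gamma>_def)
  define w where "w = (\<lambda>x :: real. indicator {0<..<1} x * (x powr (\<alpha> - 1) * (1 - x) powr (\<gamma> - 1)))"
  have "gauss_hypergeometric (of_real (H - 1/2)) (of_real (1/2 - H)) (of_real (H + 1/2)) (of_real (1 - t / s))
      = of_real (1 / Beta \<alpha> \<gamma>) * (LBINT x. of_real (w x) * (1 - of_real (1 - t / s) * of_real x) powr of_real \<alpha>)"
    unfolding w_def \<alpha>_def \<gamma>_def
    by (rule gauss_hypergeometric_eqI[OF fbm_hypergeometric_euler[OF H] one_minus_quotient_in_cut_plane[OF st]])
  also have "(LBINT x. of_real (w x) * (1 - of_real (1 - t / s) * of_real x) powr of_real \<alpha>)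
     = (LBINT x. complex_of_real (w x * (?p x) powr \<alpha>))"
  proof (intro Bochner_Integration.integral_cong refl)
    fix x :: real
    show "of_real (w x) * (1 - of_real (1 - t / s) * of_real x) powr of_real \<alpha> = complex_of_real (w x * (?p x) powr \<alpha>)"
    proof (cases "x \<in> {0<..<1}")
      case True
      have "1 - of_real (1 - t / s) * of_real x = complex_of_real (?p x)"
        by (simp add: algebra_simps)
      moreover have "?p x \<ge> 0" using True st by (intro add_nonneg_nonneg mult_nonneg_nonneg) auto
      ultimately show ?thesis by (simp only: powr_of_real of_real_mult)
    qed (simp add: w_def)
  qed
  also have "\<dots> = complex_of_real (LBINT x. w x * (?p x) powr \<alpha>)" by (rule integral_complex_of_real)
  finally have F: "Re (gauss_hypergeometric (of_real (H - 1/2)) (of_real (1/2 - H)) (of_real (H + 1/2)) (of_real (1 - t / s)))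
     = 1 / Beta \<alpha> \<gamma> * (LBINT x. w x * (?p x) powr \<alpha>)"
    by (simp flip: of_real_mult)
  define f where "f = (\<lambda>r. indicator {s<..<t} r *\<^sub>R ((t - r) powr (\<gamma> - 1) * r powr \<alpha> * (r - s) powr (\<alpha> - 1) * s powr - \<alpha>))"
  have "volterra_kernel H t s = (LBINT r. f r)"
    by (simp only: volterra_kernel_def set_lebesgue_integral_def f_def \<alpha>_def \<gamma>_def)
  also have "\<dots> = (t - s) * (LBINT x. f (s + (t - s) * x))"
    using st by (subst lborel_integral_real_affine[where c = "t - s" and t = s]) auto
  also have "(\<lambda>x. f (s + (t - s) * x)) = (\<lambda>x. (t - s) powr (\<gamma> + \<alpha> - 2) * (w x * (?p x) powr \<alpha>))"
  proof
    fix x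
    have i: "s + (t - s) * x \<in> {s<..<t} \<longleftrightarrow> x \<in> {0<..<1}"
      using st by (auto simp: zero_less_mult_iff) (smt (verit) mult_less_cancel_left2)+
    show "f (s + (t - s) * x) = (t - s) powr (\<gamma> + \<alpha> - 2) * (w x * (?p x) powr \<alpha>)"
    proof (cases "x \<in> {0<..<1}")
      case True
      have 1: "t - (s + (t - s) * x) = (t - s) * (1 - x)" by (simp add: algebra_simps)
      have 2: "s + (t - s) * x = s * (?p x)" using st by (simp add: field_simps)
      have 3: "0 \<le> ?p x" using True st by (intro add_nonneg_nonneg mult_nonneg_nonneg) auto
      have "f (s + (t - s) * x) = (t - (s + (t - s) * x)) powr (\<gamma> - 1) * (s + (t - s) * x) powr \<alpha> * ((t - s) * x) powr (\<alpha> - 1) * s powr - \<alpha>"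
        using True i by (simp add: f_def)
      also have "\<dots> = ((t - s) powr (\<gamma> - 1) * (1 - x) powr (\<gamma> - 1)) * (s powr \<alpha> * (?p x) powr \<alpha>)
          * ((t - s) powr (\<alpha> - 1) * x powr (\<alpha> - 1)) * s powr - \<alpha>"
        unfolding 1 unfolding 2 using True st 3 by (simp add: powr_mult)
      also have "\<dots> = ((t - s) powr (\<gamma> - 1) * (t - s) powr (\<alpha> - 1)) * (s powr \<alpha> * s powr - \<alpha>)
          * (x powr (\<alpha> - 1) * (1 - x) powr (\<gamma> - 1) * (?p x) powr \<alpha>)"
        by (simp only: mult_ac)
      also have "(t - s) powr (\<gamma> - 1) * (t - s) powr (\<alpha> - 1) = (t - s) powr (\<gamma> + \<alpha> - 2)"
        by (simp flip: powr_add)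
      also have "s powr \<alpha> * s powr - \<alpha> = 1" using st by (simp flip: powr_add)
      finally show ?thesis using True by (simp add: w_def)
    next
      case False
      then show ?thesis using i by (simp add: f_def w_def)
    qed
  qed
  finally have V: "volterra_kernel H t s = (t - s) powr 1 * (t - s) powr (\<gamma> + \<alpha> - 2) * (LBINT x. w x * (?p x) powr \<alpha>)"
    using st by simp
  have e: "(t - s) powr 1 * (t - s) powr (\<gamma> + \<alpha> - 2) = (t - s) powr (H - 1/2)"
    unfolding powr_add[symmetric] ag by simp
  show ?thesis
    unfolding fbm_kernel_def F V e \<alpha>_def[symmetric] \<gamma>_def[symmetric] by simp
qed

text \<open>Bounding r^\<alpha> by t^\<alpha> on (s, t) leaves the plain Beta kernel. The resulting
  finite majorant is what identifies the nonnegative integral with the Lebesgue integral that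
  defines the kernel.\<close>

lemma nn_integral_volterra:
  assumes H: "0 < H" "H < 1" "H \<noteq> 1/2" and st: "0 < s" "s < t"
  shows "(\<integral>\<^sup>+r\<in>{s<..<t}. ennreal ((t - r) powr (fbm_gamma H - 1) * r powr fbm_alpha H *
     (r - s) powr (fbm_alpha H - 1) * s powr - fbm_alpha H) \<partial>lborel) = ennreal (volterra_kernel H t s)"
    (is "(\<integral>\<^sup>+r\<in>_. ennreal (?f r) \<partial>_) = _")
    and "0 \<le> volterra_kernel H t s"
    and "volterra_kernel H t s \<le> Beta (fbm_gamma H) (fbm_alpha H) * t powr fbm_alpha H * (s powr - fbm_alpha H * (t - s) powr (H - 1/2))"
      (is "_ \<le> ?M")
proof -
  define \<alpha> \<gamma> where "\<alpha> = fbm_alpha H" and "\<gamma> = fbm_gamma H"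
  have ag: "\<gamma> + \<alpha> - 1 = H - 1/2" "0 < \<alpha>" "0 < \<gamma>" using fbm_exponents[OF H(1,2)] H(3) by (auto simp: \<alpha>_def \<gamma>_def)
  let ?k = "\<lambda>r. (t - r) powr (\<gamma> - 1) * (r - s) powr (\<alpha> - 1)"
  have "(\<integral>\<^sup>+r\<in>{s<..<t}. ennreal (?f r) \<partial>lborel)
     \<le> (\<integral>\<^sup>+r. ennreal (t powr \<alpha> * s powr - \<alpha>) * (ennreal (?k r) * indicator {s<..<t} r) \<partial>lborel)"
  proof (intro nn_integral_mono)
    fix r
    show "ennreal (?f r) * indicator {s<..<t} r \<le> ennreal (t powr \<alpha> * s powr - \<alpha>) * (ennreal (?k r) * indicator {s<..<t} r)"
    proof (cases "r \<in> {s<..<t}")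
      case True
      have "r powr \<alpha> \<le> t powr \<alpha>" using True st ag by (intro powr_mono2) auto
      then have "r powr \<alpha> * (s powr - \<alpha> * (?k r))
         \<le> t powr \<alpha> * (s powr - \<alpha> * (?k r))"
        by (intro mult_right_mono) auto
      then show ?thesis using True
        unfolding \<alpha>_def[symmetric] \<gamma>_def[symmetric] by (simp add: ennreal_mult[symmetric] mult_ac)
    qed simp
  qed
  also have "\<dots> = ennreal (t powr \<alpha> * s powr - \<alpha>) * ennreal (Beta \<gamma> \<alpha> * (t - s) powr (\<gamma> + \<alpha> - 1))"
    using ag st by (subst nn_integral_cmult) (auto simp: nn_integral_Beta_kernel)
  also have "\<dots> = ennreal ?M"
    using Beta_real_pos[of \<gamma> \<alpha>] ag
    by (simp add: ennreal_mult[symmetric] \<alpha>_def[symmetric] \<gamma>_def[symmetric] mult_ac)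
  finally have le: "(\<integral>\<^sup>+r\<in>{s<..<t}. ennreal (?f r) \<partial>lborel) \<le> ennreal ?M" .
  then have fin: "(\<integral>\<^sup>+r\<in>{s<..<t}. ennreal (?f r) \<partial>lborel) < top"
    by (rule order.strict_trans1) simp
  define c where "c = enn2real (\<integral>\<^sup>+r\<in>{s<..<t}. ennreal (?f r) \<partial>lborel)"
  have c: "(\<integral>\<^sup>+r\<in>{s<..<t}. ennreal (?f r) \<partial>lborel) = ennreal c" "c \<ge> 0"
    unfolding c_def ennreal_enn2real[OF fin] by simp_all
  have v: "volterra_kernel H t s = c"
    unfolding volterra_kernel_def
    by (rule set_integral_eq_nn_integral(2)[OF c]) (auto simp: set_borel_measurable_def)
  show "(\<integral>\<^sup>+r\<in>{s<..<t}. ennreal (?f r) \<partial>lborel) = ennreal (volterra_kernel H t s)" "0 \<le> volterra_kernel H t s"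
    using c v by auto
  have "0 \<le> ?M" using Beta_real_pos[of \<gamma> \<alpha>] ag by (auto simp: \<alpha>_def \<gamma>_def)
  then show "volterra_kernel H t s \<le> ?M" using le c v by (simp add: ennreal_le_iff)
qed

text \<open>One majorant for all H. Its square has exponent -2\<alpha> > -1 in s and 2H - 1 > -1 in
  t - s, so the kernel is square integrable in s.\<close>

lemma fbm_kernel_bound:
  assumes H: "0 < H" "H < 1"
  obtains C where "C \<ge> 0" "\<And>s t. 0 < s \<Longrightarrow> s < t \<Longrightarrow> 0 \<le> fbm_kernel H t s"
    "\<And>s t. 0 < s \<Longrightarrow> s < t \<Longrightarrow> fbm_kernel H t s \<le> C * t powr fbm_alpha H * (s powr - fbm_alpha H * (t - s) powr (H - 1/2))"
proof (cases "H = 1/2")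
  case True
  show ?thesis
    using fbm_c_pos[OF H] by (intro that[of "fbm_c H"]) (auto simp: True fbm_kernel_half fbm_alpha_def)
next
  case False
  define D where "D = fbm_c H / Beta (fbm_alpha H) (fbm_gamma H)"
  note ex = fbm_exponents[OF H]
  have D: "D > 0" unfolding D_def using fbm_c_pos[OF H] ex False by (intro divide_pos_pos Beta_real_pos) auto
  show ?thesis
  proof (rule that[of "D * Beta (fbm_gamma H) (fbm_alpha H)"])
    show "0 \<le> D * Beta (fbm_gamma H) (fbm_alpha H)"
      using D ex False by (intro mult_nonneg_nonneg less_imp_le[OF Beta_real_pos]) auto
    fix s t :: real assume st: "0 < s" "s < t"
    note v = nn_integral_volterra[OF H False st]
    show "0 \<le> fbm_kernel H t s"
      unfolding fbm_kernel_eq_volterra[OF H False st] D_def[symmetric] using D v by simp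
    show "fbm_kernel H t s \<le> D * Beta (fbm_gamma H) (fbm_alpha H) * t powr fbm_alpha H * (s powr - fbm_alpha H * (t - s) powr (H - 1/2))"
      unfolding fbm_kernel_eq_volterra[OF H False st] D_def[symmetric] using D mult_left_mono[OF v(3), of D] by (simp add: mult.assoc)
  qed
qed

lemma continuous_on_fbm_kernel:
  assumes H: "0 < H" "H < 1"
  shows "continuous_on {(t, s). 0 < s \<and> s < t} (\<lambda>(t, s). fbm_kernel H t s)"
proof -
  have "continuous_on {(t, s). 0 < s \<and> s < t} (\<lambda>p. gauss_hypergeometric (of_real (H - 1/2)) (of_real (1/2 - H)) (of_real (H + 1/2)) (of_real (1 - fst p / snd p)))"
  proof (rule continuous_on_compose2[OF holomorphic_on_imp_continuous_on[OF fbm_hypergeometric_holomorphic[OF H]]])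
    show "continuous_on {(t, s). 0 < s \<and> s < t} (\<lambda>p :: real \<times> real. complex_of_real (1 - fst p / snd p))"
      by (intro continuous_intros) auto
    show "(\<lambda>p :: real \<times> real. complex_of_real (1 - fst p / snd p)) ` {(t, s). 0 < s \<and> s < t} \<subseteq> cut_plane"
      by (intro image_subsetI one_minus_quotient_in_cut_plane) auto
  qed
  then show ?thesis
    unfolding fbm_kernel_def case_prod_unfold by (intro continuous_intros) auto
qed

text \<open>Self-similarity: the hypergeometric factor depends only on t/s, so scaling acts through
  the prefactor alone. Squared L2 norms of the kernel in s therefore scale like t^(2H).\<close>

lemma fbm_kernel_scale:
  assumes "0 < t" "0 < x" "x < 1"
  shows "fbm_kernel H t (t * x) = t powr (H - 1/2) * fbm_kernel H 1 x"
proof -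
  have "t - t * x = t * (1 - x)" by (simp add: algebra_simps)
  moreover have "t / (t * x) = 1 / x" using assms by simp
  ultimately show ?thesis using assms by (simp only: fbm_kernel_def) (simp add: powr_mult)
qed

section \<open>Lipschitz functions as indefinite integrals\<close>

lemma bi_Lipschitz_density:
  fixes G :: "real \<Rightarrow> real"
  assumes "L > 0" and lo: "\<And>x y. x \<le> y \<Longrightarrow> L * (y - x) \<le> G y - G x"
    and up: "\<And>x y. x \<le> y \<Longrightarrow> G y - G x \<le> L' * (y - x)"
  obtains f :: "real \<Rightarrow> ennreal" where "f \<in> borel_measurable borel"
    "\<And>a b. a \<le> b \<Longrightarrow> (\<integral>\<^sup>+x\<in>{a<..<b}. f x \<partial>lborel) = ennreal (G b - G a)"
proof -
  have smono: "strict_mono G"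
    using lo \<open>L > 0\<close> by (intro strict_monoI) (smt (verit) mult_pos_pos)
  have lip: "\<bar>G x - G y\<bar> \<le> \<bar>L'\<bar> * \<bar>x - y\<bar>" for x y
  proof -
    have *: "\<bar>G x - G y\<bar> \<le> \<bar>L'\<bar> * \<bar>x - y\<bar>" if "x \<le> y" for x y
    proof -
      have "0 \<le> L * (y - x)" using that \<open>L > 0\<close> by simp
      moreover have "L' * (y - x) \<le> \<bar>L'\<bar> * (y - x)" using that by (intro mult_right_mono) auto
      ultimately show ?thesis using lo[OF that] up[OF that] that by (simp add: abs_minus_commute)
    qed
    show ?thesis using *[of x y] *[of y x] by (cases "x \<le> y") (auto simp: abs_minus_commute)
  qed
  have cont: "continuous_on UNIV G"
  proof -
    have "\<bar>L'\<bar>-lipschitz_on UNIV G"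
      by (intro lipschitz_onI) (auto simp: dist_real_def lip)
    then show ?thesis by (rule lipschitz_on_continuous_on)
  qed
  have surj: "surj G"
  proof -
    have "\<exists>x. G x = y" for y
    proof -
      \<comment> \<open>Growth at rate at least L takes G from G 0 to y or beyond within distance d,
        so the intermediate value theorem applies on [-d, d].\<close>
      define d where "d = \<bar>y - G 0\<bar> / L"
      have d: "d \<ge> 0" "L * d = \<bar>y - G 0\<bar>" using \<open>L > 0\<close> by (auto simp: d_def)
      have "\<exists>x\<ge>-d. x \<le> d \<and> G x = y"
        using lo[of 0 d] lo[of "-d" 0] d
        by (intro IVT' continuous_on_subset[OF cont]) (auto simp: algebra_simps)
      then show ?thesis by blast
    qed
    then show ?thesis by (metis surj_def)
  qed
  define P where "P = inv G"
  have inj: "inj G" using smono by (rule strict_mono_imp_inj_on)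
  have GP: "G (P y) = y" and PG: "P (G x) = x" for x y
    using surj inj by (simp_all add: P_def surj_f_inv_f)
  have Pmono: "mono P"
    by (intro monoI) (metis GP smono strict_mono_less_eq)
  have Pm[measurable]: "P \<in> borel_measurable borel" by (rule borel_measurable_mono[OF Pmono])
  have vim: "P -` A = G ` A" for A using GP PG by (auto simp: image_iff) metis
  \<comment> \<open>\<open>P = G\<^sup>-\<^sup>1\<close> carries Lebesgue measure to the measure with distribution function \<open>G\<close>; it is
    absolutely continuous because Lipschitz maps preserve null sets\<close>
  define N where "N = distr lborel borel P"
  have "absolutely_continuous lborel N"
    unfolding absolutely_continuous_def
  proof
    fix A :: "real set" assume A: "A \<in> null_sets lborel"
    then have Ab: "A \<in> sets borel" by (auto simp: null_sets_def)
    have "negligible A" using A by (simp add: negligible_iff_null_sets null_sets_completionI)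
    then have "negligible (G ` A)"
    proof (rule negligible_locally_Lipschitz_image[rotated])
      show "\<exists>T B. open T \<and> x \<in> T \<and> (\<forall>y\<in>A \<inter> T. norm (G y - G x) \<le> B * norm (y - x))" if "x \<in> A" for x
        using lip by (intro exI[of _ UNIV] exI[of _ "\<bar>L'\<bar>"]) auto
    qed simp
    then have "G ` A \<in> null_sets lebesgue" by (simp add: negligible_iff_null_sets)
    moreover have "P -` A \<in> sets borel" using measurable_sets[OF Pm Ab] by simp
    ultimately have "P -` A \<in> null_sets lborel"
      by (simp add: vim null_sets_def)
    then show "A \<in> null_sets N" using Ab
      by (simp add: null_sets_def N_def emeasure_distr)
  qed
  then obtain f where f: "f \<in> borel_measurable lborel" "density lborel f = N"
    using sigma_finite_measure.Radon_Nikodym[OF sigma_finite_lborel, of N] by (auto simp: N_def)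
  show ?thesis
  proof
    show "f \<in> borel_measurable borel" using f by simp
    fix a b :: real assume "a \<le> b"
    have "(\<integral>\<^sup>+x\<in>{a<..<b}. f x \<partial>lborel) = emeasure N {a<..<b}"
      unfolding f(2)[symmetric] using f(1) by (simp add: emeasure_density)
    also have "\<dots> = emeasure lborel (P -` {a<..<b})" by (simp add: N_def emeasure_distr)
    also have "P -` {a<..<b} = {G a<..<G b}"
      using GP PG smono by (auto simp: ) (metis strict_mono_less)+
    also have "emeasure lborel {G a<..<G b} = ennreal (G b - G a)"
      using \<open>a \<le> b\<close> smono by (simp add: strict_mono_less_eq)
    finally show "(\<integral>\<^sup>+x\<in>{a<..<b}. f x \<partial>lborel) = ennreal (G b - G a)" .
  qed
qed

text \<open>w need not be monotone. With l above its Lipschitz constant, w + 2lx and 2lx - w have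
  difference quotients between l and 3l, so each has a density; subtracting 2l from the first one
  gives a density for w. The second density bounds the first.\<close>

lemma Lipschitz_real_density:
  fixes w :: "real \<Rightarrow> real"
  assumes lip: "L-lipschitz_on UNIV w"
  obtains \<rho> :: "real \<Rightarrow> real" and B where "\<rho> \<in> borel_measurable borel" "\<And>x. \<bar>\<rho> x\<bar> \<le> B"
    "\<And>a b. a \<le> b \<Longrightarrow> (LBINT x:{a<..<b}. \<rho> x) = w b - w a"
proof -
  define l where "l = \<bar>L\<bar> + 1"
  have "l > 0" by (simp add: l_def)
  have lw: "\<bar>w y - w x\<bar> \<le> l * (y - x)" if "x \<le> y" for x y
  proof -
    have "\<bar>w y - w x\<bar> \<le> L * \<bar>y - x\<bar>" using lipschitz_onD[OF lip, of y x] by (simp add: dist_real_def)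
    also have "\<dots> \<le> l * \<bar>y - x\<bar>" by (intro mult_right_mono) (auto simp: l_def)
    finally show ?thesis using that by simp
  qed
  obtain f where f[measurable]: "f \<in> borel_measurable borel"
    and fi: "\<And>a b. a \<le> b \<Longrightarrow> (\<integral>\<^sup>+x\<in>{a<..<b}. f x \<partial>lborel) = ennreal ((w b + 2 * l * b) - (w a + 2 * l * a))"
    by (rule bi_Lipschitz_density[of l "\<lambda>x. w x + 2 * l * x" "3 * l"])
       (use lw \<open>l > 0\<close> in \<open>auto simp: algebra_simps abs_le_iff, (smt (verit))+\<close>)
  obtain g where g[measurable]: "g \<in> borel_measurable borel"
    and gi: "\<And>a b. a \<le> b \<Longrightarrow> (\<integral>\<^sup>+x\<in>{a<..<b}. g x \<partial>lborel) = ennreal ((2 * l * b - w b) - (2 * l * a - w a))"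
    by (rule bi_Lipschitz_density[of l "\<lambda>x. 2 * l * x - w x" "3 * l"])
       (use lw \<open>l > 0\<close> in \<open>auto simp: algebra_simps abs_le_iff, (smt (verit))+\<close>)
  \<comment> \<open>the densities of \<open>w + 2lx\<close> and \<open>2lx - w\<close> add up to \<open>4l\<close>, which bounds each of them\<close>
  have "density lborel (\<lambda>x. (f x + g x) / ennreal (4 * l)) = lborel"
  proof (rule lborel_eqI[symmetric])
    fix a b :: real assume "\<And>i. i \<in> Basis \<Longrightarrow> a \<bullet> i \<le> b \<bullet> i"
    then have ab: "a \<le> b" by simp
    have "emeasure (density lborel (\<lambda>x. (f x + g x) / ennreal (4 * l))) (box a b)
       = (\<integral>\<^sup>+x. (f x * indicator {a<..<b} x + g x * indicator {a<..<b} x) / ennreal (4 * l) \<partial>lborel)"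
      by (subst emeasure_density)
         (auto simp: box_real ennreal_times_divide divide_ennreal_def algebra_simps intro!: nn_integral_cong)
    also have "\<dots> = (ennreal ((w b + 2 * l * b) - (w a + 2 * l * a)) + ennreal ((2 * l * b - w b) - (2 * l * a - w a))) / ennreal (4 * l)"
      using ab by (simp add: nn_integral_divide nn_integral_add fi gi)
    also have "\<dots> = ennreal (4 * l * (b - a)) / ennreal (4 * l)"
      using lw[OF ab] ab \<open>l > 0\<close> mult_left_mono[OF ab, of l]
      by (subst ennreal_plus[symmetric]) (auto simp: algebra_simps abs_le_iff)
    also have "\<dots> = ennreal (b - a)"
      using ab \<open>l > 0\<close> by (subst divide_ennreal) auto
    finally show "emeasure (density lborel (\<lambda>x. (f x + g x) / ennreal (4 * l))) (box a b) = ennreal (\<Prod>i\<in>Basis. (b - a) \<bullet> i)" by simp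
  qed simp
  then have "density lborel (\<lambda>x. (f x + g x) / ennreal (4 * l)) = density lborel (\<lambda>_. 1)"
    by (simp add: density_1)
  then have "AE x in lborel. (f x + g x) / ennreal (4 * l) = 1"
    by (subst (asm) sigma_finite_measure.density_unique_iff[OF sigma_finite_lborel]) auto
  then have fb: "AE x in lborel. f x \<le> ennreal (4 * l)"
  proof eventually_elim
    case (elim x)
    have "(f x + g x) / ennreal (4 * l) * ennreal (4 * l) = f x + g x"
      using \<open>l > 0\<close> by (simp add: ennreal_divide_times ennreal_mult_divide_eq)
    with elim show ?case by (metis add_increasing2 order_refl zero_le mult_1)
  qed
  \<comment> \<open>The bound on f holds only almost everywhere; truncation at 4l makes the density
    real and bounded at every point without changing its integrals.\<close>
  define h where "h = (\<lambda>x. enn2real (min (f x) (ennreal (4 * l))))"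
  have h[measurable]: "h \<in> borel_measurable borel" by (simp add: h_def)
  have eh: "ennreal (h x) = min (f x) (ennreal (4 * l))" for x
    unfolding h_def by (intro ennreal_enn2real) (simp add: min.strict_coboundedI2)
  have hb: "0 \<le> h x" "h x \<le> 4 * l" for x
    using \<open>l > 0\<close> eh[of x] by (auto simp: h_def intro!: enn2real_leI)
  show ?thesis
  proof
    show "(\<lambda>x. h x - 2 * l) \<in> borel_measurable borel" by simp
    show "\<bar>h x - 2 * l\<bar> \<le> 2 * l" for x using hb[of x] by (simp add: abs_le_iff)
    fix a b :: real assume ab: "a \<le> b"
    have "(\<integral>\<^sup>+x\<in>{a<..<b}. ennreal (h x) \<partial>lborel) = (\<integral>\<^sup>+x\<in>{a<..<b}. f x \<partial>lborel)"
      using fb by (intro nn_integral_cong_AE, elim AE_mp, intro AE_I2 impI) (simp only: eh min_absorb1)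
    also have "\<dots> = ennreal ((w b + 2 * l * b) - (w a + 2 * l * a))" by (rule fi[OF ab])
    finally have nn: "(\<integral>\<^sup>+x. ennreal (indicator {a<..<b} x *\<^sub>R h x) \<partial>lborel) = ennreal ((w b + 2 * l * b) - (w a + 2 * l * a))"
      by (subst nn_integral_cong[where v = "\<lambda>x. ennreal (h x) * indicator {a<..<b} x"]) (auto simp: indicator_def)
    have "has_bochner_integral lborel (\<lambda>x. indicator {a<..<b} x *\<^sub>R h x) ((w b + 2 * l * b) - (w a + 2 * l * a))"
      using lw[OF ab] ab \<open>l > 0\<close> mult_left_mono[OF ab, of l]
      by (intro has_bochner_integral_nn_integral nn) (auto simp: hb algebra_simps abs_le_iff)
    then have "set_integrable lborel {a<..<b} h" "(LBINT x:{a<..<b}. h x) = (w b + 2 * l * b) - (w a + 2 * l * a)"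
      by (auto simp: set_integrable_def set_lebesgue_integral_def has_bochner_integral_iff)
    moreover have "set_integrable lborel {a<..<b} (\<lambda>_. 2 * l)" "(LBINT x:{a<..<b}. 2 * l) = 2 * l * (b - a)"
      using ab by (auto simp: set_integrable_def set_lebesgue_integral_def)
    ultimately show "(LBINT x:{a<..<b}. h x - 2 * l) = w b - w a"
      by (simp add: set_integral_diff algebra_simps)
  qed
qed

section \<open>Continuity and injectivity of the Volterra operator\<close>

lemma L2_unitD:
  assumes "u \<in> L2_unit"
  shows "(\<lambda>s. indicator {0..1} s *\<^sub>R u s) \<in> borel_measurable borel"
    "integrable lborel (\<lambda>s. indicator {0..1} s *\<^sub>R (norm (u s))\<^sup>2)"
  using assms by (auto simp: L2_unit_def set_borel_measurable_def set_integrable_def)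

lemma L2_unit_Ioo:
  fixes u :: "real \<Rightarrow> 'a::euclidean_space"
  assumes "u \<in> L2_unit" "t \<le> 1"
  shows "set_borel_measurable lborel {0<..<t} u" "set_integrable lborel {0<..<t} (\<lambda>s. (norm (u s))\<^sup>2)"
proof -
  have "set_borel_measurable lborel {0..1} u" "set_integrable lborel {0..1} (\<lambda>s. (norm (u s))\<^sup>2)"
    using assms by (auto simp: L2_unit_def)
  then show "set_borel_measurable lborel {0<..<t} u" "set_integrable lborel {0<..<t} (\<lambda>s. (norm (u s))\<^sup>2)"
    using assms(2) by (auto intro: set_borel_measurable_subset set_integrable_subset)
qed

lemma powr_square: "(x powr a)\<^sup>2 = x powr (2 * a)" for x :: real
  by (simp add: power2_eq_square flip: powr_add)

text \<open>The square of the weight is a Beta integrand with parameters 2b + 1 and 1 - 2a, and the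
  conditions on a and b say that both are positive. The product with u is integrable because both
  factors are square integrable.\<close>

lemma set_integrable_weight_L2:
  fixes u :: "real \<Rightarrow> 'a::euclidean_space"
  assumes "u \<in> L2_unit" "0 < t" "t \<le> 1" "a < 1/2" "b > - 1/2"
  shows "set_integrable lborel {0<..<t} (\<lambda>s. (s powr - a * (t - s) powr b) *\<^sub>R u s)"
proof (rule set_integrable_scaleR_L2)
  have "set_integrable lborel {0<..<t} (\<lambda>s. (t - s) powr ((2 * b + 1) - 1) * s powr ((1 - 2 * a) - 1))"
    using assms by (intro set_integral_Beta) auto
  then show "set_integrable lborel {0<..<t} (\<lambda>s. (s powr - a * (t - s) powr b)\<^sup>2)"
    by (simp add: power_mult_distrib powr_square mult.commute)
qed (use L2_unit_Ioo[OF assms(1,3)] in \<open>auto simp: set_borel_measurable_def\<close>)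

text \<open>Fubini on the triangle with the kernel bound as majorant; its product with the norm of u
  is integrable because \<alpha> < 1/2 and H - 1/2 > -1/2.\<close>

lemma volterra_operator_factorization:
  fixes u :: "real \<Rightarrow> 'a::euclidean_space"
  assumes H: "0 < H" "H < 1" "H \<noteq> 1/2" and u: "u \<in> L2_unit" and t: "0 < t" "t \<le> 1"
  shows "(LBINT s:{0<..<t}. volterra_kernel H t s *\<^sub>R u s)
     = rl_integral (fbm_gamma H) (\<lambda>r. r powr fbm_alpha H *\<^sub>R rl_integral (fbm_alpha H) (\<lambda>s. s powr - fbm_alpha H *\<^sub>R u s) r) t"
proof -
  define \<alpha> \<gamma> where "\<alpha> = fbm_alpha H" and "\<gamma> = fbm_gamma H"
  let ?L = "\<lambda>r s. (t - r) powr (\<gamma> - 1) * r powr \<alpha> * (r - s) powr (\<alpha> - 1) * s powr - \<alpha>"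
  note ex = fbm_exponents[OF H(1,2), folded \<alpha>_def \<gamma>_def]
  let ?M = "\<lambda>s. Beta \<gamma> \<alpha> * t powr \<alpha> * (s powr - \<alpha> * (t - s) powr (H - 1/2))"
  have Bp: "Beta \<gamma> \<alpha> > 0" using ex H(3) by (intro Beta_real_pos) auto
  have "set_integrable lborel {0<..<t} (\<lambda>s. (s powr - \<alpha> * (t - s) powr (H - 1/2)) *\<^sub>R u s)"
    using ex H by (intro set_integrable_weight_L2 u t) auto
  then have "set_integrable lborel {0<..<t} (\<lambda>s. (Beta \<gamma> \<alpha> * t powr \<alpha>) * norm ((s powr - \<alpha> * (t - s) powr (H - 1/2)) *\<^sub>R u s))"
    by (intro set_integrable_mult_right set_integrable_norm)
  then have M: "set_integrable lborel {0<..<t} (\<lambda>s. ?M s *\<^sub>R norm (u s))"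
    by (simp add: mult.assoc abs_mult)
  have "(LBINT r:{0<..<t}. LBINT s:{0<..<r}. ?L r s *\<^sub>R u s) = (LBINT s:{0<..<t}. (LBINT r:{s<..<t}. ?L r s) *\<^sub>R u s)"
  proof (rule triangle_integral[where M = ?M])
    show "case_prod ?L \<in> borel_measurable (borel \<Otimes>\<^sub>M borel)" by measurable
    show "set_borel_measurable borel {0<..<t} u" using L2_unit_Ioo[OF u t(2)] by (simp add: set_borel_measurable_def)
    show "(\<integral>\<^sup>+r\<in>{s<..<t}. ennreal (?L r s) \<partial>lborel) \<le> ennreal (?M s)" if "0 < s" "s < t" for s
      using nn_integral_volterra[OF H that] unfolding \<alpha>_def \<gamma>_def by (auto intro: ennreal_leI)
  qed (use M Bp in auto)
  moreover have "(t - r) powr (\<gamma> - 1) *\<^sub>R r powr \<alpha> *\<^sub>R rl_integral \<alpha> (\<lambda>s. s powr - \<alpha> *\<^sub>R u s) r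
     = (LBINT s:{0<..<r}. ?L r s *\<^sub>R u s)" for r
    unfolding rl_integral_def set_integral_scaleR_right[symmetric] by (simp add: mult_ac)
  ultimately show ?thesis
    unfolding volterra_kernel_def \<alpha>_def[symmetric] \<gamma>_def[symmetric] rl_integral_def[of \<gamma>] by (simp only:)
qed

lemma K_op_eq_rl_integral:
  assumes H: "0 < H" "H < 1" "H \<noteq> 1/2" and u: "u \<in> L2_unit" and t: "0 < t" "t \<le> 1"
  shows "K_op H u t = (fbm_c H / Beta (fbm_alpha H) (fbm_gamma H)) *\<^sub>R
     rl_integral (fbm_gamma H) (\<lambda>r. r powr fbm_alpha H *\<^sub>R rl_integral (fbm_alpha H) (\<lambda>s. s powr - fbm_alpha H *\<^sub>R u s) r) t"
proof -
  have "K_op H u t = (LBINT s:{0<..<t}. (fbm_c H / Beta (fbm_alpha H) (fbm_gamma H)) *\<^sub>R (volterra_kernel H t s *\<^sub>R u s))"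
    unfolding K_op_def using fbm_kernel_eq_volterra[OF H] by (intro set_lebesgue_integral_cong) auto
  then show ?thesis
    by (simp only: set_integral_scaleR_right volterra_operator_factorization[OF assms])
qed

lemma K_op_half:
  assumes "0 \<le> t" 
  shows "K_op (1/2) u t = fbm_c (1/2) *\<^sub>R (LBINT s:{0<..<t}. u s)"
proof -
  have "K_op (1/2) u t = (LBINT s:{0<..<t}. fbm_c (1/2) *\<^sub>R u s)"
    unfolding K_op_def by (intro set_lebesgue_integral_cong) (auto simp: fbm_kernel_half)
  then show ?thesis by simp
qed

lemma L2_unit_integrable:
  fixes u :: "real \<Rightarrow> 'a::euclidean_space"
  assumes "u \<in> L2_unit"
  shows "set_integrable lborel {0<..<1} u"
proof -
  have "set_integrable lborel {0<..<1} (\<lambda>s. (s powr - 0 * (1 - s) powr 0) *\<^sub>R u s)"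
    by (intro set_integrable_weight_L2 assms) auto
  then show ?thesis by (rule set_integrable_cong[THEN iffD1, rotated -1]) auto
qed

lemma set_integrable_powr_scaleR:
  fixes f :: "real \<Rightarrow> 'a::euclidean_space"
  assumes f: "set_integrable lborel {0<..<t} f" and "c \<ge> 0" 
  shows "set_integrable lborel {0<..<t} (\<lambda>s. s powr c *\<^sub>R f s)"
  using \<open>c \<ge> 0\<close>
  by (intro set_integrable_bounded_scaleR[OF f, where B = "t powr c"]) (auto intro: powr_mono2)

lemma K_op_injective:
  fixes u :: "real \<Rightarrow> real^'n"
  assumes H: "0 < H" "H < 1" and u: "u \<in> L2_unit" and zero: "\<And>t. t \<in> {0<..1} \<Longrightarrow> K_op H u t = 0"
  shows "AE s in lborel. s \<in> {0<..<1} \<longrightarrow> u s = 0"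
proof (cases "H = 1/2")
  case True
  show ?thesis
  proof (rule AE_zero_if_indefinite_integral_zero[OF L2_unit_integrable[OF u]])
    fix t :: real assume t: "t \<in> {0<..1}"
    show "(LBINT s:{0<..<t}. u s) = 0"
      using zero[OF t] t fbm_c_pos[OF H] K_op_half[of t u] unfolding True by auto
  qed
next
  case False
  define \<alpha> \<gamma> where "\<alpha> = fbm_alpha H" and "\<gamma> = fbm_gamma H"
  note ex = fbm_exponents[OF H, folded \<alpha>_def \<gamma>_def]
  define v where "v = (\<lambda>s. s powr - \<alpha> *\<^sub>R u s)"
  have "set_integrable lborel {0<..<1} (\<lambda>s. (s powr - \<alpha> * (1 - s) powr 0) *\<^sub>R u s)"
    using ex by (intro set_integrable_weight_L2 u) auto
  then have v: "set_integrable lborel {0<..<1} v"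
    unfolding v_def by (rule set_integrable_cong[THEN iffD1, rotated -1]) auto
  have \<alpha>: "0 < \<alpha>" "\<alpha> < 1" using ex False by auto
  define f where "f = (\<lambda>r. r powr \<alpha> *\<^sub>R rl_integral \<alpha> v r)"
  have f: "set_integrable lborel {0<..<1} f"
    unfolding f_def using \<alpha> by (intro set_integrable_powr_scaleR set_integrable_rl_integral v) auto
  have rlf: "rl_integral \<gamma> f t = 0" if "t \<in> {0<..1}" for t
  proof -
    have "(fbm_c H / Beta \<alpha> \<gamma>) *\<^sub>R rl_integral \<gamma> f t = 0"
      using K_op_eq_rl_integral[OF H False u, of t] zero[OF that] that
      by (simp add: f_def v_def \<alpha>_def \<gamma>_def)
    then show ?thesis using fbm_c_pos[OF H] Beta_real_pos[of \<alpha> \<gamma>] \<alpha> ex by auto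
  qed
  have "AE r in lborel. r \<in> {0<..<1} \<longrightarrow> f r = 0"
  \<comment> \<open>Here \<gamma> = 1 means H > 1/2. The complementary order would be 0, so the
    outer integral is treated as an ordinary indefinite integral.\<close>
  proof (cases "\<gamma> = 1")
    case True
    show ?thesis
      by (rule AE_zero_if_indefinite_integral_zero[OF f]) (use rlf in \<open>simp add: True rl_integral_1\<close>)
  next
    case False
    then show ?thesis
      using ex rlf by (intro rl_integral_zero_imp_AE_zero[OF _ _ f, of \<gamma>] AE_I2) auto
  qed
  then have "AE r in lborel. r \<in> {0<..<1} \<longrightarrow> rl_integral \<alpha> v r = 0"
    by eventually_elim (auto simp: f_def)
  then have "AE s in lborel. s \<in> {0<..<1} \<longrightarrow> v s = 0"
    by (rule rl_integral_zero_imp_AE_zero[OF \<alpha> v])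
  then show ?thesis
    by eventually_elim (auto simp: v_def)
qed

lemma K_op_continuous:
  fixes u :: "real \<Rightarrow> real^'n"
  assumes H: "0 < H" "H < 1" and u: "u \<in> L2_unit"
  shows "continuous_on {0..1} (K_op H u)"
proof -
  define \<alpha> where "\<alpha> = fbm_alpha H"
  note ex = fbm_exponents[OF H, folded \<alpha>_def]
  obtain C where C: "C \<ge> 0" "\<And>s t. 0 < s \<Longrightarrow> s < t \<Longrightarrow> 0 \<le> fbm_kernel H t s"
    "\<And>s t. 0 < s \<Longrightarrow> s < t \<Longrightarrow> fbm_kernel H t s \<le> C * t powr \<alpha> * (s powr - \<alpha> * (t - s) powr (H - 1/2))"
    using fbm_kernel_bound[OF H] unfolding \<alpha>_def by metis
  \<comment> \<open>Extension by 0 puts the kernels for all t on the same measure space, as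
    Scheffe's lemma requires.\<close>
  define k where "k = (\<lambda>t s. indicator {0<..<t} s * fbm_kernel H t s)"
  have km[measurable]: "k t \<in> borel_measurable borel" for t
  proof -
    have "continuous_on {0<..<t} (\<lambda>s. fbm_kernel H t s)"
      using continuous_on_compose2[OF continuous_on_fbm_kernel[OF H], of "{0<..<t}" "\<lambda>s. (t, s)"]
      by (force intro!: continuous_intros)
    then show ?thesis
      unfolding k_def using borel_measurable_continuous_on_indicator[of "{0<..<t}" "fbm_kernel H t"] by simp
  qed
  have k0: "k t s \<ge> 0" for t s using C(2)[of s t] by (auto simp: k_def indicator_def)
  define A where "A = (\<integral>\<^sup>+x. ennreal ((k 1 x)\<^sup>2) \<partial>lborel)"
  have A: "A < \<infinity>"
  proof -
    have int: "set_integrable lborel {0<..<1} (\<lambda>s. (1 - s) powr (2 * H - 1) * s powr (- 2 * \<alpha>))"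
      using set_integral_Beta(1)[of "2 * H" "1 - 2 * \<alpha>" 1] ex H by simp
    have "A \<le> (\<integral>\<^sup>+s. ennreal (C\<^sup>2 * (indicator {0<..<1} s *\<^sub>R ((1 - s) powr (2 * H - 1) * s powr (- 2 * \<alpha>)))) \<partial>lborel)"
      unfolding A_def
    proof (intro nn_integral_mono ennreal_leI)
      fix s :: real
      show "(k 1 s)\<^sup>2 \<le> C\<^sup>2 * (indicator {0<..<1} s *\<^sub>R ((1 - s) powr (2 * H - 1) * s powr (- 2 * \<alpha>)))"
      proof (cases "s \<in> {0<..<1}")
        case True
        have "(fbm_kernel H 1 s)\<^sup>2 \<le> (C * (s powr - \<alpha> * (1 - s) powr (H - 1/2)))\<^sup>2"
          using C(2)[of s 1] C(3)[of s 1] True by (intro power_mono) auto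
        also have "\<dots> = C\<^sup>2 * ((1 - s) powr (2 * H - 1) * s powr (- 2 * \<alpha>))"
          by (simp add: power_mult_distrib powr_square algebra_simps)
        finally show ?thesis using True by (simp add: k_def)
      qed (simp add: k_def)
    qed
    also have "\<dots> < \<infinity>"
    proof -
      have "integrable lborel (\<lambda>s. C\<^sup>2 * (indicator {0<..<1} s *\<^sub>R ((1 - s) powr (2 * H - 1) * s powr (- 2 * \<alpha>))))"
        using int by (intro integrable_mult_right) (simp add: set_integrable_def)
      from integrable_iff_bounded[THEN iffD1, OF this] show ?thesis
        by (auto simp: abs_mult)
    qed
    finally show ?thesis .
  qed
  \<comment> \<open>With s = tx, self-similarity contributes t^(2H - 1) and the Jacobian t.
    Continuity of t^(2H) then gives the convergence of norms in Scheffe's lemma.\<close>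
  have kk: "(\<integral>\<^sup>+s. ennreal ((k t s)\<^sup>2) \<partial>lborel) = ennreal (t powr (2 * H)) * A" if "t \<ge> 0" for t
  proof (cases "t = 0")
    case True
    then show ?thesis by (simp add: k_def)
  next
    case False
    then have t: "t > 0" using that by simp
    have sc: "(k t (t * x))\<^sup>2 = t powr (2 * H - 1) * (k 1 x)\<^sup>2" for x
    proof -
      have i: "t * x \<in> {0<..<t} \<longleftrightarrow> x \<in> {0<..<1}" using t by (auto simp: zero_less_mult_iff)
      show ?thesis
      proof (cases "x \<in> {0<..<1}")
        case True
        then show ?thesis
          using i t by (simp add: k_def fbm_kernel_scale power_mult_distrib powr_square algebra_simps)
      next
        case False
        then show ?thesis using i by (simp add: k_def)
      qed
    qed
    have "(\<integral>\<^sup>+s. ennreal ((k t s)\<^sup>2) \<partial>lborel) = ennreal t * (\<integral>\<^sup>+x. ennreal ((k t (t * x))\<^sup>2) \<partial>lborel)"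
      using t by (subst nn_integral_real_affine[where c = t and t = 0]) auto
    also have "\<dots> = ennreal t * (ennreal (t powr (2 * H - 1)) * A)"
      unfolding sc A_def by (simp add: ennreal_mult nn_integral_cmult)
    also have "\<dots> = ennreal (t powr 1 * t powr (2 * H - 1)) * A"
      using t by (simp add: ennreal_mult mult.assoc)
    also have "t powr 1 * t powr (2 * H - 1) = t powr (2 * H)" by (subst powr_add[symmetric]) simp
    finally show ?thesis .
  qed
  have k2: "integrable lborel (\<lambda>s. (k t s)\<^sup>2)" if "t \<ge> 0" for t
    using kk[OF that] A by (intro integrableI_bounded) (auto simp: ennreal_mult_less_top)
  define U where "U = (LBINT s. indicator {0..1} s *\<^sub>R (norm (u s))\<^sup>2)"
  define u0 where "u0 = (\<lambda>s. indicator {0..1} s *\<^sub>R u s)"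
  have u0: "u0 \<in> borel_measurable borel" "integrable lborel (\<lambda>s. (norm (u0 s))\<^sup>2)" "(LBINT s. (norm (u0 s))\<^sup>2) = U"
  proof -
    have "(norm (u0 s))\<^sup>2 = indicator {0..1} s *\<^sub>R (norm (u s))\<^sup>2" for s by (auto simp: u0_def indicator_def)
    then show "integrable lborel (\<lambda>s. (norm (u0 s))\<^sup>2)" "(LBINT s. (norm (u0 s))\<^sup>2) = U"
      using L2_unitD[OF u] by (simp_all add: U_def)
    show "u0 \<in> borel_measurable borel" using L2_unitD[OF u] by (simp add: u0_def)
  qed
  have "U \<ge> 0" unfolding U_def by (intro integral_nonneg_AE) auto
  have prod_int: "integrable lborel (\<lambda>s. f s *\<^sub>R u0 s)"
    if "f \<in> borel_measurable borel" "integrable lborel (\<lambda>s. (f s)\<^sup>2)" for f :: "real \<Rightarrow> real"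
    using set_integrable_scaleR_L2[of lborel UNIV f u0] that u0
    by (simp add: set_borel_measurable_def set_integrable_def)
  have Kop: "K_op H u t = (LBINT s. k t s *\<^sub>R u0 s)" if "t \<le> 1" for t
    unfolding K_op_def set_lebesgue_integral_def using that
    by (intro Bochner_Integration.integral_cong) (auto simp: k_def u0_def indicator_def)
  show ?thesis
  proof (rule continuous_on_sequentiallyI)
    fix X :: "nat \<Rightarrow> real" and t assume X: "\<forall>n. X n \<in> {0..1}" and t: "t \<in> {0..1}" and lim: "X \<longlonglongrightarrow> t"
    \<comment> \<open>for nonnegative kernels \<open>(k - k')\<^sup>2 \<le> \<bar>k\<^sup>2 - k'\<^sup>2\<bar>\<close>, so \<open>L\<^sup>1\<close> convergence of the squares, given by
      Scheffe's lemma, yields \<open>L\<^sup>2\<close> convergence of the kernels\<close>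
    define D where "D = (\<lambda>n. \<integral>\<^sup>+s. ennreal (norm ((k (X n) s)\<^sup>2 - (k t s)\<^sup>2)) \<partial>lborel)"
    have D: "D \<longlonglongrightarrow> 0" unfolding D_def
    proof (rule Scheffe_lemma1)
      show "integrable lborel (\<lambda>s. (k (X n) s)\<^sup>2)" for n using X by (intro k2) auto
      show "integrable lborel (\<lambda>s. (k t s)\<^sup>2)" using t by (intro k2) auto
      \<comment> \<open>The diagonal point s = t is a null set and is left out. For s > t the
        kernels eventually vanish; for 0 < s < t the kernel is continuous in its first
        variable.\<close>
      have "(\<lambda>n. (k (X n) s)\<^sup>2) \<longlonglongrightarrow> (k t s)\<^sup>2" if st: "s \<noteq> t" for s
      proof -
        consider "s \<le> 0" | "s > t" "s > 0" | "0 < s" "s < t" using st by linarith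
        then show ?thesis
        proof cases
          case 1
          then show ?thesis by (simp add: k_def)
        next
          case 2
          have "eventually (\<lambda>n. X n < s) sequentially" using lim 2(1) by (rule order_tendstoD(2))
          then have "eventually (\<lambda>n. (k (X n) s)\<^sup>2 = (k t s)\<^sup>2) sequentially"
            by eventually_elim (use 2 in \<open>auto simp: k_def\<close>)
          then show ?thesis by (rule tendsto_eventually)
        next
          case 3
          have ev: "eventually (\<lambda>n. X n > s) sequentially" using lim 3 by (intro order_tendstoD(1)) auto
          have op: "open {(t, s). 0 < s \<and> s < (t :: real)}"
          proof -
            have "{(t, s). 0 < s \<and> s < (t :: real)} = {p. 0 < snd p} \<inter> {p. snd p < fst p}" by auto
            also have "open \<dots>" by (intro open_Int open_Collect_less continuous_intros)
            finally show ?thesis .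
          qed
          have "isCont (\<lambda>(t, s). fbm_kernel H t s) (t, s)"
            using continuous_on_fbm_kernel[OF H] op 3 by (simp add: continuous_on_eq_continuous_at)
          then have "(\<lambda>n. case (X n, s) of (t, s) \<Rightarrow> fbm_kernel H t s) \<longlonglongrightarrow> (case (t, s) of (t, s) \<Rightarrow> fbm_kernel H t s)"
            by (rule isCont_tendsto_compose) (intro tendsto_intros lim)
          then have "(\<lambda>n. (fbm_kernel H (X n) s)\<^sup>2) \<longlonglongrightarrow> (fbm_kernel H t s)\<^sup>2"
            by (intro tendsto_power) simp
          moreover have "eventually (\<lambda>n. (fbm_kernel H (X n) s)\<^sup>2 = (k (X n) s)\<^sup>2) sequentially"
            using ev by eventually_elim (use 3 in \<open>simp add: k_def\<close>)
          ultimately show ?thesis using 3 by (auto simp: k_def intro: Lim_transform_eventually)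
        qed
      qed
      then show "AE s in lborel. (\<lambda>n. (k (X n) s)\<^sup>2) \<longlonglongrightarrow> (k t s)\<^sup>2"
        using AE_lborel_singleton[of t] by (auto elim: eventually_mono)
      have "(\<lambda>n. A * ennreal (X n powr (2 * H))) \<longlonglongrightarrow> A * ennreal (t powr (2 * H))"
      proof (intro ennreal_tendsto_cmult tendsto_ennrealI)
        show "(\<lambda>n. X n powr (2 * H)) \<longlonglongrightarrow> t powr (2 * H)"
          using X H by (intro tendsto_powr2 lim tendsto_const) auto
      qed (use A in auto)
      then have "(\<lambda>n. ennreal (X n powr (2 * H)) * A) \<longlonglongrightarrow> ennreal (t powr (2 * H)) * A"
        by (simp only: mult.commute)
      then have "limsup (\<lambda>n. \<integral>\<^sup>+s. ennreal (norm ((k (X n) s)\<^sup>2)) \<partial>lborel) = ennreal (t powr (2 * H)) * A"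
        using kk X by (simp add: lim_imp_Limsup)
      then show "limsup (\<lambda>n. \<integral>\<^sup>+s. ennreal (norm ((k (X n) s)\<^sup>2)) \<partial>lborel) \<le> (\<integral>\<^sup>+s. ennreal (norm ((k t s)\<^sup>2)) \<partial>lborel)"
        using kk[of t] t by simp
    qed
    have dint: "integrable lborel (\<lambda>s. \<bar>(k (X n) s)\<^sup>2 - (k t s)\<^sup>2\<bar>)" for n
      using X t by (intro integrable_abs Bochner_Integration.integrable_diff k2) auto
    define d where "d = (\<lambda>n. LBINT s. \<bar>(k (X n) s)\<^sup>2 - (k t s)\<^sup>2\<bar>)"
    have dD: "D n = ennreal (d n)" "d n \<ge> 0" for n
      unfolding D_def d_def using dint[of n] by (auto intro!: nn_integral_eq_integral integral_nonneg_AE)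
    have "(\<lambda>n. ennreal (d n)) \<longlonglongrightarrow> ennreal 0"
    proof -
      have "D = (\<lambda>n. ennreal (d n))" using dD(1) by (rule ext)
      then show ?thesis using D by simp
    qed
    then have d: "d \<longlonglongrightarrow> 0"
      by (rule tendsto_ennrealD) (use dD in auto)
    \<comment> \<open>Young's inequality with a free weight e takes the place of Cauchy-Schwarz: for
      fixed e the term d n / e tends to 0, while e U is made small by the choice of e.\<close>
    have est: "norm (K_op H u (X n) - K_op H u t) \<le> d n / e + e * U" if "e > 0" for n and e :: real
    proof -
      have "K_op H u (X n) - K_op H u t = (LBINT s. (k (X n) s - k t s) *\<^sub>R u0 s)"
        using X t k2 by (simp add: Kop scaleR_diff_left prod_int)
      also have "norm \<dots> \<le> (LBINT s. \<bar>(k (X n) s)\<^sup>2 - (k t s)\<^sup>2\<bar> / e + e * (norm (u0 s))\<^sup>2)"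
      proof (rule Bochner_Integration.integral_norm_bound_integral)
        show "integrable lborel (\<lambda>s. (k (X n) s - k t s) *\<^sub>R u0 s)"
          unfolding scaleR_diff_left using X t by (intro Bochner_Integration.integrable_diff prod_int k2) auto
        show "integrable lborel (\<lambda>s. \<bar>(k (X n) s)\<^sup>2 - (k t s)\<^sup>2\<bar> / e + e * (norm (u0 s))\<^sup>2)"
          using dint u0 by (intro Bochner_Integration.integrable_add integrable_divide integrable_mult_right) auto
        fix s
        have "(k (X n) s - k t s)\<^sup>2 \<le> \<bar>(k (X n) s)\<^sup>2 - (k t s)\<^sup>2\<bar>"
        proof -
          have "\<bar>k (X n) s - k t s\<bar> * \<bar>k (X n) s - k t s\<bar> \<le> \<bar>k (X n) s - k t s\<bar> * \<bar>k (X n) s + k t s\<bar>"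
            using k0[of "X n" s] k0[of t s] by (intro mult_left_mono) auto
          then show ?thesis by (simp add: power2_eq_square algebra_simps flip: abs_mult)
        qed
        then have "(k (X n) s - k t s)\<^sup>2 / e + e * (norm (u0 s))\<^sup>2 \<le> \<bar>(k (X n) s)\<^sup>2 - (k t s)\<^sup>2\<bar> / e + e * (norm (u0 s))\<^sup>2"
          using that by (intro add_right_mono divide_right_mono) auto
        moreover have "\<bar>x\<bar> * y \<le> x\<^sup>2 / e + e * y\<^sup>2" if "y \<ge> 0" for x y :: real
        proof -
          have "0 \<le> (\<bar>x\<bar> - e * y)\<^sup>2 / e" using \<open>e > 0\<close> by simp
          also have "\<dots> = x\<^sup>2 / e + e * y\<^sup>2 - 2 * (\<bar>x\<bar> * y)"
            using \<open>e > 0\<close> by (simp add: power2_diff field_simps power2_eq_square)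
          finally have "2 * (\<bar>x\<bar> * y) \<le> x\<^sup>2 / e + e * y\<^sup>2" by simp
          moreover have "0 \<le> \<bar>x\<bar> * y" using that by simp
          ultimately show ?thesis by linarith
        qed
        ultimately show "norm ((k (X n) s - k t s) *\<^sub>R u0 s) \<le> \<bar>(k (X n) s)\<^sup>2 - (k t s)\<^sup>2\<bar> / e + e * (norm (u0 s))\<^sup>2"
          by (smt (verit) norm_ge_zero norm_scaleR)
      qed
      also have "\<dots> = d n / e + e * U"
        using dint u0 by (simp add: d_def)
      finally show ?thesis .
    qed
    show "(\<lambda>n. K_op H u (X n)) \<longlonglongrightarrow> K_op H u t"
    proof (rule LIMSEQ_I)
      fix r :: real assume r: "r > 0"
      \<comment> \<open>U may be 0; dividing by U + 1 is safe and keeps e U at most r / 2.\<close>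
      define e where "e = r / (2 * (U + 1))"
      have e: "e > 0" "e * U < r / 2 + r / 2 * 0" "e * U \<le> r / 2"
        using r \<open>U \<ge> 0\<close> by (auto simp: e_def field_simps)
      have "(\<lambda>n. d n / e) \<longlonglongrightarrow> 0 / e" using e by (intro tendsto_intros d) auto
      then have "eventually (\<lambda>n. d n / e < r / 2) sequentially"
        using r by (intro order_tendstoD(2)) auto
      then show "\<exists>N. \<forall>n\<ge>N. norm (K_op H u (X n) - K_op H u t) < r"
        unfolding eventually_sequentially using est[OF e(1)] e(3) by (smt (verit) field_sum_of_halves)
    qed
  qed
qed

section \<open>Solvability of the Volterra equation\<close>

lemma continuous_on_unit_bounded:
  fixes w :: "real \<Rightarrow> 'a::real_normed_vector"
  assumes "continuous_on {0..1} w"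
  obtains W where "\<And>x. x \<in> {0..1} \<Longrightarrow> norm (w x) \<le> W"
proof -
  have "bounded (w ` {0..1})"
    using assms by (intro compact_imp_bounded compact_continuous_image) auto
  then show ?thesis using that unfolding bounded_iff by (metis image_eqI)
qed

lemma L2_unit_dominated:
  fixes u :: "real \<Rightarrow> 'a::euclidean_space"
  assumes m: "set_borel_measurable borel {0<..<1} u"
    and bound: "\<And>s. 0 < s \<Longrightarrow> s < 1 \<Longrightarrow> norm (u s) \<le> B * s powr - a" and "a < 1/2"
  shows "(\<lambda>s. indicator {0<..<1} s *\<^sub>R u s) \<in> L2_unit"
proof -
  let ?u = "\<lambda>s. indicator {0<..<1} s *\<^sub>R u s"
  have um[measurable]: "?u \<in> borel_measurable borel" using m by (simp add: set_borel_measurable_def)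
  have "set_integrable lborel {0<..<1} (\<lambda>s. (1 - s) powr (1 - 1) * s powr ((1 - 2 * a) - 1))"
    using assms by (intro set_integral_Beta) auto
  then have int: "integrable lborel (\<lambda>s. B\<^sup>2 * (indicator {0<..<1} s *\<^sub>R ((1 - s) powr (1 - 1) * s powr ((1 - 2 * a) - 1))))"
    unfolding set_integrable_def by (rule integrable_mult_right)
  have "set_integrable lborel {0..1} (\<lambda>s. (norm (?u s))\<^sup>2)"
    unfolding set_integrable_def
  proof (rule Bochner_Integration.integrable_bound[OF int])
    have "norm (indicator {0..1} s *\<^sub>R (norm (?u s))\<^sup>2) \<le> norm (B\<^sup>2 * (indicator {0<..<1} s *\<^sub>R ((1 - s) powr (1 - 1) * s powr ((1 - 2 * a) - 1))))" for s
    proof (cases "s \<in> {0<..<1}")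
      case True
      have "(norm (u s))\<^sup>2 \<le> (B * s powr - a)\<^sup>2" using bound True by (intro power_mono) auto
      then show ?thesis using True by (simp add: power_mult_distrib powr_square)
    qed auto
    then show "AE s in lborel. norm (indicator {0..1} s *\<^sub>R (norm (?u s))\<^sup>2) \<le> norm (B\<^sup>2 * (indicator {0<..<1} s *\<^sub>R ((1 - s) powr (1 - 1) * s powr ((1 - 2 * a) - 1))))"
      by simp
  qed measurable
  moreover have e: "(\<lambda>s. indicator {0..1} s *\<^sub>R ?u s) = ?u"
    by (auto simp: fun_eq_iff indicator_def)
  have "set_borel_measurable lborel {0..1} ?u"
    unfolding set_borel_measurable_def e using um by simp
  ultimately show ?thesis unfolding L2_unit_def by blast
qed

text \<open>An order equal to 1 turns its power into a zeroth power, which is 1 on the open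
  interval. The instances with exponent \<open>1 - 1\<close> below obtain in this way a weight at
  one end only, or none.\<close>

lemma set_integrable_rl_bounded:
  fixes f :: "real \<Rightarrow> 'a::euclidean_space"
  assumes "a > 0" "b > 0" "t > 0" "\<And>s. 0 < s \<Longrightarrow> s < t \<Longrightarrow> norm (f s) \<le> B" 
    and m: "set_borel_measurable borel {0<..<t} f"
  shows "set_integrable lborel {0<..<t} (\<lambda>s. ((t - s) powr (a - 1) * s powr (b - 1)) *\<^sub>R f s)"
  unfolding set_integrable_def
proof (rule Bochner_Integration.integrable_bound)
  have "set_integrable lborel {0<..<t} (\<lambda>r. B * ((t - r) powr (a - 1) * r powr (b - 1)))"
    using assms by (intro set_integrable_mult_right set_integral_Beta)
  then show "integrable lborel (\<lambda>r. indicator {0<..<t} r *\<^sub>R (B * ((t - r) powr (a - 1) * r powr (b - 1))))"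
    by (simp add: set_integrable_def)
  show "(\<lambda>s. indicator {0<..<t} s *\<^sub>R (((t - s) powr (a - 1) * s powr (b - 1)) *\<^sub>R f s)) \<in> borel_measurable lborel"
    using set_borel_measurable_scaleR[of "\<lambda>s. (t - s) powr (a - 1) * s powr (b - 1)" borel, OF _ m]
    by (simp add: set_borel_measurable_def)
  have "norm (f s) \<le> \<bar>B\<bar>" if "0 < s" "s < t" for s using assms(4)[OF that] by linarith
  then show "AE s in lborel. norm (indicator {0<..<t} s *\<^sub>R (((t - s) powr (a - 1) * s powr (b - 1)) *\<^sub>R f s)) \<le> norm (indicator {0<..<t} s *\<^sub>R (B * ((t - s) powr (a - 1) * s powr (b - 1))))"
    by (intro AE_I2) (auto simp: indicator_def abs_mult mult.commute intro!: mult_right_mono)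
qed

text \<open>\<open>Beta a 1\<close> equals 1/a, so this is the usual bound B t^a / a.\<close>

lemma norm_rl_integral_le:
  fixes f :: "real \<Rightarrow> 'a::euclidean_space"
  assumes "a > 0" "t > 0" and f: "\<And>s. 0 < s \<Longrightarrow> s < t \<Longrightarrow> norm (f s) \<le> B"
    and m: "set_borel_measurable borel {0<..<t} f"
  shows "norm (rl_integral a f t) \<le> B * (Beta a 1 * t powr a)"
proof -
  have b: "set_integrable lborel {0<..<t} (\<lambda>r. (t - r) powr (a - 1) * r powr (1 - 1))"
    and bv: "(LBINT r:{0<..<t}. (t - r) powr (a - 1) * r powr (1 - 1)) = Beta a 1 * t powr (a + 1 - 1)"
    using assms by (intro set_integral_Beta; simp)+
  have "rl_integral a f t = (LBINT r:{0<..<t}. ((t - r) powr (a - 1) * r powr (1 - 1)) *\<^sub>R f r)"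
    unfolding rl_integral_def by (intro set_lebesgue_integral_cong) auto
  also have "norm \<dots> \<le> (LBINT r:{0<..<t}. B * ((t - r) powr (a - 1) * r powr (1 - 1)))"
    unfolding set_lebesgue_integral_def
    using set_integrable_rl_bounded[OF assms(1) _ assms(2) f m, of 1] set_integrable_mult_right[OF b, of B] f
    by (intro Bochner_Integration.integral_norm_bound_integral)
       (auto simp: set_integrable_def indicator_def mult.commute intro!: mult_right_mono)
  also have "\<dots> = B * (Beta a 1 * t powr a)" using bv by simp
  finally show ?thesis .
qed

lemma rl_integral_scaleR: "rl_integral a (\<lambda>s. c *\<^sub>R f s) t = c *\<^sub>R rl_integral a f t"
proof -
  have "rl_integral a (\<lambda>s. c *\<^sub>R f s) t = (LBINT s:{0<..<t}. c *\<^sub>R ((t - s) powr (a - 1) *\<^sub>R f s))"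
    unfolding rl_integral_def by (simp add: mult.commute)
  then show ?thesis unfolding rl_integral_def by (simp only: set_integral_scaleR_right)
qed

lemma rl_integral_cong:
  "(\<And>s. 0 < s \<Longrightarrow> s < t \<Longrightarrow> f s = g s) \<Longrightarrow> rl_integral a f t = rl_integral a g t"
  unfolding rl_integral_def by (intro set_lebesgue_integral_cong) auto

text \<open>A form of the index law I^a s^(-2a) I^a = s^(-a) I^(2a) s^(-a), here up to
  \<open>Beta a a\<close>. The inner integral is the weighted Beta integral with both parameters
  equal to a, and its factor q^(-a) cancels the weight q^a.\<close>

lemma rl_integral_weighted_composition:
  fixes w :: "real \<Rightarrow> 'a::euclidean_space"
  assumes a: "0 < a" and r: "0 < r" and w: "\<And>s. 0 < s \<Longrightarrow> s < r \<Longrightarrow> norm (w s) \<le> B"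
    and m: "set_borel_measurable borel {0<..<r} w"
  shows "rl_integral a (\<lambda>s. s powr - (2 * a) *\<^sub>R rl_integral a (\<lambda>q. q powr a *\<^sub>R w q) s) r
     = (Beta a a * r powr - a) *\<^sub>R rl_integral (2 * a) w r"
proof -
  let ?L = "\<lambda>s q. (r - s) powr (a - 1) * (s - q) powr (a - 1) * s powr - (a + a)"
  let ?M = "\<lambda>q. Beta a a * (r - q) powr (a + a - 1) * q powr - a * r powr - a"
  let ?f = "\<lambda>q. q powr a *\<^sub>R w q"
  have Bp: "Beta a a > 0" using a by (intro Beta_real_pos)
  have fm: "set_borel_measurable borel {0<..<r} ?f"
    by (rule set_borel_measurable_scaleR[OF _ m]) simp
  have nn: "(\<integral>\<^sup>+s\<in>{q<..<r}. ennreal (?L s q) \<partial>lborel) = ennreal (?M q)" if "0 < q" "q < r" for q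
    by (rule nn_integral_Beta_weighted[OF a a that])
  have inner: "(LBINT s:{q<..<r}. ?L s q) = ?M q" if "0 < q" "q < r" for q
    using that Bp by (intro set_integral_eq_nn_integral[OF nn]) (auto simp: set_borel_measurable_def)
  have "set_integrable lborel {0<..<r} (\<lambda>q. ((r - q) powr ((a + a) - 1) * q powr (1 - 1)) *\<^sub>R w q)"
    using a r w m by (intro set_integrable_rl_bounded) auto
  then have "set_integrable lborel {0<..<r} (\<lambda>q. (Beta a a * r powr - a) * norm (((r - q) powr ((a + a) - 1) * q powr (1 - 1)) *\<^sub>R w q))"
    by (intro set_integrable_mult_right set_integrable_norm)
  then have M: "set_integrable lborel {0<..<r} (\<lambda>q. ?M q *\<^sub>R norm (?f q))"
    by (rule set_integrable_cong[THEN iffD1, rotated -1]) (auto simp: powr_minus)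
  have "(LBINT s:{0<..<r}. LBINT q:{0<..<s}. ?L s q *\<^sub>R ?f q) = (LBINT q:{0<..<r}. (LBINT s:{q<..<r}. ?L s q) *\<^sub>R ?f q)"
  proof (rule triangle_integral[where M = ?M])
    show "case_prod ?L \<in> borel_measurable (borel \<Otimes>\<^sub>M borel)" by measurable
  qed (use fm nn M Bp in auto)
  also have "\<dots> = (LBINT q:{0<..<r}. (Beta a a * r powr - a) *\<^sub>R ((r - q) powr (2 * a - 1) *\<^sub>R w q))"
  proof (intro set_lebesgue_integral_cong allI impI)
    fix q assume "q \<in> {0<..<r}"
    then have q: "0 < q" "q < r" by auto
    show "(LBINT s:{q<..<r}. ?L s q) *\<^sub>R ?f q = (Beta a a * r powr - a) *\<^sub>R ((r - q) powr (2 * a - 1) *\<^sub>R w q)"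
      unfolding inner[OF q] using q by (simp add: powr_minus)
  qed simp
  also have "\<dots> = (Beta a a * r powr - a) *\<^sub>R rl_integral (2 * a) w r"
    unfolding rl_integral_def by (simp only: set_integral_scaleR_right)
  also have "(LBINT s:{0<..<r}. LBINT q:{0<..<s}. ?L s q *\<^sub>R ?f q)
     = rl_integral a (\<lambda>s. s powr - (2 * a) *\<^sub>R rl_integral a ?f s) r"
    unfolding rl_integral_def set_integral_scaleR_right[symmetric] by (simp add: mult_ac)
  finally show ?thesis .
qed

lemma K_op_scaleR: "K_op H (\<lambda>s. c *\<^sub>R u s) t = c *\<^sub>R K_op H u t"
proof -
  have "K_op H (\<lambda>s. c *\<^sub>R u s) t = (LBINT s:{0<..<t}. c *\<^sub>R (fbm_kernel H t s *\<^sub>R u s))"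
    unfolding K_op_def by (simp add: mult.commute)
  then show ?thesis unfolding K_op_def by (simp only: set_integral_scaleR_right)
qed

lemma L2_unit_scaleR: 
  assumes "u \<in> L2_unit"
  shows "(\<lambda>s. c *\<^sub>R u s) \<in> L2_unit"
proof -
  have "(\<lambda>s. c *\<^sub>R (indicator {0..1} s *\<^sub>R u s)) \<in> borel_measurable lborel"
    using assms unfolding L2_unit_def set_borel_measurable_def
    by (intro borel_measurable_scaleR[OF borel_measurable_const]) blast
  moreover have "(\<lambda>s. c *\<^sub>R (indicator {0..1} s *\<^sub>R u s)) = (\<lambda>s. indicator {0..1} s *\<^sub>R (c *\<^sub>R u s))"
    by (simp add: fun_eq_iff mult.commute)
  ultimately have "set_borel_measurable lborel {0..1} (\<lambda>s. c *\<^sub>R u s)"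
    unfolding set_borel_measurable_def by (simp only:)
  moreover have "set_integrable lborel {0..1} (\<lambda>s. c\<^sup>2 * (norm (u s))\<^sup>2)"
    using assms by (intro set_integrable_mult_right) (auto simp: L2_unit_def)
  ultimately show ?thesis
    unfolding L2_unit_def by (simp add: power_mult_distrib)
qed

text \<open>The solution is a multiple of \<open>s\<^sup>-\<^sup>\<alpha> I\<^sup>\<alpha> (q\<^sup>\<alpha> w)\<close>.\<close>

lemma K_op_surjective_rough:
  fixes w :: "real \<Rightarrow> real^'n"
  assumes H: "0 < H" "H < 1/2" and w: "continuous_on {0..1} w"
  obtains u c where "u \<in> L2_unit" "c \<noteq> 0" "\<And>t. t \<in> {0<..1} \<Longrightarrow> K_op H u t = c *\<^sub>R (LBINT s:{0<..<t}. w s)"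
proof -
  define \<alpha> where "\<alpha> = fbm_alpha H"
  have H': "H < 1" "H \<noteq> 1/2" using H by auto
  have \<alpha>: "0 < \<alpha>" "\<alpha> < 1/2" "fbm_gamma H = 1 - 2 * \<alpha>" "1 - 2 * \<alpha> > 0" 
    using H by (auto simp: \<alpha>_def fbm_alpha_def fbm_gamma_def)
  obtain W where W: "\<And>x. x \<in> {0..1} \<Longrightarrow> norm (w x) \<le> W"
    using continuous_on_unit_bounded[OF w] by blast
  have wm: "set_borel_measurable borel {0<..<t} w" if "t \<le> 1" for t
    unfolding set_borel_measurable_def using that
    by (intro borel_measurable_continuous_on_indicator continuous_on_subset[OF w]) auto
  let ?f = "\<lambda>q. q powr \<alpha> *\<^sub>R w q"
  have fm: "set_borel_measurable borel {0<..<t} ?f" if "t \<le> 1" for t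
    by (rule set_borel_measurable_scaleR[OF _ wm[OF that]]) simp
  have fb: "norm (?f s) \<le> W * t powr \<alpha>" if "0 < s" "s < t" "t \<le> 1" for s t
  proof -
    have "s powr \<alpha> * norm (w s) \<le> t powr \<alpha> * W" 
      using that \<alpha> W[of s] by (intro mult_mono powr_mono2) auto
    then show ?thesis by (simp add: mult.commute)
  qed
  have fint: "set_integrable lborel {0<..<1} ?f"
  proof -
    have "set_integrable lborel {0<..<1} (\<lambda>q. ((1 - q) powr (1 - 1) * q powr (1 - 1)) *\<^sub>R ?f q)"
      using fb[of _ 1] fm[of 1] by (intro set_integrable_rl_bounded) auto
    then show ?thesis by (rule set_integrable_cong[THEN iffD1, rotated -1]) auto
  qed
  define u0 where "u0 = (\<lambda>s. s powr - \<alpha> *\<^sub>R rl_integral \<alpha> ?f s)"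
  define u where "u = (\<lambda>s. indicator {0<..<1} s *\<^sub>R u0 s)"
  have u: "u \<in> L2_unit" unfolding u_def
  proof (rule L2_unit_dominated)
    have "set_borel_measurable borel {0<..<1} (rl_integral \<alpha> ?f)"
      by (intro set_integrable_imp_borel_measurable set_integrable_rl_integral \<alpha> fint)
    then show "set_borel_measurable borel {0<..<1} u0"
      unfolding u0_def by (rule set_borel_measurable_scaleR[rotated]) simp
    fix s :: real assume s: "0 < s" "s < 1"
    have "norm (u0 s) = s powr - \<alpha> * norm (rl_integral \<alpha> ?f s)" by (simp add: u0_def)
    also have "\<dots> \<le> s powr - \<alpha> * (W * s powr \<alpha> * (Beta \<alpha> 1 * s powr \<alpha>))"
      using s fb[of _ s] fm[of s] \<alpha> by (intro mult_left_mono norm_rl_integral_le) auto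
    \<comment> \<open>The exponent is +\<alpha>, written as the domination criterion for square
      integrability expects it, with its parameter equal to -\<alpha>.\<close>
    also have "\<dots> = W * Beta \<alpha> 1 * s powr - (- \<alpha>)" using s by (simp add: powr_minus field_simps)
    finally show "norm (u0 s) \<le> W * Beta \<alpha> 1 * s powr - (- \<alpha>)" .
  qed (use \<alpha> in auto)
  \<comment> \<open>The weight s^(-\<alpha>) of the operator and that in u0 combine to
    s^(-2\<alpha>), the form of the index law. The factor r^\<alpha> of the operator will cancel
    r^(-\<alpha>), and the orders 1 - 2\<alpha> and 2\<alpha> add up to 1.\<close>
  have key: "rl_integral \<alpha> (\<lambda>s. s powr - \<alpha> *\<^sub>R u s) r = (Beta \<alpha> \<alpha> * r powr - \<alpha>) *\<^sub>R rl_integral (2 * \<alpha>) w r"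
    if "0 < r" "r \<le> 1" for r
  proof -
    have "rl_integral \<alpha> (\<lambda>s. s powr - \<alpha> *\<^sub>R u s) r = rl_integral \<alpha> (\<lambda>s. s powr - (2 * \<alpha>) *\<^sub>R rl_integral \<alpha> ?f s) r"
      using that by (intro rl_integral_cong) (auto simp: u_def u0_def simp flip: powr_add)
    also have "\<dots> = (Beta \<alpha> \<alpha> * r powr - \<alpha>) *\<^sub>R rl_integral (2 * \<alpha>) w r"
      using that W \<alpha> by (intro rl_integral_weighted_composition[where B = W] wm) auto
    finally show ?thesis .
  qed
  \<comment> \<open>The constant of the kernel times the Beta factors of the index law and of the
    semigroup law.\<close>
  define c where "c = fbm_c H / Beta \<alpha> (1 - 2 * \<alpha>) * (Beta \<alpha> \<alpha> * Beta (1 - 2 * \<alpha>) (2 * \<alpha>))"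
  show ?thesis
  proof (rule that[OF u])
    show "c \<noteq> 0"
      using fbm_c_pos[OF H(1) H'(1)] Beta_real_pos[of \<alpha> "1 - 2 * \<alpha>"] Beta_real_pos[of \<alpha> \<alpha>] Beta_real_pos[of "1 - 2 * \<alpha>" "2 * \<alpha>"] \<alpha>
      by (auto simp: c_def)
    fix t :: real assume "t \<in> {0<..1}"
    then have t: "0 < t" "t \<le> 1" by auto
    have "rl_integral (1 - 2 * \<alpha>) (\<lambda>r. r powr \<alpha> *\<^sub>R rl_integral \<alpha> (\<lambda>s. s powr - \<alpha> *\<^sub>R u s) r) t
       = rl_integral (1 - 2 * \<alpha>) (\<lambda>r. Beta \<alpha> \<alpha> *\<^sub>R rl_integral (2 * \<alpha>) w r) t"
    proof (intro rl_integral_cong)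
      fix s assume "0 < s" "s < t"
      then show "s powr \<alpha> *\<^sub>R rl_integral \<alpha> (\<lambda>s. s powr - \<alpha> *\<^sub>R u s) s = Beta \<alpha> \<alpha> *\<^sub>R rl_integral (2 * \<alpha>) w s"
        using t by (subst key) (auto simp: powr_minus)
    qed
    also have "\<dots> = Beta \<alpha> \<alpha> *\<^sub>R rl_integral (1 - 2 * \<alpha>) (rl_integral (2 * \<alpha>) w) t"
      by (rule rl_integral_scaleR)
    also have "rl_integral (1 - 2 * \<alpha>) (rl_integral (2 * \<alpha>) w) t = Beta (1 - 2 * \<alpha>) (2 * \<alpha>) *\<^sub>R rl_integral (1 - 2 * \<alpha> + 2 * \<alpha>) w t"
    proof (rule rl_integral_semigroup(2))
      have "set_integrable lborel {0<..<t} (\<lambda>s. ((t - s) powr (1 - 1) * s powr (1 - 1)) *\<^sub>R w s)"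
        using W t by (intro set_integrable_rl_bounded[where B = W] wm) auto
      then have "set_integrable lborel {0<..<t} (\<lambda>s. norm (((t - s) powr (1 - 1) * s powr (1 - 1)) *\<^sub>R w s))"
        by (rule set_integrable_norm)
      then show "set_integrable lborel {0<..<t} (\<lambda>s. (t - s) powr (1 - 2 * \<alpha> + 2 * \<alpha> - 1) *\<^sub>R norm (w s))"
        by (rule set_integrable_cong[THEN iffD1, rotated -1]) auto
    qed (use \<alpha> wm t in auto)
    finally show "K_op H u t = c *\<^sub>R (LBINT s:{0<..<t}. w s)"
      unfolding K_op_eq_rl_integral[OF H(1) H' u t] \<alpha>_def[symmetric] \<alpha>(3) by (simp add: c_def rl_integral_1)
  qed
qed

lemma K_op_surjective_half:
  fixes w :: "real \<Rightarrow> real^'n"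
  assumes w: "continuous_on {0..1} w"
  obtains u c where "u \<in> L2_unit" "c \<noteq> 0" "\<And>t. t \<in> {0<..1} \<Longrightarrow> K_op (1/2) u t = c *\<^sub>R (LBINT s:{0<..<t}. w s)"
proof (rule that[of "\<lambda>s. indicator {0<..<1} s *\<^sub>R w s" "fbm_c (1/2)"])
  obtain W where W: "\<And>x. x \<in> {0..1} \<Longrightarrow> norm (w x) \<le> W"
    using continuous_on_unit_bounded[OF w] by blast
  show "(\<lambda>s. indicator {0<..<1} s *\<^sub>R w s) \<in> L2_unit"
  proof (rule L2_unit_dominated)
    show "set_borel_measurable borel {0<..<1} w"
      unfolding set_borel_measurable_def
      by (intro borel_measurable_continuous_on_indicator continuous_on_subset[OF w]) auto
    show "norm (w s) \<le> W * s powr - 0" if "0 < s" "s < 1" for s using W[of s] that by simp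
  qed simp
  show "fbm_c (1/2) \<noteq> 0" using fbm_c_pos[of "1/2"] by simp
  show "K_op (1/2) (\<lambda>s. indicator {0<..<1} s *\<^sub>R w s) t = fbm_c (1/2) *\<^sub>R (LBINT s:{0<..<t}. w s)" if "t \<in> {0<..1}" for t
    using that by (subst K_op_half) (auto intro!: set_lebesgue_integral_cong)
qed

section \<open>Bounded densities and the integrated product rule\<close>

lemma Lipschitz_density:
  fixes E :: "real \<Rightarrow> 'a::euclidean_space"
  assumes lip: "L-lipschitz_on UNIV E"
  obtains \<rho> :: "real \<Rightarrow> 'a" and B where "\<rho> \<in> borel_measurable borel" "\<And>x. norm (\<rho> x) \<le> B"
    "\<And>a b. a \<le> b \<Longrightarrow> (LBINT x:{a<..<b}. \<rho> x) = E b - E a"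
proof -
  have "\<exists>r. \<exists>B. r \<in> borel_measurable borel \<and> (\<forall>x. \<bar>r x\<bar> \<le> B) \<and> (\<forall>a b. a \<le> b \<longrightarrow> (LBINT x:{a<..<b}. r x) = E b \<bullet> i - E a \<bullet> i)"
    if i: "i \<in> Basis" for i :: 'a
  proof -
    have "L-lipschitz_on UNIV (\<lambda>x. E x \<bullet> i)"
    proof (rule lipschitz_onI)
      fix x y :: real
      have "dist (E x \<bullet> i) (E y \<bullet> i) \<le> norm (E x - E y)"
        using Basis_le_norm[OF i, of "E x - E y"] by (simp add: dist_real_def inner_diff_left)
      also have "\<dots> \<le> L * dist x y" using lipschitz_onD[OF lip, of x y] by (simp add: dist_norm)
      finally show "dist (E x \<bullet> i) (E y \<bullet> i) \<le> L * dist x y" .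
    qed (use lip in \<open>simp add: lipschitz_on_def\<close>)
    then show ?thesis by (rule Lipschitz_real_density) blast
  qed
  then obtain r B where r: "\<And>i. i \<in> Basis \<Longrightarrow> r i \<in> borel_measurable borel"
    "\<And>i x. i \<in> Basis \<Longrightarrow> \<bar>r i x\<bar> \<le> B i"
    "\<And>i a b. i \<in> Basis \<Longrightarrow> a \<le> b \<Longrightarrow> (LBINT x:{a<..<b}. r i x) = E b \<bullet> i - E a \<bullet> i"
    by metis
  show ?thesis
  proof
    show "(\<lambda>x. \<Sum>i\<in>Basis. r i x *\<^sub>R i) \<in> borel_measurable borel"
      using r(1) by (intro borel_measurable_sum borel_measurable_scaleR) auto
    show "norm (\<Sum>i\<in>Basis. r i x *\<^sub>R i) \<le> (\<Sum>i\<in>Basis. B i)" for x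
      using r(2) by (intro order.trans[OF norm_sum] sum_mono) auto
    fix a b :: real assume ab: "a \<le> b"
    have int: "set_integrable lborel {a<..<b} (\<lambda>x. r i x)" if "i \<in> Basis" for i
      unfolding set_integrable_def
    proof (rule Bochner_Integration.integrable_bound)
      show "integrable lborel (\<lambda>x. B i * indicator {a<..<b} x)"
        using ab by (intro integrable_mult_right integrable_real_indicator) auto
      show "(\<lambda>x. indicator {a<..<b} x *\<^sub>R r i x) \<in> borel_measurable lborel" using r(1)[OF that] by simp
      have "\<bar>r i x\<bar> \<le> \<bar>B i\<bar>" for x using r(2)[OF that, of x] by linarith
      then show "AE x in lborel. norm (indicator {a<..<b} x *\<^sub>R r i x) \<le> norm (B i * indicator {a<..<b} x)"
        by (intro AE_I2) (auto simp: indicator_def)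
    qed
    have "(LBINT x:{a<..<b}. \<Sum>i\<in>Basis. r i x *\<^sub>R i) = (\<Sum>i\<in>Basis. LBINT x. (indicator {a<..<b} x *\<^sub>R r i x) *\<^sub>R i)"
      unfolding set_lebesgue_integral_def scaleR_sum_right
      using int by (subst Bochner_Integration.integral_sum[symmetric]) (auto simp: set_integrable_def)
    also have "\<dots> = (\<Sum>i\<in>Basis. (E b \<bullet> i - E a \<bullet> i) *\<^sub>R i)"
      using int r(3)[OF _ ab] by (intro sum.cong refl) (simp add: set_integrable_def set_lebesgue_integral_def integral_scaleR_left)
    also have "\<dots> = (\<Sum>i\<in>Basis. ((E b - E a) \<bullet> i) *\<^sub>R i)" by (simp add: inner_diff_left)
    finally show "(LBINT x:{a<..<b}. \<Sum>i\<in>Basis. r i x *\<^sub>R i) = E b - E a"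
      by (simp only: euclidean_representation)
  qed
qed

lemma set_integral_FTC_powr:
  fixes a q t :: real
  assumes "0 < a" "0 < q" "q < t" 
  shows "(\<integral>\<^sup>+r\<in>{q<..<t}. ennreal (a * r powr (a - 1)) \<partial>lborel) = ennreal (t powr a - q powr a)"
proof -
  have "(\<integral>\<^sup>+r. ennreal (a * r powr (a - 1)) * indicator {q..t} r \<partial>lborel) = ennreal (t powr a - q powr a)"
  proof (rule nn_integral_FTC_Icc)
    show "((\<lambda>r. r powr a) has_real_derivative a * x powr (a - 1)) (at x)" if "x \<in> {q..t}" for x
      using has_real_derivative_powr[of x a] that assms by auto
  qed (use assms in auto)
  moreover have neq: "AE r in lborel. r \<noteq> q \<and> r \<noteq> t"
    using AE_lborel_singleton[of q] AE_lborel_singleton[of t] by eventually_elim auto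
  have "(\<integral>\<^sup>+r. ennreal (a * r powr (a - 1)) * indicator {q<..<t} r \<partial>lborel) = (\<integral>\<^sup>+r. ennreal (a * r powr (a - 1)) * indicator {q..t} r \<partial>lborel)"
  proof (rule nn_integral_cong_AE)
    show "AE r in lborel. ennreal (a * r powr (a - 1)) * indicator {q<..<t} r = ennreal (a * r powr (a - 1)) * indicator {q..t} r"
      using neq by (rule eventually_mono) (auto simp: indicator_def)
  qed
  ultimately show ?thesis by simp
qed

text \<open>The boundary term of s^a E(s) at 0 vanishes because a > 0. E is only a primitive of
  \<rho>, so nothing is differentiated: E(s) is written as E(0) plus the integral of \<rho>, and
  Fubini turns the term with a s^(a - 1) into the integral of t^a - q^a against \<rho>.\<close>

lemma set_integral_AC_product:
  fixes E \<rho> :: "real \<Rightarrow> 'a::euclidean_space"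
  assumes a: "0 < a" "a \<le> 1" and t: "0 < t"
    and \<rho>: "\<rho> \<in> borel_measurable borel" "\<And>x. norm (\<rho> x) \<le> B"
    and E: "\<And>s. 0 \<le> s \<Longrightarrow> s \<le> t \<Longrightarrow> (LBINT x:{0<..<s}. \<rho> x) = E s - E 0"
  shows "set_integrable lborel {0<..<t} (\<lambda>s. (a * s powr (a - 1)) *\<^sub>R E s + s powr a *\<^sub>R \<rho> s)"
    and "(LBINT s:{0<..<t}. (a * s powr (a - 1)) *\<^sub>R E s + s powr a *\<^sub>R \<rho> s) = t powr a *\<^sub>R E t"
proof -
  let ?f = "\<lambda>s. (a * s powr (a - 1)) *\<^sub>R E s + s powr a *\<^sub>R \<rho> s"
  \<comment> \<open>Constant in q; the second argument makes it a kernel for Fubini on the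
    triangle.\<close>
  let ?L = "\<lambda>r q :: real. a * r powr (a - 1)"
  let ?g = "\<lambda>s. (?L s 0 *\<^sub>R (LBINT q:{0<..<s}. \<rho> q) + (a * s powr (a - 1)) *\<^sub>R E 0) + s powr a *\<^sub>R \<rho> s"
  have \<rho>m: "set_borel_measurable borel {0<..<t} \<rho>" using \<rho>(1) by (simp add: set_borel_measurable_def)
  have \<rho>i: "set_integrable lborel {0<..<t} \<rho>"
  proof -
    have "set_integrable lborel {0<..<t} (\<lambda>q. ((t - q) powr (1 - 1) * q powr (1 - 1)) *\<^sub>R \<rho> q)"
      using \<rho> \<rho>m t by (intro set_integrable_rl_bounded) auto
    then show ?thesis by (rule set_integrable_cong[THEN iffD1, rotated -1]) auto
  qed
  have nn: "(\<integral>\<^sup>+r\<in>{q<..<t}. ennreal (?L r q) \<partial>lborel) = ennreal (t powr a - q powr a)" if "0 < q" "q < t" for q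
    using set_integral_FTC_powr[OF a(1) that] .
  have M: "set_integrable lborel {0<..<t} (\<lambda>s. t powr a *\<^sub>R norm (\<rho> s))"
    using \<rho>i by (intro set_integrable_scaleR_right set_integrable_norm) 
  have Lm: "case_prod ?L \<in> borel_measurable (borel \<Otimes>\<^sub>M borel)" by measurable
  have bnd: "(\<integral>\<^sup>+r\<in>{q<..<t}. ennreal (?L r q) \<partial>lborel) \<le> ennreal (t powr a)" if "0 < q" "q < t" for q
    unfolding nn[OF that] by (intro ennreal_leI) simp
  have inner: "(LBINT r:{q<..<t}. ?L r q) = t powr a - q powr a" if "0 < q" "q < t" for q
    using a that by (intro set_integral_eq_nn_integral[OF nn]) (auto simp: set_borel_measurable_def intro!: powr_mono2)
  have Lp: "0 \<le> ?L r q" for r q using a by simp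
  have "(\<lambda>r. LBINT q:{0<..<r}. ?L r q *\<^sub>R \<rho> q) = (\<lambda>r. ?L r 0 *\<^sub>R (LBINT q:{0<..<r}. \<rho> q))"
    by (simp only: set_integral_scaleR_right)
  then have i1: "set_integrable lborel {0<..<t} (\<lambda>r. ?L r 0 *\<^sub>R (LBINT q:{0<..<r}. \<rho> q))"
    and v1: "(LBINT r:{0<..<t}. ?L r 0 *\<^sub>R (LBINT q:{0<..<r}. \<rho> q)) = (LBINT q:{0<..<t}. (LBINT r:{q<..<t}. ?L r q) *\<^sub>R \<rho> q)"
    using triangle_integrable[OF Lm Lp \<rho>m bnd M] triangle_integral[OF Lm Lp \<rho>m bnd M] by simp_all
  have i2: "set_integrable lborel {0<..<t} (\<lambda>s. s powr a *\<^sub>R \<rho> s)"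
    using a by (intro set_integrable_powr_scaleR \<rho>i) auto
  have b: "set_integrable lborel {0<..<t} (\<lambda>r. (t - r) powr (1 - 1) * r powr (a - 1))"
    and bv: "(LBINT r:{0<..<t}. (t - r) powr (1 - 1) * r powr (a - 1)) = Beta 1 a * t powr (1 + a - 1)"
    using a t by (intro set_integral_Beta; simp)+
  have B1: "Beta 1 a = 1 / a"
  proof -
    have "a \<notin> \<int>\<^sub>\<le>\<^sub>0" using a by (auto elim!: nonpos_Ints_cases)
    then show ?thesis using Gamma_plus1[of a] by (simp add: Beta_def add.commute Gamma_eq_zero_iff)
  qed
  have i3: "set_integrable lborel {0<..<t} (\<lambda>s. (a * s powr (a - 1)) *\<^sub>R E 0)"
    and v3: "(LBINT s:{0<..<t}. (a * s powr (a - 1)) *\<^sub>R E 0) = t powr a *\<^sub>R E 0"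
  proof -
    have c: "set_integrable lborel {0<..<t} (\<lambda>s. s powr (a - 1))" "(LBINT s:{0<..<t}. s powr (a - 1)) = t powr a / a"
    proof -
      show "set_integrable lborel {0<..<t} (\<lambda>s. s powr (a - 1))"
        using b by (rule set_integrable_cong[THEN iffD1, rotated -1]) auto
      have "(LBINT s:{0<..<t}. s powr (a - 1)) = (LBINT r:{0<..<t}. (t - r) powr (1 - 1) * r powr (a - 1))"
        by (intro set_lebesgue_integral_cong) auto
      then show "(LBINT s:{0<..<t}. s powr (a - 1)) = t powr a / a" using bv B1 by simp
    qed
    then have d: "set_integrable lborel {0<..<t} (\<lambda>s. a * s powr (a - 1))" "(LBINT s:{0<..<t}. a * s powr (a - 1)) = t powr a"
      using a by simp_all
    show "set_integrable lborel {0<..<t} (\<lambda>s. (a * s powr (a - 1)) *\<^sub>R E 0)"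
      using d(1) by (rule set_integrable_scaleR_left[rotated])
    show "(LBINT s:{0<..<t}. (a * s powr (a - 1)) *\<^sub>R E 0) = t powr a *\<^sub>R E 0"
    proof -
      have "(LBINT s:{0<..<t}. (a * s powr (a - 1)) *\<^sub>R E 0) = (LBINT s:{0<..<t}. a * s powr (a - 1)) *\<^sub>R E 0"
      proof -
        have "(LBINT s. (indicator {0<..<t} s *\<^sub>R (a * s powr (a - 1))) *\<^sub>R E 0)
           = (LBINT s. indicator {0<..<t} s *\<^sub>R (a * s powr (a - 1))) *\<^sub>R E 0"
          using d(1) by (intro integral_scaleR_left) (simp add: set_integrable_def)
        then show ?thesis unfolding set_lebesgue_integral_def by (simp only: scaleR_scaleR real_scaleR_def)
      qed
      then show ?thesis unfolding d(2) .
    qed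
  qed
  have i4: "set_integrable lborel {0<..<t} (\<lambda>s. ?g s)"
    by (intro set_integral_add i1 i2 i3)
  have eq: "?f s = ?g s"
    if "s \<in> {0<..<t}" for s
    using that E[of s] by (simp add: scaleR_diff_right)
  show "set_integrable lborel {0<..<t} (\<lambda>s. ?f s)"
    using i4 by (rule set_integrable_cong[THEN iffD1, rotated -1]) (auto simp: eq)
  have "(LBINT s:{0<..<t}. ?f s)
      = (LBINT s:{0<..<t}. ?g s)"
    by (intro set_lebesgue_integral_cong) (auto simp: eq)
  also have "\<dots> = (LBINT q:{0<..<t}. (LBINT r:{q<..<t}. ?L r q) *\<^sub>R \<rho> q) + t powr a *\<^sub>R E 0 + (LBINT s:{0<..<t}. s powr a *\<^sub>R \<rho> s)"
    by (simp only: set_integral_add i1 i2 i3 v1 v3)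
  also have "(LBINT q:{0<..<t}. (LBINT r:{q<..<t}. ?L r q) *\<^sub>R \<rho> q) = (LBINT q:{0<..<t}. t powr a *\<^sub>R \<rho> q - q powr a *\<^sub>R \<rho> q)"
  proof (intro set_lebesgue_integral_cong allI impI)
    fix q assume "q \<in> {0<..<t}"
    then have q: "0 < q" "q < t" by auto
    show "(LBINT r:{q<..<t}. ?L r q) *\<^sub>R \<rho> q = t powr a *\<^sub>R \<rho> q - q powr a *\<^sub>R \<rho> q"
      unfolding inner[OF q] scaleR_diff_left ..
  qed simp
  also have "\<dots> = t powr a *\<^sub>R (E t - E 0) - (LBINT s:{0<..<t}. s powr a *\<^sub>R \<rho> s)"
    using \<rho>i i2 E[of t] t by (subst set_integral_diff(2)) auto
  finally show "(LBINT s:{0<..<t}. ?f s) = t powr a *\<^sub>R E t"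
    by (simp add: algebra_simps)
qed

lemma rl_integral_diff:
  assumes "set_integrable lborel {0<..<t} (\<lambda>s. (t - s) powr (a - 1) *\<^sub>R f s)"
    "set_integrable lborel {0<..<t} (\<lambda>s. (t - s) powr (a - 1) *\<^sub>R g s)"
  shows "rl_integral a (\<lambda>s. f s - g s) t = rl_integral a f t - rl_integral a g t"
  unfolding rl_integral_def scaleR_diff_right by (rule set_integral_diff(2)[OF assms])

text \<open>With r = tx the dependence on t is confined to a power and to the dilation w(tx); when
  the weight is integrable, the remaining integral inherits Lipschitz continuity from w.\<close>

lemma rl_integral_powr_scaling:
  fixes w :: "real \<Rightarrow> 'a::euclidean_space"
  assumes t: "0 < t"
  shows "rl_integral a (\<lambda>r. r powr b *\<^sub>R w r) t = t powr (a + b) *\<^sub>R (LBINT x:{0<..<1}. ((1 - x) powr (a - 1) * x powr b) *\<^sub>R w (t * x))"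
proof -
  let ?g = "\<lambda>x. indicator {0<..<1} x *\<^sub>R (((1 - x) powr (a - 1) * x powr b) *\<^sub>R w (t * x))"
  define F where "F = (\<lambda>r. indicator {0<..<t} r *\<^sub>R ((t - r) powr (a - 1) *\<^sub>R (r powr b *\<^sub>R w r)))"
  have "rl_integral a (\<lambda>r. r powr b *\<^sub>R w r) t = (LBINT r. F r)"
    by (simp only: rl_integral_def set_lebesgue_integral_def F_def)
  also have "\<dots> = t *\<^sub>R (LBINT x. F (t * x))"
    using t by (subst lborel_integral_real_affine[where c = t and t = 0]) auto
  also have "(\<lambda>x. F (t * x)) = (\<lambda>x. t powr (a - 1 + b) *\<^sub>R (?g x))"
  proof
    fix x
    have i: "t * x \<in> {0<..<t} \<longleftrightarrow> x \<in> {0<..<1}" using t by (auto simp: zero_less_mult_iff)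
    show "F (t * x) = t powr (a - 1 + b) *\<^sub>R (?g x)"
    proof (cases "x \<in> {0<..<1}")
      case True
      have "t - t * x = t * (1 - x)" by (simp add: algebra_simps)
      then show ?thesis using True i t by (simp add: F_def powr_mult powr_add mult_ac)
    next
      case False
      then show ?thesis using i by (simp add: F_def)
    qed
  qed
  also have "t *\<^sub>R (LBINT x. t powr (a - 1 + b) *\<^sub>R (?g x))
     = (t powr 1 * t powr (a - 1 + b)) *\<^sub>R (LBINT x:{0<..<1}. ((1 - x) powr (a - 1) * x powr b) *\<^sub>R w (t * x))"
  proof -
    have "t powr 1 = t" using t by simp
    then show ?thesis by (simp only: integral_scaleR_right set_lebesgue_integral_def scaleR_scaleR[of t "t powr (a - 1 + b)"])
  qed
  also have "t powr 1 * t powr (a - 1 + b) = t powr (a + b)" by (subst powr_add[symmetric]) simp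
  finally show ?thesis .
qed

text \<open>
  Here the equation to solve is \<open>I\<^sup>\<alpha> v = r\<^sup>-\<^sup>\<alpha> w\<close> up to a constant. Applying the
  complementary integral turns it into \<open>\<integral> v = s\<^sup>1\<^sup>-\<^sup>2\<^sup>\<alpha> E s\<close>, where \<open>E\<close> is an average of dilations
  of \<open>w\<close> and hence Lipschitz, so that the right-hand side has a density.
\<close>

lemma K_op_surjective_smooth:
  fixes w :: "real \<Rightarrow> real^'n"
  assumes H: "1/2 < H" "H < 1" and w: "L-lipschitz_on {0..1} w"
  obtains u c where "u \<in> L2_unit" "c \<noteq> 0" "\<And>t. t \<in> {0<..1} \<Longrightarrow> K_op H u t = c *\<^sub>R (LBINT s:{0<..<t}. w s)"
proof -
  define \<alpha> where "\<alpha> = fbm_alpha H"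
  have H': "0 < H" "H \<noteq> 1/2" using H by auto
  have \<alpha>: "0 < \<alpha>" "\<alpha> < 1/2" "fbm_gamma H = 1" 
    using H by (auto simp: \<alpha>_def fbm_alpha_def fbm_gamma_def)
  let ?k = "\<lambda>x. (1 - x) powr ((1 - \<alpha>) - 1) * x powr ((1 - \<alpha>) - 1)"
  have L0: "L \<ge> 0" using w by (simp add: lipschitz_on_def)
  \<comment> \<open>Clamping the argument to [0, 1] extends w to the line with the same Lipschitz
    constant, so that E is defined and Lipschitz on the whole line, as the density lemma
    requires.\<close>
  define w1 where "w1 = (\<lambda>x. w (max 0 (min 1 x)))"
  have w1: "w1 x = w x" if "x \<in> {0..1}" for x
  proof -
    have "max 0 (min 1 x) = x" using that by auto
    then show ?thesis by (simp add: w1_def)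
  qed
  have w1lip: "norm (w1 x - w1 y) \<le> L * \<bar>x - y\<bar>" for x y
  proof -
    have "norm (w1 x - w1 y) \<le> L * \<bar>max 0 (min 1 x) - max 0 (min 1 y)\<bar>"
      using lipschitz_onD[OF w, of "max 0 (min 1 x)" "max 0 (min 1 y)"] by (simp add: w1_def dist_norm)
    also have "\<dots> \<le> L * \<bar>x - y\<bar>" using L0 by (intro mult_left_mono) (auto simp: min_def max_def)
    finally show ?thesis .
  qed
  obtain W where W: "\<And>x. x \<in> {0..1} \<Longrightarrow> norm (w x) \<le> W"
    using continuous_on_unit_bounded[OF lipschitz_on_continuous_on[OF w]] by blast
  have W1: "norm (w1 x) \<le> W" for x unfolding w1_def by (rule W) auto
  have "continuous_on UNIV w1"
    by (rule lipschitz_on_continuous_on[of L]) (auto intro!: lipschitz_onI simp: dist_norm w1lip L0)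
  then have [measurable]: "w1 \<in> borel_measurable borel" by (rule borel_measurable_continuous_onI)
  define E where "E = (\<lambda>s. LBINT x:{0<..<1}. ?k x *\<^sub>R w1 (s * x))"
  have wint: "set_integrable lborel {0<..<1} (\<lambda>x. ?k x *\<^sub>R w1 (s * x))" for s
    using \<alpha> W1 by (intro set_integrable_rl_bounded) (auto simp: set_borel_measurable_def)
  have Beta_pos: "Beta (1 - \<alpha>) (1 - \<alpha>) > 0" using \<alpha> by (intro Beta_real_pos) auto
  have kint: "set_integrable lborel {0<..<1} (\<lambda>x. ?k x)"
    and kval: "(LBINT x:{0<..<1}. ?k x) = Beta (1 - \<alpha>) (1 - \<alpha>)"
    using set_integral_Beta[of "1 - \<alpha>" "1 - \<alpha>" 1] \<alpha> by simp_all
  have Elip: "(L * Beta (1 - \<alpha>) (1 - \<alpha>))-lipschitz_on UNIV E"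
  proof (rule lipschitz_onI)
    fix s r :: real
    have eq: "E s - E r = (LBINT x:{0<..<1}. ?k x *\<^sub>R (w1 (s * x) - w1 (r * x)))"
      unfolding E_def scaleR_diff_right by (rule set_integral_diff(2)[OF wint wint, symmetric])
    have "norm (E s - E r) \<le> (LBINT x:{0<..<1}. (L * \<bar>s - r\<bar>) * ?k x)"
      unfolding eq set_lebesgue_integral_def
    proof (rule Bochner_Integration.integral_norm_bound_integral)
      show "integrable lborel (\<lambda>x. indicator {0<..<1} x *\<^sub>R (?k x *\<^sub>R (w1 (s * x) - w1 (r * x))))"
        using set_integral_diff(1)[OF wint[of s] wint[of r]] by (simp add: set_integrable_def scaleR_diff_right)
      show "integrable lborel (\<lambda>x. indicator {0<..<1} x *\<^sub>R ((L * \<bar>s - r\<bar>) * ?k x))"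
        using set_integrable_mult_right[OF kint, of "L * \<bar>s - r\<bar>"] by (simp add: set_integrable_def)
      fix x :: real
      have "norm (w1 (s * x) - w1 (r * x)) \<le> L * \<bar>s - r\<bar>" if "0 < x" "x < 1"
      proof -
        have "norm (w1 (s * x) - w1 (r * x)) \<le> L * (\<bar>s - r\<bar> * \<bar>x\<bar>)"
          using w1lip[of "s * x" "r * x"] by (simp add: abs_mult left_diff_distrib[symmetric])
        also have "\<dots> \<le> L * (\<bar>s - r\<bar> * 1)" using that L0 by (intro mult_left_mono) auto
        finally show ?thesis by simp
      qed
      then show "norm (indicator {0<..<1} x *\<^sub>R (?k x *\<^sub>R (w1 (s * x) - w1 (r * x))))
        \<le> indicator {0<..<1} x *\<^sub>R ((L * \<bar>s - r\<bar>) * ?k x)"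
        by (auto simp: indicator_def mult.commute intro!: mult_right_mono)
    qed
    also have "\<dots> = L * Beta (1 - \<alpha>) (1 - \<alpha>) * dist s r" using kval by (simp add: dist_real_def)
    finally show "dist (E s) (E r) \<le> L * Beta (1 - \<alpha>) (1 - \<alpha>) * dist s r" by (simp add: dist_norm)
  qed (use L0 Beta_pos in auto)
  obtain \<rho> B where \<rho>: "\<rho> \<in> borel_measurable borel" "\<And>x. norm (\<rho> x) \<le> B"
    "\<And>a b. a \<le> b \<Longrightarrow> (LBINT x:{a<..<b}. \<rho> x) = E b - E a"
    using Lipschitz_density[OF Elip] by metis
  have [measurable]: "\<rho> \<in> borel_measurable borel" by (rule \<rho>)
  have [measurable]: "E \<in> borel_measurable borel"
    by (intro borel_measurable_continuous_onI lipschitz_on_continuous_on[OF Elip])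
  \<comment> \<open>The density of s^(1 - 2\<alpha>) E(s) given by the product rule.\<close>
  define v where "v = (\<lambda>s. ((1 - 2 * \<alpha>) * s powr ((1 - 2 * \<alpha>) - 1)) *\<^sub>R E s + s powr (1 - 2 * \<alpha>) *\<^sub>R \<rho> s)"
  have v: "set_integrable lborel {0<..<t} v" "(LBINT s:{0<..<t}. v s) = t powr (1 - 2 * \<alpha>) *\<^sub>R E t" if "0 < t" for t
    unfolding v_def using \<alpha> that \<rho> by (intro set_integral_AC_product[where B = B]; simp)+
  define u0 where "u0 = (\<lambda>s. s powr \<alpha> *\<^sub>R v s)"
  define u where "u = (\<lambda>s. indicator {0<..<1} s *\<^sub>R u0 s)"
  define EB where "EB = norm (E 0) + L * Beta (1 - \<alpha>) (1 - \<alpha>)"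
  have EB: "norm (E s) \<le> EB" if "0 < s" "s < 1" for s
  proof -
    have "norm (E s - E 0) \<le> L * Beta (1 - \<alpha>) (1 - \<alpha>) * \<bar>s\<bar>"
      using lipschitz_onD[OF Elip, of s 0] by (simp add: dist_norm)
    also have "\<dots> \<le> L * Beta (1 - \<alpha>) (1 - \<alpha>) * 1" using that L0 Beta_pos by (intro mult_left_mono) auto
    finally show ?thesis unfolding EB_def using norm_triangle_ineq2[of "E s" "E 0"] by linarith
  qed
  have u: "u \<in> L2_unit" unfolding u_def
  proof (rule L2_unit_dominated)
    show "set_borel_measurable borel {0<..<1} u0"
      unfolding set_borel_measurable_def u0_def v_def by measurable
    fix s :: real assume s: "0 < s" "s < 1"
    \<comment> \<open>The power s^(-\<alpha>) bounds the singularity of u0 at 0; it is square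
      integrable because \<alpha> < 1/2.\<close>
    have p1: "s powr \<alpha> * s powr ((1 - 2 * \<alpha>) - 1) = s powr - \<alpha>" by (simp flip: powr_add)
    have p2: "s powr \<alpha> * s powr (1 - 2 * \<alpha>) \<le> s powr - \<alpha>"
    proof -
      have "s powr \<alpha> * s powr (1 - 2 * \<alpha>) = s powr (1 - \<alpha>)" by (simp flip: powr_add)
      also have "\<dots> \<le> s powr - \<alpha>" using s by (intro powr_mono') auto
      finally show ?thesis .
    qed
    have "norm (u0 s) \<le> s powr \<alpha> * (((1 - 2 * \<alpha>) * s powr ((1 - 2 * \<alpha>) - 1)) * EB + s powr (1 - 2 * \<alpha>) * B)"
      unfolding u0_def v_def norm_scaleR abs_of_nonneg[OF powr_ge_zero]
    proof (intro mult_left_mono order.trans[OF norm_triangle_ineq] add_mono)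
      show "norm (((1 - 2 * \<alpha>) * s powr ((1 - 2 * \<alpha>) - 1)) *\<^sub>R E s) \<le> ((1 - 2 * \<alpha>) * s powr ((1 - 2 * \<alpha>) - 1)) * EB"
        using \<alpha> EB[OF s] by (simp add: abs_mult mult_left_mono)
      show "norm (s powr (1 - 2 * \<alpha>) *\<^sub>R \<rho> s) \<le> s powr (1 - 2 * \<alpha>) * B"
        using \<rho>(2)[of s] by (simp add: mult_left_mono)
    qed simp
    also have "\<dots> = (1 - 2 * \<alpha>) * EB * (s powr \<alpha> * s powr ((1 - 2 * \<alpha>) - 1)) + (s powr \<alpha> * s powr (1 - 2 * \<alpha>)) * B"
      by (simp add: algebra_simps)
    also have "\<dots> \<le> (1 - 2 * \<alpha>) * EB * s powr - \<alpha> + s powr - \<alpha> * B"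
      unfolding p1 using p2 order.trans[OF norm_ge_zero \<rho>(2)] by (intro add_left_mono mult_right_mono) auto
    also have "\<dots> = ((1 - 2 * \<alpha>) * EB + B) * s powr - \<alpha>" by (simp add: algebra_simps)
    finally show "norm (u0 s) \<le> ((1 - 2 * \<alpha>) * EB + B) * s powr - \<alpha>" .
  qed (use \<alpha> in auto)
  define \<beta> where "\<beta> = Beta (1 - \<alpha>) \<alpha>"
  have \<beta>: "\<beta> > 0" unfolding \<beta>_def using \<alpha> by (intro Beta_real_pos) auto
  \<comment> \<open>The defect in the equation for v. The construction of v shows only that its
    integral of order 1 - \<alpha> vanishes; injectivity of that integral makes the defect vanish
    almost everywhere.\<close>
  define d where "d = (\<lambda>r. rl_integral \<alpha> v r - \<beta> *\<^sub>R (r powr - \<alpha> *\<^sub>R w1 r))"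
  have w1i: "set_integrable lborel {0<..<t} (\<lambda>s. (t - s) powr ((1 - \<alpha>) - 1) *\<^sub>R (s powr - \<alpha> *\<^sub>R w1 s))" if "0 < t" for t
  proof -
    have "set_integrable lborel {0<..<t} (\<lambda>s. ((t - s) powr ((1 - \<alpha>) - 1) * s powr ((1 - \<alpha>) - 1)) *\<^sub>R w1 s)"
      using \<alpha> W1 that by (intro set_integrable_rl_bounded) (auto simp: set_borel_measurable_def)
    then show ?thesis by simp
  qed
  have w2i: "set_integrable lborel {0<..<1} (\<lambda>s. s powr - \<alpha> *\<^sub>R w1 s)"
  proof -
    have "set_integrable lborel {0<..<1} (\<lambda>s. ((1 - s) powr (1 - 1) * s powr ((1 - \<alpha>) - 1)) *\<^sub>R w1 s)"
      using \<alpha> W1 by (intro set_integrable_rl_bounded) (auto simp: set_borel_measurable_def)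
    then show ?thesis by (rule set_integrable_cong[THEN iffD1, rotated -1]) auto
  qed
  have di: "set_integrable lborel {0<..<1} d"
    unfolding d_def using \<alpha>
    by (intro set_integral_diff(1) set_integrable_rl_integral v set_integrable_scaleR_right w2i) auto
  have rld: "rl_integral (1 - \<alpha>) d t = 0" if t: "t \<in> {0<..<1}" for t
  proof -
    have vt: "set_integrable lborel {0<..<t} v" using v t by auto
    have i1: "set_integrable lborel {0<..<t} (\<lambda>s. (t - s) powr ((1 - \<alpha>) - 1) *\<^sub>R rl_integral \<alpha> v s)"
      using \<alpha> set_integrable_powr_mult[OF set_integrable_norm[OF vt], of 0]
      by (intro rl_integral_semigroup(1)) (auto intro: set_integrable_imp_borel_measurable[OF vt])
    have "set_integrable lborel {0<..<t} (\<lambda>s. \<beta> *\<^sub>R ((t - s) powr ((1 - \<alpha>) - 1) *\<^sub>R (s powr - \<alpha> *\<^sub>R w1 s)))"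
      using w1i t by (intro set_integrable_scaleR_right) auto
    then have i2: "set_integrable lborel {0<..<t} (\<lambda>s. (t - s) powr ((1 - \<alpha>) - 1) *\<^sub>R (\<beta> *\<^sub>R (s powr - \<alpha> *\<^sub>R w1 s)))"
      by (simp add: mult_ac)
    have "rl_integral (1 - \<alpha>) d t = rl_integral (1 - \<alpha>) (rl_integral \<alpha> v) t - \<beta> *\<^sub>R rl_integral (1 - \<alpha>) (\<lambda>s. s powr - \<alpha> *\<^sub>R w1 s) t"
      unfolding d_def by (subst rl_integral_diff[OF i1 i2]) (simp only: rl_integral_scaleR)
    also have "rl_integral (1 - \<alpha>) (rl_integral \<alpha> v) t = \<beta> *\<^sub>R (t powr (1 - 2 * \<alpha>) *\<^sub>R E t)"
      using rl_integral_complement[OF \<alpha>(1) _ vt] \<alpha> v t by (simp add: \<beta>_def)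
    also have "rl_integral (1 - \<alpha>) (\<lambda>s. s powr - \<alpha> *\<^sub>R w1 s) t = t powr (1 - 2 * \<alpha>) *\<^sub>R E t"
      using t by (subst rl_integral_powr_scaling) (auto simp: E_def)
    finally show ?thesis by simp
  qed
  have d0: "AE r in lborel. r \<in> {0<..<1} \<longrightarrow> d r = 0"
    using \<alpha> rld by (intro rl_integral_zero_imp_AE_zero[OF _ _ di, of "1 - \<alpha>"] AE_I2) auto
  define c where "c = fbm_c H / Beta \<alpha> 1 * \<beta>"
  show ?thesis
  proof (rule that[OF u])
    show "c \<noteq> 0"
      using fbm_c_pos[OF H'(1) H(2)] Beta_real_pos[of \<alpha> 1] \<beta> \<alpha> by (auto simp: c_def)
    fix t :: real assume "t \<in> {0<..1}"
    then have t: "0 < t" "t \<le> 1" by auto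
    have vt: "set_integrable lborel {0<..<t} v" using v t by auto
    have eqv: "rl_integral \<alpha> (\<lambda>s. s powr - \<alpha> *\<^sub>R u s) r = rl_integral \<alpha> v r" if "r \<le> 1" for r
      using that by (intro rl_integral_cong) (auto simp: u_def u0_def simp flip: powr_add)
    have "(LBINT r:{0<..<t}. r powr \<alpha> *\<^sub>R rl_integral \<alpha> (\<lambda>s. s powr - \<alpha> *\<^sub>R u s) r)
        = (LBINT r:{0<..<t}. r powr \<alpha> *\<^sub>R rl_integral \<alpha> v r)"
      using t by (intro set_lebesgue_integral_cong) (auto simp: eqv)
    \<comment> \<open>Equality almost everywhere is enough here, since the outer integral has order
      \<gamma> = 1.\<close>
    also have "\<dots> = (LBINT r:{0<..<t}. \<beta> *\<^sub>R w1 r)"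
      unfolding set_lebesgue_integral_def
    proof (rule integral_cong_AE)
      show "(\<lambda>r. indicator {0<..<t} r *\<^sub>R (r powr \<alpha> *\<^sub>R rl_integral \<alpha> v r)) \<in> borel_measurable lborel"
        using set_integrable_powr_scaleR[OF set_integrable_rl_integral[OF \<alpha>(1) vt], of \<alpha>] \<alpha>
        by (auto simp: set_integrable_def)
      show "AE r in lborel. indicator {0<..<t} r *\<^sub>R (r powr \<alpha> *\<^sub>R rl_integral \<alpha> v r) = indicator {0<..<t} r *\<^sub>R (\<beta> *\<^sub>R w1 r)"
        using d0
      proof eventually_elim
        case (elim r)
        have "r powr \<alpha> *\<^sub>R rl_integral \<alpha> v r = \<beta> *\<^sub>R w1 r" if "0 < r" "r < t"
        proof -
          have "rl_integral \<alpha> v r = \<beta> *\<^sub>R (r powr - \<alpha> *\<^sub>R w1 r)" using elim that t by (simp add: d_def)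
          then have "r powr \<alpha> *\<^sub>R rl_integral \<alpha> v r = \<beta> *\<^sub>R ((r powr \<alpha> * r powr - \<alpha>) *\<^sub>R w1 r)"
            by (simp add: mult_ac)
          also have "r powr \<alpha> * r powr - \<alpha> = 1" using that by (simp flip: powr_add)
          finally show ?thesis by simp
        qed
        then show ?case by (simp add: indicator_def)
      qed
    qed simp
    also have "\<dots> = \<beta> *\<^sub>R (LBINT s:{0<..<t}. w s)"
      unfolding set_integral_scaleR_right using t w1
      by (intro arg_cong[where f = "scaleR \<beta>"] set_lebesgue_integral_cong) auto
    finally show "K_op H u t = c *\<^sub>R (LBINT s:{0<..<t}. w s)"
      unfolding K_op_eq_rl_integral[OF H'(1) H(2) H'(2) u t] \<alpha>_def[symmetric] \<alpha>(3)
      by (simp add: c_def rl_integral_1)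
  qed
qed

lemma K_op_surjective:
  fixes w :: "real \<Rightarrow> real^'n"
  assumes H: "0 < H" "H < 1" and w: "continuous_on {0..1} w"
    and lip: "1/2 < H \<Longrightarrow> \<exists>L. L-lipschitz_on {0..1} w"
  obtains u where "u \<in> L2_unit" "\<And>t. t \<in> {0<..1} \<Longrightarrow> K_op H u t = (LBINT s:{0<..<t}. w s)"
proof -
  obtain u c where u: "u \<in> L2_unit" "c \<noteq> 0" "\<And>t. t \<in> {0<..1} \<Longrightarrow> K_op H u t = c *\<^sub>R (LBINT s:{0<..<t}. w s)"
  proof (cases H "1/2 :: real" rule: linorder_cases)
    case less
    then show ?thesis using that K_op_surjective_rough[OF H(1) _ w] by blast
  next
    case equal
    then show ?thesis using that K_op_surjective_half[OF w] by blast
  next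
    case greater
    then show ?thesis using that K_op_surjective_smooth[OF _ H(2)] lip by metis
  qed
  show ?thesis
    using u by (intro that[of "\<lambda>s. (1 / c) *\<^sub>R u s"] L2_unit_scaleR) (auto simp: K_op_scaleR)
qed

section \<open>Riemann--Stieltjes integrals\<close>

no_notation fps_nth (infixl "$" 75)

lemma bounded_bilinear_matrix_vector_mult:
  "bounded_bilinear (\<lambda>(A :: real^'n^'m) (x :: real^'n). A *v x)"
  unfolding bilinear_conv_bounded_bilinear[symmetric] bilinear_def
  by (auto intro!: linearI simp: matrix_vector_mult_add_rdistrib matrix_vector_right_distrib
      scaleR_matrix_vector_assoc matrix_vector_mult_scaleR)

lemmas has_vector_derivative_matrix_vector [derivative_intros] =
  bounded_bilinear.has_vector_derivative[OF bounded_bilinear_matrix_vector_mult]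
lemmas continuous_on_matrix_vector [continuous_intros] =
  bounded_bilinear.continuous_on[OF bounded_bilinear_matrix_vector_mult]

text \<open>Makes the \<open>THE\<close> in the definition determinate. Cousin's lemma, with balls
  of radius d / 2 as gauge, provides a tagged division of mesh below d on which both limits can be
  compared, so the defining condition is never vacuous.\<close>

lemma has_RS_integral_unique:
  assumes "has_RS_integral f g a b I" "has_RS_integral f g a b J"
  shows "I = J"
proof (rule ccontr)
  assume "I \<noteq> J"
  define e where "e = dist I J / 2"
  have e: "e > 0" using \<open>I \<noteq> J\<close> by (simp add: e_def)
  let ?S = "\<lambda>p. \<Sum>(x, K)\<in>p. f x *v (g (Sup K) - g (Inf K))"
  obtain d1 where d1: "d1 > 0" "\<And>p. p tagged_division_of {a..b} \<Longrightarrow> \<forall>(x, K)\<in>p. Sup K - Inf K < d1 \<Longrightarrow> norm (?S p - I) < e"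
    using assms(1) e unfolding has_RS_integral_def by meson
  obtain d2 where d2: "d2 > 0" "\<And>p. p tagged_division_of {a..b} \<Longrightarrow> \<forall>(x, K)\<in>p. Sup K - Inf K < d2 \<Longrightarrow> norm (?S p - J) < e"
    using assms(2) e unfolding has_RS_integral_def by meson
  define d where "d = min d1 d2"
  have "gauge (\<lambda>x. ball x (d / 2))" using d1 d2 by (auto simp: gauge_def d_def)
  then obtain p where p: "p tagged_division_of {a..b}" "(\<lambda>x. ball x (d / 2)) fine p"
    by (rule fine_division_exists_real)
  have "Sup K - Inf K < d" if xK: "(x, K) \<in> p" for x K
  proof -
    obtain l u where K: "K = {l..u}" using tagged_division_ofD(4)[OF p(1) xK] by auto
    have "l \<le> u" using tagged_division_ofD(2)[OF p(1) xK] K by auto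
    moreover have "K \<subseteq> ball x (d / 2)" using p(2) xK by (auto simp: fine_def)
    then have "l \<in> ball x (d / 2)" "u \<in> ball x (d / 2)" using \<open>l \<le> u\<close> K by auto
    then have "\<bar>x - l\<bar> < d / 2" "\<bar>x - u\<bar> < d / 2" by (auto simp: dist_real_def)
    ultimately show ?thesis using K by (simp add: abs_if split: if_splits)
  qed
  then have "norm (?S p - I) < e" "norm (?S p - J) < e"
    using d1(2)[OF p(1)] d2(2)[OF p(1)] by (force simp: d_def)+
  then have "dist I J < e + e"
    using dist_triangle[of I J "?S p"] by (simp add: dist_norm norm_minus_commute)
  then show False by (simp add: e_def)
qed

lemma RS_integral_eqI: "has_RS_integral f g a b I \<Longrightarrow> RS_integral f g a b = I"
  unfolding RS_integral_def by (blast intro: has_RS_integral_unique)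

lemma has_RS_integral_by_parts:
  fixes \<sigma> \<sigma>' :: "real \<Rightarrow> real^'n^'k" and g :: "real \<Rightarrow> real^'n"
  assumes ab: "a \<le> b"
    and \<sigma>: "\<And>x. x \<in> {a..b} \<Longrightarrow> (\<sigma> has_vector_derivative \<sigma>' x) (at x within {a..b})"
    and \<sigma>': "continuous_on {a..b} \<sigma>'" and g: "continuous_on {a..b} g"
  shows "has_RS_integral \<sigma> g a b (\<sigma> b *v g b - \<sigma> a *v g a - integral {a..b} (\<lambda>s. \<sigma>' s *v g s))"
proof -
  \<comment> \<open>The primitive predicted by integrating by parts, with the derivative moved from
    g to \<sigma>.\<close>
  define \<Phi> where "\<Phi> = (\<lambda>t. \<sigma> t *v g t - integral {a..t} (\<lambda>s. \<sigma>' s *v g s))"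
  obtain N where N: "N > 0" "\<And>A (x :: real^'n). norm ((A :: real^'n^'k) *v x) \<le> norm A * norm x * N"
    using bounded_bilinear.pos_bounded[OF bounded_bilinear_matrix_vector_mult] by blast
  have "bounded (\<sigma>' ` {a..b})"
    using \<sigma>' by (intro compact_imp_bounded compact_continuous_image) auto
  then obtain B0 where B0: "\<And>x. x \<in> {a..b} \<Longrightarrow> norm (\<sigma>' x) \<le> B0"
    unfolding bounded_iff by (metis image_eqI)
  define B where "B = max B0 1"
  have B: "B > 0" "\<And>x. x \<in> {a..b} \<Longrightarrow> norm (\<sigma>' x) \<le> B" using B0 by (force simp: B_def)+
  have unif: "uniformly_continuous_on {a..b} g"
    using g by (intro compact_uniformly_continuous) auto
  have piece: "norm (integral {l..u} (\<lambda>s. \<sigma>' s *v (g s - v))) \<le> B * \<eta> * N * (u - l)"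
    if al: "a \<le> l" and "l \<le> u" and ub: "u \<le> b" and \<eta>: "\<And>s. s \<in> {l..u} \<Longrightarrow> norm (g s - v) \<le> \<eta>" for l u v \<eta>
  proof (rule integral_bound)
    show "continuous_on {l..u} (\<lambda>s. \<sigma>' s *v (g s - v))"
      using that by (intro continuous_intros continuous_on_subset[OF \<sigma>'] continuous_on_subset[OF g]) auto
    show "norm (\<sigma>' s *v (g s - v)) \<le> B * \<eta> * N" if s: "s \<in> {l..u}" for s
    proof -
      have "norm (\<sigma>' s *v (g s - v)) \<le> norm (\<sigma>' s) * norm (g s - v) * N" by (rule N)
      also have "\<dots> \<le> B * \<eta> * N"
        using al ub \<eta>[OF s] s B N(1) by (intro mult_right_mono mult_mono) auto
      finally show ?thesis .
    qed
  qed (use that in auto)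
  have FTC: "integral {l..u} (\<lambda>s. \<sigma>' s *v v) = \<sigma> u *v v - \<sigma> l *v v" if "a \<le> l" "l \<le> u" "u \<le> b" for l u v
  proof (rule integral_unique, rule fundamental_theorem_of_calculus)
    fix x assume x: "x \<in> {l..u}"
    have "((\<lambda>s. \<sigma> s *v v) has_vector_derivative (\<sigma> x *v 0 + \<sigma>' x *v v)) (at x within {l..u})"
      using that x by (intro has_vector_derivative_matrix_vector has_vector_derivative_const has_vector_derivative_within_subset[OF \<sigma>]) auto
    then show "((\<lambda>s. \<sigma> s *v v) has_vector_derivative \<sigma>' x *v v) (at x within {l..u})" by simp
  qed (use that in auto)
  have int: "(\<lambda>s. \<sigma>' s *v (g s - v)) integrable_on {l..u}" "(\<lambda>s. \<sigma>' s *v g s) integrable_on {l..u}" "(\<lambda>s. \<sigma>' s *v v) integrable_on {l..u}"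
    if "a \<le> l" "u \<le> b" for l u v
    using that by (auto intro!: integrable_continuous_real continuous_intros intro: continuous_on_subset[OF \<sigma>'] continuous_on_subset[OF g])
  \<comment> \<open>\<open>\<Phi>\<close> is additive, so it suffices to compare one tagged interval at a time; the difference
    only involves the oscillation of \<open>g\<close>, whence no bounded variation of \<open>g\<close> is needed\<close>
  have split: "\<sigma> x *v (g u - g l) - (\<Phi> u - \<Phi> l)
      = integral {x..u} (\<lambda>s. \<sigma>' s *v (g s - g u)) + integral {l..x} (\<lambda>s. \<sigma>' s *v (g s - g l))"
    if "a \<le> l" "l \<le> x" "x \<le> u" "u \<le> b" for x l u
  proof -
    have 1: "integral {x..u} (\<lambda>s. \<sigma>' s *v (g s - g u)) = integral {x..u} (\<lambda>s. \<sigma>' s *v g s) - (\<sigma> u *v g u - \<sigma> x *v g u)"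
      using that int[of x u] by (simp add: matrix_vector_mult_diff_distrib integral_diff FTC)
    have 2: "integral {l..x} (\<lambda>s. \<sigma>' s *v (g s - g l)) = integral {l..x} (\<lambda>s. \<sigma>' s *v g s) - (\<sigma> x *v g l - \<sigma> l *v g l)"
      using that int[of l x] by (simp add: matrix_vector_mult_diff_distrib integral_diff FTC)
    have 3: "integral {a..l} (\<lambda>s. \<sigma>' s *v g s) + integral {l..x} (\<lambda>s. \<sigma>' s *v g s) = integral {a..x} (\<lambda>s. \<sigma>' s *v g s)"
      using that int[of a x] by (intro Henstock_Kurzweil_Integration.integral_combine) auto
    have 4: "integral {a..x} (\<lambda>s. \<sigma>' s *v g s) + integral {x..u} (\<lambda>s. \<sigma>' s *v g s) = integral {a..u} (\<lambda>s. \<sigma>' s *v g s)"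
      using that int[of a u] by (intro Henstock_Kurzweil_Integration.integral_combine) auto
    show ?thesis unfolding 1 2 \<Phi>_def 4[symmetric] 3[symmetric]
      by (simp add: matrix_vector_mult_diff_distrib algebra_simps)
  qed
  have \<Phi>: "\<sigma> b *v g b - \<sigma> a *v g a - integral {a..b} (\<lambda>s. \<sigma>' s *v g s) = \<Phi> b - \<Phi> a"
    by (simp add: \<Phi>_def)
  show ?thesis unfolding has_RS_integral_def \<Phi>
  proof (intro allI impI)
    fix e :: real assume e: "e > 0"
    \<comment> \<open>b - a + 1 keeps the denominator positive when a = b and makes the final
      estimate strict.\<close>
    define \<eta> where "\<eta> = e / (B * N * (b - a + 1))"
    have \<eta>: "\<eta> > 0" using e B N ab by (auto simp: \<eta>_def)
    obtain \<delta> where \<delta>: "\<delta> > 0" "\<And>x y. x \<in> {a..b} \<Longrightarrow> y \<in> {a..b} \<Longrightarrow> dist x y < \<delta> \<Longrightarrow> dist (g x) (g y) < \<eta>"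
      using unif \<eta> unfolding uniformly_continuous_on_def by metis
    have "norm ((\<Sum>(x, K)\<in>p. \<sigma> x *v (g (Sup K) - g (Inf K))) - (\<Phi> b - \<Phi> a)) < e"
      if p: "p tagged_division_of {a..b}" and fine: "\<forall>(x, K)\<in>p. Sup K - Inf K < \<delta>" for p
    proof -
      have "(\<Sum>(x, K)\<in>p. \<sigma> x *v (g (Sup K) - g (Inf K))) - (\<Phi> b - \<Phi> a)
          = (\<Sum>(x, K)\<in>p. \<sigma> x *v (g (Sup K) - g (Inf K)) - (\<Phi> (Sup K) - \<Phi> (Inf K)))"
        unfolding additive_tagged_division_1[OF ab p, symmetric] by (simp add: sum_subtractf case_prod_unfold)
      also have "norm \<dots> \<le> (\<Sum>(x, K)\<in>p. B * \<eta> * N * measure lborel K)"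
        unfolding case_prod_unfold
      proof (intro sum_norm_le)
        fix q assume q: "q \<in> p"
        obtain x K where xK: "q = (x, K)" by force
        note in_p = q[unfolded xK]
        obtain l u where K: "K = {l..u}" using tagged_division_ofD(4)[OF p in_p] by auto
        have x: "l \<le> x" "x \<le> u" using tagged_division_ofD(2)[OF p in_p] K by auto
        have lu: "a \<le> l" "u \<le> b" using tagged_division_ofD(3)[OF p in_p] K x by auto
        have "u - l < \<delta>" using fine in_p K x by auto
        then have d: "norm (g s - g s') \<le> \<eta>" if "s \<in> {l..u}" "s' \<in> {l..u}" for s s'
        proof -
          have "dist s s' < \<delta>" using \<open>u - l < \<delta>\<close> that by (auto simp: dist_real_def abs_if)
          then have "dist (g s) (g s') < \<eta>" using \<delta>(2)[of s s'] that lu by auto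
          then show ?thesis by (simp add: dist_norm)
        qed
        have "norm (\<sigma> x *v (g u - g l) - (\<Phi> u - \<Phi> l)) \<le> B * \<eta> * N * (u - x) + B * \<eta> * N * (x - l)"
          unfolding split[OF lu(1) x lu(2)] using x lu
          by (intro order.trans[OF norm_triangle_ineq] add_mono piece d) auto
        then show "norm (\<sigma> (fst q) *v (g (Sup (snd q)) - g (Inf (snd q))) - (\<Phi> (Sup (snd q)) - \<Phi> (Inf (snd q)))) \<le> B * \<eta> * N * measure lborel (snd q)"
          using x by (simp add: xK K algebra_simps)
      qed
      also have "\<dots> = B * \<eta> * N * (b - a)"
        using additive_content_tagged_division[of p a b] p ab
        by (simp add: sum_distrib_left[symmetric] case_prod_unfold)
      also have "\<dots> < e"
      proof -
        have *: "B * \<eta> * N = e / (b - a + 1)" using B N by (simp add: \<eta>_def)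
        show ?thesis unfolding * using ab e by (simp add: field_simps)
      qed
      finally show ?thesis .
    qed
    then show "\<exists>\<delta>>0. \<forall>p. p tagged_division_of {a..b} \<and> (\<forall>(x, K)\<in>p. Sup K - Inf K < \<delta>) \<longrightarrow>
        norm ((\<Sum>(x, K)\<in>p. \<sigma> x *v (g (Sup K) - g (Inf K))) - (\<Phi> b - \<Phi> a)) < e"
      using \<delta>(1) by blast
  qed
qed

lemma RS_integral_by_parts_unit:
  fixes \<sigma> \<sigma>' :: "real \<Rightarrow> real^'n^'k" and g :: "real \<Rightarrow> real^'n"
  assumes "\<And>x. x \<in> {0..1} \<Longrightarrow> (\<sigma> has_vector_derivative \<sigma>' x) (at x within {0..1})"
    and "continuous_on {0..1} \<sigma>'" "continuous_on {0..1} g" and t: "t \<in> {0..1}"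
  shows "RS_integral \<sigma> g 0 t = \<sigma> t *v g t - \<sigma> 0 *v g 0 - integral {0..t} (\<lambda>s. \<sigma>' s *v g s)"
  using t by (intro RS_integral_eqI has_RS_integral_by_parts has_vector_derivative_within_subset[OF assms(1)]
      continuous_on_subset[OF assms(2)] continuous_on_subset[OF assms(3)]) auto

section \<open>Stieltjes integrals with a diagonal integrand\<close>

lemma diagonal_matrix_vector_nth:
  fixes A :: "real^'n^'n"
  assumes "\<And>i j. i \<noteq> j \<Longrightarrow> A $ i $ j = (0 :: real)"
  shows "(A *v x) $ i = A $ i $ i * x $ i"
proof -
  have "(A *v x) $ i = (\<Sum>j\<in>UNIV. A $ i $ j * x $ j)" by (simp add: matrix_vector_mult_def)
  also have "\<dots> = (\<Sum>j\<in>UNIV. if j = i then A $ i $ i * x $ i else 0)"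
    using assms by (intro sum.cong) auto
  finally show ?thesis by simp
qed

text \<open>The matrix units E rebuild \<sigma> from its diagonal, so the scalar derivatives combine
  to a matrix-valued one, which by construction is diagonal at every t and not only on S.\<close>

lemma diagonal_C1_derivative:
  fixes \<sigma> :: "real \<Rightarrow> real^'n^'n"
  assumes diag: "\<And>t i j. t \<in> S \<Longrightarrow> i \<noteq> j \<Longrightarrow> \<sigma> t $ i $ j = 0"
    and C1: "\<And>i. C1_on (\<lambda>t. \<sigma> t $ i $ i) S"
  obtains \<sigma>' where "\<And>t. t \<in> S \<Longrightarrow> (\<sigma> has_vector_derivative \<sigma>' t) (at t within S)"
    "continuous_on S \<sigma>'" "\<And>t i j. i \<noteq> j \<Longrightarrow> \<sigma>' t $ i $ j = 0"
proof -
  obtain d where d: "\<And>i t. t \<in> S \<Longrightarrow> ((\<lambda>t. \<sigma> t $ i $ i) has_derivative blinfun_apply (d i t)) (at t within S)"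
    "\<And>i. continuous_on S (d i)"
    using C1 unfolding C1_on_def by metis
  define E where "E = (\<lambda>i. (\<chi> p q. if p = i \<and> q = i then 1 else 0) :: real^'n^'n)"
  have comp: "(\<Sum>i\<in>UNIV. c i *\<^sub>R E i) $ p $ q = (if p = q then c p else 0)" for c p q
  proof -
    have "(\<Sum>i\<in>UNIV. c i *\<^sub>R E i) $ p $ q = (\<Sum>i\<in>UNIV. if i = p then (if p = q then c p else 0) else 0)"
      unfolding sum_component by (intro sum.cong) (auto simp: E_def)
    then show ?thesis by simp
  qed
  define \<sigma>' where "\<sigma>' = (\<lambda>t. \<Sum>i\<in>UNIV. blinfun_apply (d i t) 1 *\<^sub>R E i)"
  have dv: "((\<lambda>t. \<sigma> t $ i $ i) has_vector_derivative blinfun_apply (d i t) 1) (at t within S)" if "t \<in> S" for i t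
    using d(1)[OF that, of i] unfolding has_vector_derivative_def
    by (rule has_derivative_eq_rhs) (auto simp: fun_eq_iff, metis blinfun.scaleR_right mult.right_neutral real_scaleR_def)
  have eq: "(\<Sum>i\<in>UNIV. (\<sigma> t $ i $ i) *\<^sub>R E i) = \<sigma> t" if "t \<in> S" for t
    using diag[OF that] by (simp only: vec_eq_iff comp) auto
  show ?thesis
  proof
    show "(\<sigma> has_vector_derivative \<sigma>' t) (at t within S)" if "t \<in> S" for t
    proof (rule has_vector_derivative_transform[OF that])
      show "((\<lambda>t. \<Sum>i\<in>UNIV. (\<sigma> t $ i $ i) *\<^sub>R E i) has_vector_derivative \<sigma>' t) (at t within S)"
        unfolding \<sigma>'_def
        by (intro has_vector_derivative_sum bounded_linear.has_vector_derivative[OF bounded_linear_scaleR_left] dv that)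
    qed (simp add: eq)
    show "continuous_on S \<sigma>'" unfolding \<sigma>'_def by (intro continuous_intros d)
    show "\<sigma>' t $ i $ j = 0" if "i \<noteq> j" for t i j
      using that by (simp only: \<sigma>'_def comp if_False)
  qed
qed

text \<open>g is merely continuous, but integration by parts shows that \<sigma> g is the primitive
  G of \<sigma>' g. Componentwise G' is the logarithmic derivative of the diagonal entry times G, so
  the quotient of G by that entry, which is the component of g, is constant and equals its value 0
  at 0.\<close>

lemma RS_integral_zero_imp_zero:
  fixes \<sigma> :: "real \<Rightarrow> real^'n^'n" and g :: "real \<Rightarrow> real^'n"
  assumes diag: "\<And>t i j. t \<in> {0..1} \<Longrightarrow> i \<noteq> j \<Longrightarrow> \<sigma> t $ i $ j = 0"
    and pos: "\<And>t i. t \<in> {0..1} \<Longrightarrow> \<sigma> t $ i $ i \<noteq> 0"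
    and C1: "\<And>i. C1_on (\<lambda>t. \<sigma> t $ i $ i) {0..1}"
    and g: "continuous_on {0..1} g" "g 0 = 0"
    and zero: "\<And>t. t \<in> {0..1} \<Longrightarrow> RS_integral \<sigma> g 0 t = 0"
    and t: "t \<in> {0..1}"
  shows "g t = 0"
proof -
  obtain \<sigma>' where \<sigma>': "\<And>t. t \<in> {0..1} \<Longrightarrow> (\<sigma> has_vector_derivative \<sigma>' t) (at t within {0..1})"
    "continuous_on {0..1} \<sigma>'" "\<And>t i j. i \<noteq> j \<Longrightarrow> \<sigma>' t $ i $ j = 0"
    using diagonal_C1_derivative[OF diag C1] by blast
  have eq: "\<sigma> t *v g t = integral {0..t} (\<lambda>s. \<sigma>' s *v g s)" if t: "t \<in> {0..1}" for t
  proof -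
    have "RS_integral \<sigma> g 0 t = \<sigma> t *v g t - \<sigma> 0 *v g 0 - integral {0..t} (\<lambda>s. \<sigma>' s *v g s)"
      using RS_integral_by_parts_unit[OF \<sigma>'(1,2) g(1) t] .
    then show ?thesis using zero[OF t] g(2) by simp
  qed
  have "g t $ i = 0" for i
  proof -
    let ?G = "\<lambda>t. integral {0..t} (\<lambda>s. \<sigma>' s *v g s) $ i"
    have dG: "(?G has_real_derivative \<sigma>' x $ i $ i * g x $ i) (at x within {0..1})" if "x \<in> {0..1}" for x
    proof -
      have "((\<lambda>t. integral {0..t} (\<lambda>s. \<sigma>' s *v g s)) has_vector_derivative \<sigma>' x *v g x) (at x within {0..1})"
        using that by (intro integral_has_vector_derivative continuous_intros \<sigma>' g)
      from bounded_linear.has_vector_derivative[OF bounded_linear_vec_nth this, of i]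
      show ?thesis
        by (simp add: has_real_derivative_iff_has_vector_derivative diagonal_matrix_vector_nth[OF \<sigma>'(3)])
    qed
    have ds: "((\<lambda>t. \<sigma> t $ i $ i) has_real_derivative \<sigma>' x $ i $ i) (at x within {0..1})" if "x \<in> {0..1}" for x
      using bounded_linear.has_vector_derivative[OF bounded_linear_vec_nth
          bounded_linear.has_vector_derivative[OF bounded_linear_vec_nth \<sigma>'(1)[OF that]]]
      by (simp add: has_real_derivative_iff_has_vector_derivative)
    have Gs: "?G x = \<sigma> x $ i $ i * g x $ i" if "x \<in> {0..1}" for x
      using diagonal_matrix_vector_nth[of "\<sigma> x" "g x" i] diag[OF that] by (simp add: eq[OF that, symmetric])
    have "\<exists>c. \<forall>x\<in>{0..1}. ?G x / \<sigma> x $ i $ i = c"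
    proof (rule has_field_derivative_zero_constant)
      fix x :: real assume x: "x \<in> {0..1}"
      have "((\<lambda>x. ?G x / \<sigma> x $ i $ i) has_real_derivative
          (\<sigma>' x $ i $ i * g x $ i * \<sigma> x $ i $ i - ?G x * \<sigma>' x $ i $ i) / (\<sigma> x $ i $ i * \<sigma> x $ i $ i)) (at x within {0..1})"
        using dG[OF x] ds[OF x] pos[OF x] by (intro DERIV_divide)
      then show "((\<lambda>x. ?G x / \<sigma> x $ i $ i) has_real_derivative 0) (at x within {0..1})"
        by (simp add: Gs[OF x] mult_ac)
    qed auto
    then obtain c where "\<And>x. x \<in> {0..1} \<Longrightarrow> ?G x / \<sigma> x $ i $ i = c" by blast
    then have c: "g x $ i = c" if "x \<in> {0..1}" for x
    proof -
      have "?G x / \<sigma> x $ i $ i = g x $ i" unfolding Gs[OF that] using pos[OF that, of i] by simp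
      then show ?thesis using \<open>\<And>x. x \<in> {0..1} \<Longrightarrow> ?G x / \<sigma> x $ i $ i = c\<close>[OF that] by simp
    qed
    show ?thesis using c[of 0] c[OF t] g(2) by simp
  qed
  then show ?thesis by (simp add: vec_eq_iff)
qed

text \<open>For a differentiable integrator the Stieltjes integral becomes an ordinary one: in the
  derivative of the by-parts formula the two terms \<sigma>' g cancel.\<close>

lemma RS_integral_C1_integrator:
  fixes \<sigma> :: "real \<Rightarrow> real^'n^'n" and g w :: "real \<Rightarrow> real^'n"
  assumes diag: "\<And>t i j. t \<in> {0..1} \<Longrightarrow> i \<noteq> j \<Longrightarrow> \<sigma> t $ i $ j = 0"
    and C1: "\<And>i. C1_on (\<lambda>t. \<sigma> t $ i $ i) {0..1}"
    and g: "\<And>x. x \<in> {0..1} \<Longrightarrow> (g has_vector_derivative w x) (at x within {0..1})" "g 0 = 0"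
    and t: "t \<in> {0..1}"
  shows "((\<lambda>s. \<sigma> s *v w s) has_integral RS_integral \<sigma> g 0 t) {0..t}"
proof -
  obtain \<sigma>' where \<sigma>': "\<And>t. t \<in> {0..1} \<Longrightarrow> (\<sigma> has_vector_derivative \<sigma>' t) (at t within {0..1})"
    "continuous_on {0..1} \<sigma>'" "\<And>t i j. i \<noteq> j \<Longrightarrow> \<sigma>' t $ i $ j = 0"
    using diagonal_C1_derivative[OF diag C1] by blast
  let ?G = "\<lambda>t. \<sigma> t *v g t - integral {0..t} (\<lambda>s. \<sigma>' s *v g s)"
  have gc: "continuous_on {0..1} g"
    by (meson continuous_on_eq_continuous_within has_vector_derivative_continuous g(1))
  have RS: "RS_integral \<sigma> g 0 t = ?G t" if t: "t \<in> {0..1}" for t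
  proof -
    have "RS_integral \<sigma> g 0 t = \<sigma> t *v g t - \<sigma> 0 *v g 0 - integral {0..t} (\<lambda>s. \<sigma>' s *v g s)"
      using RS_integral_by_parts_unit[OF \<sigma>'(1,2) gc t] .
    then show ?thesis using g(2) by simp
  qed
  have "((\<lambda>s. \<sigma> s *v w s) has_integral (\<lambda>t. ?G t) t - (\<lambda>t. ?G t) 0) {0..t}"
  proof (rule fundamental_theorem_of_calculus)
    fix x assume x: "x \<in> {0..t}"
    then have x1: "x \<in> {0..1}" using t by auto
    have "((\<lambda>t. ?G t) has_vector_derivative
       (\<sigma> x *v w x + \<sigma>' x *v g x - \<sigma>' x *v g x)) (at x within {0..1})"
      using x1 by (intro has_vector_derivative_diff has_vector_derivative_matrix_vector integral_has_vector_derivative continuous_intros \<sigma>' g gc)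
    then have "((\<lambda>t. ?G t) has_vector_derivative \<sigma> x *v w x) (at x within {0..1})"
      by simp
    then show "((\<lambda>t. ?G t) has_vector_derivative \<sigma> x *v w x) (at x within {0..t})"
      by (rule has_vector_derivative_within_subset) (use t in auto)
  qed (use t in auto)
  then show ?thesis using RS[OF t] g(2) by simp
qed

section \<open>Most probable paths\<close>

lemma solves_ode_unit_unique:
  fixes f :: "real \<Rightarrow> 'a::real_inner \<Rightarrow> 'a"
  assumes lip: "\<And>t x x'. t \<in> {0..1} \<Longrightarrow> norm (f t x - f t x') \<le> L * norm (x - x')"
    and y: "solves_ode_unit f z0 y" and z: "solves_ode_unit f z0 z" and t: "t \<in> {0..1}"
  shows "y t = z t"
proof -
  \<comment> \<open>Gronwall: \<open>|y - z|\<^sup>2 exp (- 2Lt)\<close> is nonincreasing and vanishes at \<open>0\<close>\<close>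
  define d where "d = (\<lambda>t. y t - z t)"
  define q where "q = (\<lambda>t. (d t \<bullet> d t) * exp (- 2 * L * t))"
  let ?D = "\<lambda>t. f t (y t) - f t (z t)"
  let ?q = "\<lambda>x. (d x \<bullet> ?D x + ?D x \<bullet> d x) * exp (- 2 * L * x) + (exp (- 2 * L * x) * (- 2 * L)) * (d x \<bullet> d x)"
  have dd: "(d has_vector_derivative ?D x) (at x within {0..1})" if "x \<in> {0..1}" for x
    unfolding d_def using y z that unfolding solves_ode_unit_def by (intro has_vector_derivative_diff) auto
  have qd: "(q has_real_derivative ?q x) (at x within {0..1})"
    if "x \<in> {0..1}" for x
  proof -
    have "((\<lambda>t. d t \<bullet> d t) has_real_derivative d x \<bullet> ?D x + ?D x \<bullet> d x) (at x within {0..1})"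
      using bounded_bilinear.has_vector_derivative[OF bounded_bilinear_inner dd[OF that] dd[OF that]]
      by (simp add: has_real_derivative_iff_has_vector_derivative)
    moreover have "((\<lambda>t. exp (- 2 * L * t)) has_real_derivative exp (- 2 * L * x) * (- 2 * L)) (at x within {0..1})"
      by (auto intro!: derivative_eq_intros)
    ultimately show ?thesis unfolding q_def by (rule DERIV_mult)
  qed
  have "q t \<le> q 0"
  proof (rule DERIV_nonpos_imp_decreasing_open[of 0 t q])
    show "0 \<le> t" using t by simp
    have "continuous_on {0..1} q"
      using qd by (meson DERIV_continuous continuous_on_eq_continuous_within)
    then show "continuous_on {0..t} q" by (rule continuous_on_subset) (use t in auto)
    fix x assume x: "0 < x" "x < t"
    then have x1: "x \<in> {0..1}" "x \<in> interior {0..1}" using t by (auto simp: interior_atLeastAtMost_real)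
    have "?D x \<bullet> d x \<le> norm (?D x) * norm (d x)" by (rule norm_cauchy_schwarz)
    also have "\<dots> \<le> L * norm (d x) * norm (d x)"
      using lip[OF x1(1), of "y x" "z x"] unfolding d_def by (intro mult_right_mono) auto
    finally have le: "?D x \<bullet> d x \<le> L * (d x \<bullet> d x)" by (simp add: power2_norm_eq_inner[symmetric] power2_eq_square)
    show "\<exists>y. (q has_real_derivative y) (at x) \<and> y \<le> 0"
    proof (intro exI conjI)
      show "(q has_real_derivative ?q x) (at x)"
        using qd[OF x1(1)] unfolding at_within_interior[OF x1(2)] .
      have "?q x
         = 2 * exp (- 2 * L * x) * (?D x \<bullet> d x - L * (d x \<bullet> d x))"
        by (simp add: algebra_simps inner_commute)
      also have "\<dots> \<le> 0" using le by (intro mult_nonneg_nonpos) auto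
      finally show "?q x \<le> 0" .
    qed
  qed
  moreover have "q 0 = 0" using y z by (simp add: q_def d_def solves_ode_unit_def)
  ultimately have "(d t \<bullet> d t) * exp (- 2 * L * t) \<le> 0" by (simp add: q_def)
  then have "d t \<bullet> d t \<le> 0" by (simp add: mult_le_0_iff)
  then have "d t \<bullet> d t = 0" using inner_ge_zero[of "d t"] by (rule antisym)
  then have "d t = 0" by (simp only: inner_eq_zero_iff)
  then show ?thesis by (simp add: d_def)
qed

section \<open>Lipschitz continuity of C1 functions, products and vectors\<close>

lemma C1_unit_Lipschitz:
  fixes f :: "real \<Rightarrow> 'a::real_normed_vector"
  assumes d: "\<And>x. x \<in> {0..1} \<Longrightarrow> (f has_vector_derivative f' x) (at x within {0..1})" and c: "continuous_on {0..1} f'"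
  shows "\<exists>L. L-lipschitz_on {0..1} f"
proof -
  obtain B where B: "\<And>x. x \<in> {0..1} \<Longrightarrow> norm (f' x) \<le> B"
    using continuous_on_unit_bounded[OF c] by blast
  have "0 \<le> B" using order.trans[OF norm_ge_zero B[of 0]] by simp
  have "B-lipschitz_on {0..1} f"
  proof (rule bounded_derivative_imp_lipschitz[where f' = "\<lambda>x h. h *\<^sub>R f' x"])
    show "(f has_derivative (\<lambda>h. h *\<^sub>R f' x)) (at x within {0..1})" if "x \<in> {0..1}" for x
      using d[OF that] by (simp add: has_vector_derivative_def)
    show "onorm (\<lambda>h. h *\<^sub>R f' x) \<le> B" if "x \<in> {0..1}" for x
      using B[OF that] by (intro onorm_le) (auto simp: mult.commute[of B] intro!: mult_left_mono)
  qed (use \<open>0 \<le> B\<close> in auto)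
  then show ?thesis by blast
qed

lemma Lipschitz_mult_bounded:
  fixes f g :: "'a::metric_space \<Rightarrow> real"
  assumes f: "L-lipschitz_on S f" and g: "M-lipschitz_on S g"
    and "\<And>x. x \<in> S \<Longrightarrow> \<bar>f x\<bar> \<le> A" "\<And>x. x \<in> S \<Longrightarrow> \<bar>g x\<bar> \<le> B" "A \<ge> 0" "B \<ge> 0"
  shows "(A * M + B * L)-lipschitz_on S (\<lambda>x. f x * g x)"
proof (rule lipschitz_onI)
  fix x y assume xy: "x \<in> S" "y \<in> S"
  have "f x * g x - f y * g y = f x * (g x - g y) + g y * (f x - f y)" by (simp add: algebra_simps)
  then have "\<bar>f x * g x - f y * g y\<bar> \<le> \<bar>f x\<bar> * \<bar>g x - g y\<bar> + \<bar>g y\<bar> * \<bar>f x - f y\<bar>"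
    by (metis abs_mult abs_triangle_ineq)
  also have "\<dots> \<le> A * (M * dist x y) + B * (L * dist x y)"
    using lipschitz_onD[OF f xy] lipschitz_onD[OF g xy] assms xy
    by (intro add_mono mult_mono) (auto simp: dist_real_def)
  finally show "dist (f x * g x) (f y * g y) \<le> (A * M + B * L) * dist x y"
    by (simp add: dist_real_def algebra_simps)
qed (use assms in \<open>auto simp: lipschitz_on_def\<close>)

lemma Lipschitz_componentwise:
  fixes f :: "'a::metric_space \<Rightarrow> real^'n"
  assumes "\<And>i. \<exists>L. L-lipschitz_on S (\<lambda>x. f x $ i)"
  shows "\<exists>L. L-lipschitz_on S f"
proof -
  obtain L where L: "\<And>i. (L i)-lipschitz_on S (\<lambda>x. f x $ i)" using assms by metis
  have "(\<Sum>i\<in>UNIV. L i)-lipschitz_on S f"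
  proof (rule lipschitz_onI)
    fix x y assume xy: "x \<in> S" "y \<in> S"
    have "dist (f x) (f y) \<le> (\<Sum>i\<in>UNIV. \<bar>(f x - f y) $ i\<bar>)"
      unfolding dist_norm by (rule norm_le_l1_cart)
    also have "\<dots> \<le> (\<Sum>i\<in>UNIV. L i * dist x y)"
      using lipschitz_onD[OF L xy] by (intro sum_mono) (simp add: dist_real_def)
    finally show "dist (f x) (f y) \<le> (\<Sum>i\<in>UNIV. L i) * dist x y" by (simp add: sum_distrib_right)
  qed (use L in \<open>auto simp: lipschitz_on_def intro!: sum_nonneg\<close>)
  then show ?thesis by blast
qed

lemma K_op_0: "K_op H u 0 = 0"
  by (simp add: K_op_def set_lebesgue_integral_def)

lemma K_sigma_zero:
  fixes \<sigma> :: "real \<Rightarrow> real^'n^'n"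
  shows "K_sigma H \<sigma> (\<lambda>_. 0) t = 0"
proof -
  have "K_op H (\<lambda>_. 0 :: real^'n) = (\<lambda>_. 0)" by (simp add: K_op_def set_lebesgue_integral_def fun_eq_iff)
  then show ?thesis
    unfolding K_sigma_def
    by (intro RS_integral_eqI) (auto simp: has_RS_integral_def case_prod_unfold intro!: exI[of _ 1])
qed

text \<open>The chosen preimage is determined only up to a null set, so the conclusion holds almost
  everywhere; the endpoints 0 and 1, which injectivity on the open interval leaves out, are null as
  well.\<close>

lemma K_sigma_inv_zero:
  fixes \<sigma> :: "real \<Rightarrow> real^'n^'n"
  assumes H: "0 < H" "H < 1"
    and diag: "\<And>t i j. t \<in> {0..1} \<Longrightarrow> i \<noteq> j \<Longrightarrow> \<sigma> t $ i $ j = 0"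
    and pos: "\<And>t i. t \<in> {0..1} \<Longrightarrow> \<sigma> t $ i $ i \<noteq> 0"
    and C1: "\<And>i. C1_on (\<lambda>t. \<sigma> t $ i $ i) {0..1}"
    and h: "\<And>t. t \<in> {0..1} \<Longrightarrow> h t = 0"
  shows "AE s in lborel. s \<in> {0..1} \<longrightarrow> K_sigma_inv H \<sigma> h s = 0"
proof -
  let ?u = "K_sigma_inv H \<sigma> h"
  \<comment> \<open>The zero function shows that the choice ranges over a nonempty set, so it
    returns a genuine preimage of the zero path.\<close>
  have "(\<lambda>_. 0) \<in> (L2_unit :: (real \<Rightarrow> real^'n) set)"
    by (simp add: L2_unit_def set_borel_measurable_def set_integrable_def)
  then have "\<exists>u. u \<in> L2_unit \<and> (\<forall>t\<in>{0..1}. K_sigma H \<sigma> u t = h t)"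
    using h by (intro exI[of _ "\<lambda>_. 0"]) (simp add: K_sigma_zero)
  then have "?u \<in> L2_unit \<and> (\<forall>t\<in>{0..1}. K_sigma H \<sigma> ?u t = h t)"
    unfolding K_sigma_inv_def by (rule someI_ex)
  then have u: "?u \<in> L2_unit" "\<And>t. t \<in> {0..1} \<Longrightarrow> RS_integral \<sigma> (K_op H ?u) 0 t = 0"
    by (auto simp: h K_sigma_def)
  have "K_op H ?u t = 0" if "t \<in> {0<..1}" for t
    using that by (intro RS_integral_zero_imp_zero[OF diag pos C1 K_op_continuous[OF H u(1)] K_op_0 u(2)]) auto
  from K_op_injective[OF H u(1) this]
  have "AE s in lborel. s \<in> {0<..<1} \<longrightarrow> ?u s = 0" .
  then show ?thesis
    using AE_lborel_singleton[of 0] AE_lborel_singleton[of 1] by eventually_elim auto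
qed

text \<open>Divide out the diagonal: with w the quotient of \<beta> by the diagonal of \<sigma>,
  choose u whose Volterra image is the primitive of w. That image is a C1 integrator, so its
  Stieltjes integral against \<sigma> is the integral of \<sigma> w = \<beta>, which is h. For H >
  1/2 the quotient remains Lipschitz because the inverse diagonal entries are C1.\<close>

lemma C1_path_in_K_sigma_range:
  fixes \<sigma> :: "real \<Rightarrow> real^'n^'n"
  assumes H: "0 < H" "H < 1"
    and diag: "\<And>t i j. t \<in> {0..1} \<Longrightarrow> i \<noteq> j \<Longrightarrow> \<sigma> t $ i $ j = 0"
    and pos: "\<And>t i. t \<in> {0..1} \<Longrightarrow> \<sigma> t $ i $ i \<noteq> 0"
    and C1: "\<And>i. C1_on (\<lambda>t. \<sigma> t $ i $ i) {0..1}"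
    and h: "\<And>t. t \<in> {0..1} \<Longrightarrow> (h has_vector_derivative \<beta> t) (at t within {0..1})" "h 0 = 0"
    and \<beta>: "continuous_on {0..1} \<beta>" "1/2 < H \<Longrightarrow> \<exists>L. L-lipschitz_on {0..1} \<beta>"
  shows "h \<in> K_sigma_range H \<sigma>"
proof -
  obtain \<sigma>' where \<sigma>': "\<And>t. t \<in> {0..1} \<Longrightarrow> (\<sigma> has_vector_derivative \<sigma>' t) (at t within {0..1})"
    "continuous_on {0..1} \<sigma>'" "\<And>t i j. i \<noteq> j \<Longrightarrow> \<sigma>' t $ i $ j = 0"
    using diagonal_C1_derivative[OF diag C1] by blast
  have \<sigma>c: "continuous_on {0..1} \<sigma>"
    by (meson continuous_on_eq_continuous_within has_vector_derivative_continuous \<sigma>'(1))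
  define w where "w = (\<lambda>t. \<chi> i. inverse (\<sigma> t $ i $ i) * \<beta> t $ i)"
  have wc: "continuous_on {0..1} w"
    unfolding w_def using pos by (intro continuous_intros \<sigma>c \<beta>) auto
  have wl: "\<exists>L. L-lipschitz_on {0..1} w" if half: "1/2 < H"
  proof (rule Lipschitz_componentwise)
    fix i
    obtain L where L: "L-lipschitz_on {0..1} \<beta>" using \<beta>(2)[OF half] by blast
    have L': "L-lipschitz_on {0..1} (\<lambda>x. \<beta> x $ i)"
    proof (rule lipschitz_onI)
      fix x y :: real assume "x \<in> {0..1}" "y \<in> {0..1}"
      then show "dist (\<beta> x $ i) (\<beta> y $ i) \<le> L * dist x y"
        using order.trans[OF dist_vec_nth_le lipschitz_onD[OF L]] by blast
    qed (use L in \<open>simp add: lipschitz_on_def\<close>)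
    let ?d = "\<lambda>x. - (inverse (\<sigma> x $ i $ i) * \<sigma>' x $ i $ i * inverse (\<sigma> x $ i $ i))"
    have "\<exists>M. M-lipschitz_on {0..1} (\<lambda>x. inverse (\<sigma> x $ i $ i))"
    proof (rule C1_unit_Lipschitz)
      fix x :: real assume x: "x \<in> {0..1}"
      have "((\<lambda>t. \<sigma> t $ i $ i) has_real_derivative \<sigma>' x $ i $ i) (at x within {0..1})"
        using bounded_linear.has_vector_derivative[OF bounded_linear_vec_nth
            bounded_linear.has_vector_derivative[OF bounded_linear_vec_nth \<sigma>'(1)[OF x]]]
        by (simp add: has_real_derivative_iff_has_vector_derivative)
      then have "((\<lambda>x. inverse (\<sigma> x $ i $ i)) has_real_derivative ?d x) (at x within {0..1})"
        by (rule DERIV_cong[OF DERIV_inverse_fun]) (use pos[OF x] in \<open>simp_all add: mult_ac\<close>)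
      then show "((\<lambda>x. inverse (\<sigma> x $ i $ i)) has_vector_derivative ?d x) (at x within {0..1})"
        unfolding has_real_derivative_iff_has_vector_derivative .
    next
      show "continuous_on {0..1} (\<lambda>x. ?d x)"
        using pos by (intro continuous_intros \<sigma>c \<sigma>'(2)) auto
    qed
    then obtain M where M: "M-lipschitz_on {0..1} (\<lambda>x. inverse (\<sigma> x $ i $ i))" by blast
    have "\<exists>A\<ge>0. \<forall>x\<in>{0..1}. \<bar>g x\<bar> \<le> A" if lg: "K-lipschitz_on {0..1} g" for g :: "real \<Rightarrow> real" and K
    proof -
      obtain A where A: "\<And>x. x \<in> {0..1} \<Longrightarrow> norm (g x) \<le> A"
        using continuous_on_unit_bounded[OF lipschitz_on_continuous_on[OF lg]] by blast
      have "\<bar>g x\<bar> \<le> \<bar>A\<bar>" if "x \<in> {0..1}" for x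
        using A[OF that] by simp
      then show ?thesis by (intro exI[of _ "\<bar>A\<bar>"]) auto
    qed
    from this[OF L'] this[OF M] obtain A B where AB: "A \<ge> 0" "\<And>x. x \<in> {0..1} \<Longrightarrow> \<bar>inverse (\<sigma> x $ i $ i)\<bar> \<le> A"
      "B \<ge> 0" "\<And>x. x \<in> {0..1} \<Longrightarrow> \<bar>\<beta> x $ i\<bar> \<le> B" by blast
    show "\<exists>L. L-lipschitz_on {0..1} (\<lambda>x. w x $ i)"
      using Lipschitz_mult_bounded[OF M L' AB(2) AB(4) AB(1) AB(3)] unfolding w_def by auto
  qed
  obtain u where u: "u \<in> L2_unit" "\<And>t. t \<in> {0<..1} \<Longrightarrow> K_op H u t = (LBINT s:{0<..<t}. w s)"
    using K_op_surjective[OF H wc wl] by blast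
  have Ku: "K_op H u t = integral {0..t} w" if t: "t \<in> {0..1}" for t
  proof (cases "t = 0")
    case True
    then show ?thesis by (simp add: K_op_0)
  next
    case False
    have "set_integrable lborel {0..t} w"
      using t by (intro borel_integrable_atLeastAtMost' continuous_on_subset[OF wc]) auto
    then have "set_integrable lborel {0<..<t} w" by (rule set_integrable_subset) auto
    then have "(LBINT s:{0<..<t}. w s) = integral {0<..<t} w" by (rule set_borel_integral_eq_integral)
    then show ?thesis using u(2)[of t] t False by (simp add: integral_open_interval_real)
  qed
  have "K_sigma H \<sigma> u t = h t" if t: "t \<in> {0..1}" for t
  proof -
    have "((\<lambda>s. \<sigma> s *v w s) has_integral RS_integral \<sigma> (K_op H u) 0 t) {0..t}"
    proof (rule RS_integral_C1_integrator[where g = "K_op H u", OF diag C1 _ K_op_0 t])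
      fix x :: real assume x: "x \<in> {0..1}"
      show "(K_op H u has_vector_derivative w x) (at x within {0..1})"
        by (rule has_vector_derivative_transform[OF x _ integral_has_vector_derivative[OF wc x]]) (rule Ku)
    qed
    moreover have "\<sigma> s *v w s = \<beta> s" if "s \<in> {0..t}" for s
    proof -
      have s: "s \<in> {0..1}" using that t by auto
      show ?thesis
        using pos[OF s] diag[OF s] by (simp add: vec_eq_iff diagonal_matrix_vector_nth w_def)
    qed
    ultimately have "(\<beta> has_integral RS_integral \<sigma> (K_op H u) 0 t) {0..t}"
      using has_integral_cong[of "{0..t}" "\<lambda>s. \<sigma> s *v w s" \<beta>] by simp
    moreover have "(\<beta> has_integral (h t - h 0)) {0..t}"
      using t by (intro fundamental_theorem_of_calculus has_vector_derivative_within_subset[OF h(1)]) auto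
    ultimately show ?thesis unfolding K_sigma_def h(2) by (metis diff_zero has_integral_unique)
  qed
  then show ?thesis unfolding K_sigma_range_def using u(1) by blast
qed

lemma OM_functional_constant_divergence:
  fixes b :: "real \<Rightarrow> real^'m \<Rightarrow> real^'n \<Rightarrow> real^'n"
  assumes "\<forall>t\<in>{0..1}. \<forall>x y. divergence (\<lambda>y. b t x y) y = C"
  shows "OM_functional H a b \<sigma> x0 y0 \<phi> = 1/2 * (LBINT s:{0..1}. (norm (K_sigma_inv H \<sigma>
     (\<lambda>t. \<phi> t - y0 - (LBINT v:{0..t}. b v (companion a x0 \<phi> v) (\<phi> v))) s))\<^sup>2) + fbm_d H / 2 * C"
proof -
  have "(LBINT s:{0..1}. divergence (\<lambda>y. b s (companion a x0 \<phi> s) y) (\<phi> s)) = (LBINT s:{0..1::real}. C)"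
    using assms by (intro set_lebesgue_integral_cong) auto
  then show ?thesis by (simp add: OM_functional_def Let_def set_lebesgue_integral_def)
qed

theorem theorem4p1:
  fixes H C :: real
    and a :: "real \<Rightarrow> real^'m \<Rightarrow> real^'n \<Rightarrow> real^'m"
    and b :: "real \<Rightarrow> real^'m \<Rightarrow> real^'n \<Rightarrow> real^'n"
    and \<sigma> :: "real \<Rightarrow> real^'n^'n"
    and x0 :: "real^'m" and y0 :: "real^'n"
  assumes "H \<in> {1/4<..<1}"
    and "assumption_A H a b \<sigma>"
    and "\<forall>t\<in>{0..1}. \<forall>x y. divergence (\<lambda>y. b t x y) y = C"
  shows "path_preserving H a b \<sigma> x0 y0 \<and>
    (\<forall>\<psi> \<phi>. solves_deterministic_system a b x0 y0 \<psi> \<phi> \<longrightarrow>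
       \<phi> \<in> admissible H \<sigma> y0 \<and>
       OM_functional H a b \<sigma> x0 y0 \<phi> = (INF \<phi>'\<in>admissible H \<sigma> y0. OM_functional H a b \<sigma> x0 y0 \<phi>'))"
proof -
  have H: "0 < H" "H < 1" using assms(1) by auto
  have diag: "\<And>t i j. t \<in> {0..1} \<Longrightarrow> i \<noteq> j \<Longrightarrow> \<sigma> t $ i $ j = 0"
    and C1: "\<And>i. C1_on (\<lambda>t. \<sigma> t $ i $ i) {0..1}"
    using assms(2) unfolding assumption_A_def by auto
  have pos: "\<sigma> t $ i $ i \<noteq> 0" if "t \<in> {0..1}" for t i
    using assms(2) that unfolding assumption_A_def by (metis less_le_not_le order.trans)
  have bc: "continuous_on ({0..1} \<times> UNIV \<times> UNIV) (\<lambda>(t, x, y). b t x y)"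
    and bl: "1/2 < H \<Longrightarrow> \<exists>L. L-lipschitz_on ({0..1} \<times> UNIV \<times> UNIV) (\<lambda>(t, x, y). b t x y)"
    using assms(2) H unfolding assumption_A_def by auto
  obtain L where aL: "L-lipschitz_on ({0..1} \<times> UNIV \<times> UNIV) (\<lambda>(t, x, y). a t x y)"
    using assms(2) unfolding assumption_A_def by auto
  have ac: "continuous_on ({0..1} \<times> UNIV \<times> UNIV) (\<lambda>(t, x, y). a t x y)"
    by (rule lipschitz_on_continuous_on[OF aL])
  have alip: "norm (a t x y - a t x' y) \<le> L * norm (x - x')" if "t \<in> {0..1}" for t x x' y
    using lipschitz_onD[OF aL, of "(t, x, y)" "(t, x', y)"] that by (simp add: dist_norm norm_Pair)
  note OM = OM_functional_constant_divergence[OF assms(3)]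
  \<comment> \<open>Valid for every path: the first term is nonnegative whatever function the choice
    of the inverse returns, and it is 0 by default if the square is not integrable.\<close>
  have lower: "fbm_d H / 2 * C \<le> OM_functional H a b \<sigma> x0 y0 \<phi>" for \<phi>
    unfolding OM set_lebesgue_integral_def by (auto intro!: integral_nonneg_AE)
  have main: "\<phi> \<in> admissible H \<sigma> y0 \<and> OM_functional H a b \<sigma> x0 y0 \<phi> = fbm_d H / 2 * C"
    if sol: "solves_deterministic_system a b x0 y0 \<psi> \<phi>" for \<psi> \<phi>
  proof -
    have init: "\<psi> 0 = x0" "\<phi> 0 = y0"
      using sol by (auto simp: solves_deterministic_system_def solves_ode_unit_def)
    have "((\<lambda>t. (\<psi> t, \<phi> t)) has_vector_derivative (a t (\<psi> t) (\<phi> t), b t (\<psi> t) (\<phi> t))) (at t within {0..1})"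
      if "t \<in> {0..1}" for t
      using sol that by (auto simp: solves_deterministic_system_def solves_ode_unit_def)
    from bounded_linear.has_vector_derivative[OF bounded_linear_fst this] bounded_linear.has_vector_derivative[OF bounded_linear_snd this]
    have \<psi>d: "\<And>t. t \<in> {0..1} \<Longrightarrow> (\<psi> has_vector_derivative a t (\<psi> t) (\<phi> t)) (at t within {0..1})"
      and \<phi>d: "\<And>t. t \<in> {0..1} \<Longrightarrow> (\<phi> has_vector_derivative b t (\<psi> t) (\<phi> t)) (at t within {0..1})"
      by simp_all
    have \<psi>c: "continuous_on {0..1} \<psi>" and \<phi>c: "continuous_on {0..1} \<phi>"
      by (meson continuous_on_eq_continuous_within has_vector_derivative_continuous \<psi>d \<phi>d)+
    have \<psi>s: "solves_ode_unit (\<lambda>t x. a t x (\<phi> t)) x0 \<psi>"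
      using init \<psi>d by (simp add: solves_ode_unit_def)
    then have "solves_ode_unit (\<lambda>t x. a t x (\<phi> t)) x0 (companion a x0 \<phi>)"
      using someI[of "solves_ode_unit (\<lambda>t x. a t x (\<phi> t)) x0" \<psi>] by (simp add: companion_def)
    \<comment> \<open>\<open>companion\<close> is an arbitrary choice among the solutions; Lipschitz
      continuity of a in x makes it coincide with \<psi> on [0, 1].\<close>
    then have comp: "companion a x0 \<phi> t = \<psi> t" if "t \<in> {0..1}" for t
      using \<psi>s that by (intro solves_ode_unit_unique[where L = L]) (auto intro: alip)
    define \<beta> where "\<beta> = (\<lambda>t. b t (\<psi> t) (\<phi> t))"
    have curve: "continuous_on {0..1} (\<lambda>t. (t, \<psi> t, \<phi> t))" "(\<lambda>t. (t, \<psi> t, \<phi> t)) ` {0..1} \<subseteq> {0..1} \<times> UNIV \<times> UNIV"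
      by (auto intro!: continuous_intros \<psi>c \<phi>c)
    have \<beta>c: "continuous_on {0..1} \<beta>"
      using continuous_on_compose2[OF bc curve] by (simp add: \<beta>_def)
    have \<alpha>c: "continuous_on {0..1} (\<lambda>t. a t (\<psi> t) (\<phi> t))"
      using continuous_on_compose2[OF ac curve] by simp
    have \<beta>l: "\<exists>L. L-lipschitz_on {0..1} \<beta>" if "1/2 < H"
    proof -
      \<comment> \<open>The curve is C1 because a and b are continuous along it, hence Lipschitz;
        composition with the Lipschitz function b then makes \<beta> Lipschitz.\<close>
      have "\<exists>M. M-lipschitz_on {0..1} (\<lambda>t. (t, \<psi> t, \<phi> t))"
      proof (rule C1_unit_Lipschitz)
        show "((\<lambda>t. (t, \<psi> t, \<phi> t)) has_vector_derivative (1, a t (\<psi> t) (\<phi> t), \<beta> t)) (at t within {0..1})" if "t \<in> {0..1}" for t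
          unfolding \<beta>_def by (intro has_vector_derivative_Pair has_vector_derivative_id \<psi>d \<phi>d that)
        show "continuous_on {0..1} (\<lambda>t. (1 :: real, a t (\<psi> t) (\<phi> t), \<beta> t))"
          by (intro continuous_intros \<alpha>c \<beta>c)
      qed
      then obtain M where M: "M-lipschitz_on {0..1} (\<lambda>t. (t, \<psi> t, \<phi> t))" by blast
      obtain K where K: "K-lipschitz_on ({0..1} \<times> UNIV \<times> UNIV) (\<lambda>(t, x, y). b t x y)" using bl \<open>1/2 < H\<close> by blast
      have "(K * M)-lipschitz_on {0..1} (\<lambda>t. (\<lambda>(t, x, y). b t x y) (t, \<psi> t, \<phi> t))"
        using M lipschitz_on_subset[OF K curve(2)] by (rule lipschitz_on_compose2)
      then show ?thesis by (auto simp: \<beta>_def)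
    qed
    have adm: "\<phi> \<in> admissible H \<sigma> y0"
    proof -
      have "((\<lambda>t. \<phi> t - y0) has_vector_derivative \<beta> t) (at t within {0..1})" if "t \<in> {0..1}" for t
        using has_vector_derivative_diff[OF \<phi>d[OF that] has_vector_derivative_const[of y0]] by (simp add: \<beta>_def)
      then show ?thesis
        unfolding admissible_def using C1_path_in_K_sigma_range[OF H diag pos C1 _ _ \<beta>c \<beta>l] init by simp
    qed
    let ?h = "\<lambda>t. \<phi> t - y0 - (LBINT v:{0..t}. b v (companion a x0 \<phi> v) (\<phi> v))"
    have "?h t = 0" if t: "t \<in> {0..1}" for t
    proof -
      have "(LBINT v:{0..t}. b v (companion a x0 \<phi> v) (\<phi> v)) = (LBINT v:{0..t}. \<beta> v)"
        using t by (intro set_lebesgue_integral_cong) (auto simp: comp \<beta>_def)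
      also have "\<dots> = \<phi> t - \<phi> 0"
        unfolding set_lebesgue_integral_def
        using t by (intro integral_FTC_Icc has_vector_derivative_within_subset[OF \<phi>d, folded \<beta>_def] continuous_on_subset[OF \<beta>c])
          (auto simp: \<beta>_def intro: has_vector_derivative_within_subset[OF \<phi>d])
      finally show ?thesis using init by simp
    qed
    then have "AE s in lborel. s \<in> {0..1} \<longrightarrow> K_sigma_inv H \<sigma> ?h s = 0"
      by (intro K_sigma_inv_zero[OF H diag pos C1, where h = ?h])
    then have "(LBINT s:{0..1}. (norm (K_sigma_inv H \<sigma> ?h s))\<^sup>2) = 0"
      unfolding set_lebesgue_integral_def
      by (intro integral_eq_zero_AE) (auto elim!: eventually_mono simp: indicator_def split: if_splits)
    then show ?thesis using adm unfolding OM by simp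
  qed
  have "free_terminal_most_probable_path H a b \<sigma> x0 y0 \<phi>"
    if "solves_deterministic_system a b x0 y0 \<psi> \<phi>" for \<psi> \<phi>
    using main[OF that] lower unfolding free_terminal_most_probable_path_def is_arg_min_def
    by (metis not_less)
  moreover have "OM_functional H a b \<sigma> x0 y0 \<phi> = (INF \<phi>'\<in>admissible H \<sigma> y0. OM_functional H a b \<sigma> x0 y0 \<phi>')"
    if "solves_deterministic_system a b x0 y0 \<psi> \<phi>" for \<psi> \<phi>
  proof (rule cInf_eq_minimum[symmetric])
    show "OM_functional H a b \<sigma> x0 y0 \<phi> \<in> OM_functional H a b \<sigma> x0 y0 ` admissible H \<sigma> y0"
      using main[OF that] by blast
    show "OM_functional H a b \<sigma> x0 y0 \<phi> \<le> J" if "J \<in> OM_functional H a b \<sigma> x0 y0 ` admissible H \<sigma> y0" for J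
      using main[OF \<open>solves_deterministic_system a b x0 y0 \<psi> \<phi>\<close>] lower that by (metis imageE)
  qed
  ultimately show ?thesis using main unfolding path_preserving_def by blast
qed

end
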